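(* Let $|\operatorname{Re}a|<\operatorname{Re}b$ and $x\in\mathbb{C}\setminus(-\infty,0]$. Then $$\int_0^\infty c\,J_0(cx)\,(b^2+c^2-a^2)\left[(a^2+b^2+c^2)^2-4a^2b^2\right]^{-3/2}dc=\frac{x}{2b}\,I_0(ax)\,K_1(bx).$$
   Context: $J_\nu$ is the Bessel function of the first kind, and $I_\nu$ and $K_\nu$ are the modified Bessel functions of the first and second kind, of order $\nu$.
   Formalization: For nonreal x the integral diverges; there it means the analytic continuation in x from x>0, with K_1(bx) continued (taken at log b + log x). The power -3/2 uses the branch continuous in c on [0,∞) that is principal for large c, since the principal power can jump. *)

theory Defs
  imports "HOL-Complex_Analysis.Complex_Analysis"
begin

section \<open>Bessel functions of complex order and argument\<close>

text \<open>The common entire factor of \<open>J\<close> and \<open>I\<close>.  The reciprocal Gamma function makes the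
  formula valid for negative integer orders as well.\<close>

definition bessel_series :: "complex \<Rightarrow> complex \<Rightarrow> complex" where
  "bessel_series \<nu> w = (\<Sum>k. rGamma (\<nu> + of_nat k + 1) * w ^ k / fact k)"

text \<open>In the library \<open>0 powr 0 = 0\<close>, whereas \<open>J\<^sub>0\<close> and \<open>I\<^sub>0\<close> must be \<open>1\<close> at the origin; hence the
  case distinction in the prefactor.\<close>

definition bessel_prefactor :: "complex \<Rightarrow> complex \<Rightarrow> complex" where
  "bessel_prefactor \<nu> z = (if \<nu> = 0 then 1 else (z / 2) powr \<nu>)"

definition besselJ :: "complex \<Rightarrow> complex \<Rightarrow> complex" where
  "besselJ \<nu> z = bessel_prefactor \<nu> z * bessel_series \<nu> (- ((z / 2)\<^sup>2))"

definition besselI :: "complex \<Rightarrow> complex \<Rightarrow> complex" where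
  "besselI \<nu> z = bessel_prefactor \<nu> z * bessel_series \<nu> ((z / 2)\<^sup>2)"

text \<open>\<open>K\<^sub>\<nu>\<close> is multivalued with its only branch point at the origin.  The functions with suffix
  \<open>_log\<close> live on the Riemann surface of the logarithm: their second argument \<open>l\<close> stands for the
  point over \<open>exp l\<close> with logarithm \<open>l\<close>.  For integer order, \<open>K\<close> is the limit of the quotient
  defining it at the other orders.\<close>

definition besselI_log :: "complex \<Rightarrow> complex \<Rightarrow> complex" where
  "besselI_log \<nu> l = exp (\<nu> * (l - Ln 2)) * bessel_series \<nu> ((exp l / 2)\<^sup>2)"

definition besselK_log_quotient :: "complex \<Rightarrow> complex \<Rightarrow> complex" where
  "besselK_log_quotient l \<nu> =
     of_real pi / 2 * (besselI_log (- \<nu>) l - besselI_log \<nu> l) / sin (of_real pi * \<nu>)"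

definition besselK_log :: "complex \<Rightarrow> complex \<Rightarrow> complex" where
  "besselK_log \<nu> l =
     (if \<nu> \<in> \<int> then Lim (at \<nu>) (besselK_log_quotient l) else besselK_log_quotient l \<nu>)"

definition besselK :: "complex \<Rightarrow> complex \<Rightarrow> complex" where
  "besselK \<nu> z = besselK_log \<nu> (Ln z)"

lemma besselI_log_Ln:
  assumes "z \<noteq> 0"
  shows "besselI_log \<nu> (Ln z) = besselI \<nu> z"
proof -
  have "Ln (z / 2) = Ln z - Ln 2"
    using Ln_divide_of_real[of 2 z] assms by (simp add: Ln_of_real[of 2, simplified])
  then show ?thesis
    using assms by (auto simp: besselI_log_def besselI_def bessel_prefactor_def powr_def)
qed

lemma besselK_nonint:
  assumes "z \<noteq> 0" "\<nu> \<notin> \<int>"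
  shows "besselK \<nu> z = of_real pi / 2 * (besselI (- \<nu>) z - besselI \<nu> z) / sin (of_real pi * \<nu>)"
  using assms by (simp add: besselK_def besselK_log_def besselK_log_quotient_def besselI_log_Ln)

lemma besselK_int:
  assumes "z \<noteq> 0" "\<nu> \<in> \<int>"
  shows "besselK \<nu> z =
    Lim (at \<nu>) (\<lambda>\<mu>. of_real pi / 2 * (besselI (- \<mu>) z - besselI \<mu> z) / sin (of_real pi * \<mu>))"
  using assms
  by (simp add: besselK_def besselK_log_def besselK_log_quotient_def[abs_def] besselI_log_Ln)

lemma besselK_log_mult:
  assumes "z \<noteq> 0" "w \<noteq> 0" "Arg z + Arg w \<in> {-pi<..pi}"
  shows "besselK_log \<nu> (Ln z + Ln w) = besselK \<nu> (z * w)"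
  using assms Ln_times_simple[of z w] by (simp add: besselK_def Arg_eq_Im_Ln)

lemma besselI_0_0: "besselI 0 0 = 1" and besselJ_0_0: "besselJ 0 0 = 1"
proof -
  have "(\<Sum>k. rGamma (of_nat k + 1) * 0 ^ k / fact k) = (1::complex)"
    by (subst suminf_finite[of "{0}"]) (auto simp: rGamma_inverse_Gamma)
  then show "besselI 0 0 = 1" "besselJ 0 0 = 1"
    by (simp_all add: besselI_def besselJ_def bessel_prefactor_def bessel_series_def)
qed


section \<open>Powers of a nonvanishing function on the half-line\<close>

text \<open>For complex \<open>a\<close>, \<open>b\<close> the expression \<open>(a\<^sup>2 + b\<^sup>2 + c\<^sup>2)\<^sup>2 - 4 a\<^sup>2 b\<^sup>2\<close> may cross the negative real axis
  as \<open>c\<close> runs through \<open>[0, \<infinity>)\<close> (for instance \<open>a = 0\<close>, \<open>Arg b > pi / 4\<close>), and the principal value of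
  a fractional power is then discontinuous.  The power is taken with the logarithm that is continuous
  on \<open>[0, \<infinity>)\<close> and agrees with the principal one for large \<open>c\<close>.\<close>

definition is_log_branch :: "(real \<Rightarrow> complex) \<Rightarrow> (real \<Rightarrow> complex) \<Rightarrow> bool" where
  "is_log_branch p L \<longleftrightarrow> continuous_on {0..} L \<and> (\<forall>c\<ge>0. exp (L c) = p c) \<and>
     ((\<lambda>c. Im (L c)) \<longlongrightarrow> 0) at_top"

definition branch_powr :: "(real \<Rightarrow> complex) \<Rightarrow> complex \<Rightarrow> real \<Rightarrow> complex" where
  "branch_powr p s c = exp (s * (SOME L. is_log_branch p L) c)"

lemma is_log_branch_unique:
  assumes "is_log_branch p L" "is_log_branch p M" "c \<ge> 0"
  shows "L c = M c"
proof -
  define d where "d = (\<lambda>c. (L c - M c) / (2 * of_real pi * \<i>))"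
  have cont: "continuous_on {0..} d"
    using assms unfolding d_def is_log_branch_def by (intro continuous_intros) auto
  have int: "d y \<in> \<int>" if "y \<ge> 0" for y
  proof -
    have "exp (L y) = exp (M y)" using assms that by (simp add: is_log_branch_def)
    then obtain n :: int where "L y = M y + of_int (2 * n) * of_real pi * \<i>"
      by (auto simp: exp_eq)
    then have "d y = of_int n" by (simp add: d_def)
    then show ?thesis by simp
  qed
  have "d constant_on {0..}"
  proof (rule continuous_discrete_range_constant)
    show "connected {0::real..}" by (simp add: convex_connected)
    fix x :: real assume x: "x \<in> {0..}"
    show "\<exists>e>0. \<forall>y. y \<in> {0..} \<and> d y \<noteq> d x \<longrightarrow> e \<le> norm (d y - d x)"
    proof (intro exI[of _ 1] conjI allI impI)
      fix y assume y: "y \<in> {0..} \<and> d y \<noteq> d x"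
      then have "d y - d x \<in> \<int>" "d y - d x \<noteq> 0" using int x by auto
      then obtain m :: int where m: "d y - d x = of_int m" "m \<noteq> 0"
        by (metis Ints_cases of_int_0)
      then have "1 \<le> \<bar>m\<bar>" by simp
      then have "1 \<le> \<bar>real_of_int m\<bar>" by linarith
      then show "1 \<le> norm (d y - d x)" by (simp add: m(1) norm_of_int)
    qed auto
  qed (rule cont)
  then obtain k where k: "\<And>y. y \<ge> 0 \<Longrightarrow> d y = k" by (auto simp: constant_on_def)
  have kint: "k \<in> \<int>" using int[of 0] k[of 0] by simp
  have "((\<lambda>y. (Im (L y) - Im (M y)) / (2 * pi)) \<longlongrightarrow> (0 - 0) / (2 * pi)) at_top"
    using assms unfolding is_log_branch_def by (intro tendsto_intros) auto
  moreover have "eventually (\<lambda>y. (Im (L y) - Im (M y)) / (2 * pi) = Re k) at_top"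
    using eventually_ge_at_top[of 0]
  proof eventually_elim
    case (elim y)
    have "L y - M y = 2 * of_real pi * \<i> * k" using k[OF elim] by (auto simp: d_def field_simps)
    then have "Im (L y - M y) = 2 * pi * Re k" by simp
    then show ?case by simp
  qed
  ultimately have "((\<lambda>y::real. Re k) \<longlongrightarrow> 0) at_top"
    using tendsto_cong by fastforce
  then have "Re k = 0" by (simp add: tendsto_const_iff)
  then have "k = 0" using kint by (auto elim!: Ints_cases)
  then show ?thesis using k[OF assms(3)] by (simp add: d_def)
qed

lemma branch_powr_eq:
  assumes "is_log_branch p L" "c \<ge> 0"
  shows "branch_powr p s c = exp (s * L c)"
  using is_log_branch_unique[OF someI[of "is_log_branch p", OF assms(1)] assms]
  by (simp add: branch_powr_def)

lemma sq_plus_sq_notin_nonpos_Reals: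
  assumes "Re w \<noteq> 0"
  shows "(of_real c)\<^sup>2 + w\<^sup>2 \<notin> \<real>\<^sub>\<le>\<^sub>0"
proof
  assume *: "(of_real c)\<^sup>2 + w\<^sup>2 \<in> \<real>\<^sub>\<le>\<^sub>0"
  then have "Im w = 0" using assms by (auto simp: complex_nonpos_Reals_iff power2_eq_square)
  then have "c\<^sup>2 + (Re w)\<^sup>2 \<le> 0" using * by (simp add: complex_nonpos_Reals_iff power2_eq_square)
  then show False using assms zero_le_power2[of c] zero_less_power2[of "Re w"] by linarith
qed

lemma Im_Ln_sq_plus_sq_tendsto:
  "((\<lambda>c::real. Im (Ln ((of_real c)\<^sup>2 + w\<^sup>2))) \<longlongrightarrow> 0) at_top"
proof -
  have "((\<lambda>c::real. (w / of_real c)\<^sup>2) \<longlongrightarrow> 0\<^sup>2) at_top"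
    by (intro tendsto_power tendsto_divide_0[OF tendsto_const] filterlim_of_real_at_infinity)
  then have "((\<lambda>c::real. 1 + (w / of_real c)\<^sup>2) \<longlongrightarrow> 1 + 0) at_top"
    by (intro tendsto_add tendsto_const) simp
  then have "((\<lambda>c::real. Im (Ln (1 + (w / of_real c)\<^sup>2))) \<longlongrightarrow> Im (Ln 1)) at_top"
    by (intro tendsto_Im tendsto_Ln) auto
  moreover have "eventually (\<lambda>c::real. c > 0 \<and> 1 + (w / of_real c)\<^sup>2 \<noteq> 0) at_top"
    using eventually_gt_at_top[of "0::real"] eventually_gt_at_top[of "norm w"]
  proof eventually_elim
    case (elim c)
    have "norm ((w / of_real c)\<^sup>2) < 1"
      using elim by (simp add: norm_power norm_divide power_divide power_strict_mono)
    then show ?case using elim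
      by (metis add.commute add_eq_0_iff norm_minus_cancel norm_one order_less_irrefl)
  qed
  then have "eventually (\<lambda>c::real. Im (Ln (1 + (w / of_real c)\<^sup>2))
      = Im (Ln ((of_real c)\<^sup>2 + w\<^sup>2))) at_top"
  proof eventually_elim
    case (elim c)
    have "(of_real c)\<^sup>2 + w\<^sup>2 = of_real (c\<^sup>2) * (1 + (w / of_real c)\<^sup>2)"
      using elim by (simp add: field_simps)
    moreover have "Ln (of_real (c\<^sup>2) * (1 + (w / of_real c)\<^sup>2)) =
        of_real (ln (c\<^sup>2)) + Ln (1 + (w / of_real c)\<^sup>2)"
      using Ln_times_of_real[of "c\<^sup>2" "1 + (w / of_real c)\<^sup>2"] elim
        Ln_of_real[of "c\<^sup>2"] by simp
    ultimately show ?case by simp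
  qed
  ultimately show ?thesis using tendsto_cong by fastforce
qed

lemma is_log_branch_bracket:
  fixes a b :: complex
  assumes "\<bar>Re a\<bar> < Re b"
  shows "is_log_branch (\<lambda>c. (a\<^sup>2 + b\<^sup>2 + (of_real c)\<^sup>2)\<^sup>2 - 4 * a\<^sup>2 * b\<^sup>2)
           (\<lambda>c. Ln ((of_real c)\<^sup>2 + (b + a)\<^sup>2) + Ln ((of_real c)\<^sup>2 + (b - a)\<^sup>2))"
proof -
  have re: "Re (b + a) \<noteq> 0" "Re (b - a) \<noteq> 0" using assms by auto
  note n = sq_plus_sq_notin_nonpos_Reals[OF re(1)] sq_plus_sq_notin_nonpos_Reals[OF re(2)]
  have nz: "(of_real c)\<^sup>2 + (b + a)\<^sup>2 \<noteq> 0" "(of_real c)\<^sup>2 + (b - a)\<^sup>2 \<noteq> 0" for c :: real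
    using n[of c] by (metis nonpos_Reals_zero_I)+
  have lim: "((\<lambda>c::real. Im (Ln ((of_real c)\<^sup>2 + (b + a)\<^sup>2)) + Im (Ln ((of_real c)\<^sup>2 + (b - a)\<^sup>2)))
      \<longlongrightarrow> 0 + 0) at_top"
    by (intro tendsto_add Im_Ln_sq_plus_sq_tendsto)
  have "continuous_on {0..}
      (\<lambda>c::real. Ln ((of_real c)\<^sup>2 + (b + a)\<^sup>2) + Ln ((of_real c)\<^sup>2 + (b - a)\<^sup>2))"
    by (intro continuous_intros) (use n in auto)
  moreover have "((of_real c)\<^sup>2 + (b + a)\<^sup>2) * ((of_real c)\<^sup>2 + (b - a)\<^sup>2) =
      (a\<^sup>2 + b\<^sup>2 + (of_real c)\<^sup>2)\<^sup>2 - 4 * a\<^sup>2 * b\<^sup>2" for c :: real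
    by (simp add: power2_eq_square algebra_simps)
  ultimately show ?thesis
    using lim nz by (simp add: is_log_branch_def exp_add)
qed


section \<open>Analytic continuation of a parameter integral\<close>

text \<open>An integral over \<open>[0, \<infinity>)\<close> with integrand \<open>f x\<close> that converges for \<open>x > 0\<close> is given at the
  remaining points of the plane cut along \<open>(-\<infinity>, 0]\<close> the value of its analytic continuation.\<close>

definition has_continued_integral ::
    "(complex \<Rightarrow> real \<Rightarrow> complex) \<Rightarrow> complex \<Rightarrow> complex \<Rightarrow> bool" where
  "has_continued_integral f v x \<longleftrightarrow>
     (\<exists>F. F holomorphic_on (- \<real>\<^sub>\<le>\<^sub>0) \<and>
          (\<forall>t::real. t > 0 \<longrightarrow> (f (of_real t) has_integral F (of_real t)) {0..}) \<and>
          F x = v)"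

lemma has_continued_integral_of_real:
  assumes "has_continued_integral f v (of_real t)" "t > 0"
  shows "(f (of_real t) has_integral v) {0..}"
  using assms by (auto simp: has_continued_integral_def)

lemma has_continued_integral_unique:
  assumes "has_continued_integral f v x" "has_continued_integral f w x" "x \<notin> \<real>\<^sub>\<le>\<^sub>0"
  shows "v = w"
proof -
  obtain F where F: "F holomorphic_on (- \<real>\<^sub>\<le>\<^sub>0)" "F x = v"
      "\<And>t::real. t > 0 \<Longrightarrow> (f (of_real t) has_integral F (of_real t)) {0..}"
    using assms(1) by (auto simp: has_continued_integral_def)
  obtain G where G: "G holomorphic_on (- \<real>\<^sub>\<le>\<^sub>0)" "G x = w"
      "\<And>t::real. t > 0 \<Longrightarrow> (f (of_real t) has_integral G (of_real t)) {0..}"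
    using assms(2) by (auto simp: has_continued_integral_def)
  have conn: "connected (- \<real>\<^sub>\<le>\<^sub>0 :: complex set)"
    using starlike_imp_connected[OF starlike_slotted_complex_plane_left[of 0]]
    by (simp add: nonpos_Reals_def atMost_def image_Collect)
  have "F x - G x = 0"
  proof (rule analytic_continuation[where f = "\<lambda>z. F z - G z" and w = x and S = "- \<real>\<^sub>\<le>\<^sub>0"
        and U = "of_real ` {0<..}" and \<xi> = 1])
    show "(\<lambda>z. F z - G z) holomorphic_on (- \<real>\<^sub>\<le>\<^sub>0)" using F G by (intro holomorphic_intros)
    show "(1::complex) islimpt of_real ` {0<..}"
    proof (rule islimptI)
      fix T :: "complex set" assume T: "1 \<in> T" "open T"
      then obtain e where e: "e > 0" "ball 1 e \<subseteq> T" using openE by blast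
      have "complex_of_real (1 + e / 2) \<in> ball 1 e"
        using e by (simp add: dist_norm)
      then have "complex_of_real (1 + e / 2) \<in> T" using e(2) by (rule subsetD[rotated])
      moreover have "complex_of_real (1 + e / 2) \<in> of_real ` {0<..}" using e by (intro imageI) simp
      moreover have "complex_of_real (1 + e / 2) \<noteq> 1" using e by simp
      ultimately show "\<exists>y\<in>of_real ` {0<..}. y \<in> T \<and> y \<noteq> (1::complex)" by blast
    qed
    show "F z - G z = 0" if "z \<in> of_real ` {0<..}" for z
      using that has_integral_unique[OF F(3) G(3)] by auto
  qed (use assms(3) conn in \<open>auto simp: open_Compl\<close>)
  then show ?thesis using F G by simp
qed

end

theory Submission
  imports Defs "HOL-Real_Asymp.Real_Asymp"
begin

text \<open>As a function of \<open>a\<close> and \<open>c\<close>, the kernel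
  \<open>k = (b\<^sup>2 + c\<^sup>2 - a\<^sup>2) ((c\<^sup>2 + (b + a)\<^sup>2) (c\<^sup>2 + (b - a)\<^sup>2)) powr (- 3 / 2)\<close> satisfies
  \<open>k\<^sub>a\<^sub>a + k\<^sub>a / a + k\<^sub>c\<^sub>c + k\<^sub>c / c = 0\<close>: up to a factor it is the \<open>b\<close>-derivative of an average over a
  circle of the fundamental solution of the Laplacian in four dimensions.  Integrating by parts in \<open>c\<close>
  against \<open>J\<^sub>0 (c x)\<close>, the integral \<open>F a\<close> satisfies \<open>a F'' + F' = x\<^sup>2 a F\<close>, so that
  \<open>F a = F 0 * I\<^sub>0 (a x)\<close> in the strip \<open>\<bar>Re a\<bar> < Re b\<close>.  It remains to evaluate
  \<open>F 0 = \<integral> c J\<^sub>0 (c x) (c\<^sup>2 + b\<^sup>2)\<^sup>-\<^sup>2 dc\<close>.  For real \<open>b\<close>, Fubini's theorem and Weber's integral turn it into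
  \<open>\<integral> exp (- t - w / t) dt / (2 b\<^sup>2)\<close> with \<open>w = (b x / 2)\<^sup>2\<close>; for complex \<open>b\<close> use analytic continuation.
  Finally \<open>e \<nu> w = \<integral> t powr (\<nu> - 1) exp (- t - w / t) dt\<close> and the combination of \<open>I\<^sub>\<nu>\<close> and \<open>I\<^sub>-\<^sub>\<nu>\<close> defining
  \<open>K\<^sub>\<nu>\<close> solve the same first-order system coupling the orders \<open>\<nu>\<close> and \<open>1 - \<nu>\<close>, with the same values at
  \<open>w = 0\<close> by the reflection formula for \<open>Gamma\<close>; letting \<open>\<nu>\<close> tend to 1 from below gives \<open>K\<^sub>1\<close>.\<close>

section \<open>Bessel series and their dependence on the order\<close>

text \<open>The Bessel equation in \<open>a\<close> is singular at 0, and a solution holomorphic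
  there is determined by its value at 0. Hence the single point \<open>a = 0\<close>, where the two
  logarithms in the bracket coincide and the kernel becomes rational, settles the whole strip.

  Differentiating twice under the integral sign requires majorants for the
  \<open>a\<close>-derivatives of the integrand. Cauchy's inequality derives them from a locally
  uniform bound on the kernel itself, so the long explicit derivatives are only compared
  algebraically.

  \<open>K\<^sub>1\<close> is defined as a limit in the order, and its defining quotient is
  \<open>0 / 0\<close> at order 1. For \<open>0 < \<nu> < 1\<close> both \<open>\<nu>\<close> and
  \<open>1 - \<nu>\<close> are positive, so the integrals of both orders are continuous up to
  \<open>w = 0\<close>. Differentiation in \<open>w\<close> exchanges the two orders, so the pair is
  pinned down by its values at 0 instead of by its behaviour at infinity.

  Throughout, \<open>x\<close> is a positive real \<open>t\<close>: all majorants rest on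
  \<open>norm (J0 s) \<le> 1\<close> and \<open>norm (J1 s) \<le> 1\<close> for
  \<open>s \<ge> 0\<close>, whereas \<open>J0 (c * x)\<close> grows exponentially in
  \<open>c\<close> for nonreal \<open>x\<close>. Complex \<open>x\<close> enters only through the
  continuation in the final theorem.\<close>

lemma rGamma_shifts_bounded:
  fixes R :: real
  obtains B where "\<And>\<nu> k. norm \<nu> \<le> R \<Longrightarrow> norm (rGamma (\<nu> + of_nat k + 1 :: complex)) \<le> B"
proof -
  \<comment> \<open>From the index \<open>m\<close> on,
    \<open>Re (\<nu> + of_nat m + 1) \<ge> 1\<close>, so every further Pochhammer factor has norm at
    least 1 and shifting can only shrink \<open>rGamma\<close>; the earlier shifts stay in one
    compact disc. The bound is uniform in the order as well as in the index, as differentiation in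
    the order requires.\<close>
  define m where "m = nat \<lceil>R\<rceil>"
  have m: "R \<le> real m" by (simp add: m_def real_nat_ceiling_ge)
  have "compact (rGamma ` cball (0::complex) (R + real m + 1))"
    by (intro compact_continuous_image holomorphic_on_imp_continuous_on holomorphic_intros compact_cball)
  then obtain B where B: "\<And>z. norm z \<le> R + real m + 1 \<Longrightarrow> norm (rGamma z :: complex) \<le> B"
    using compact_imp_bounded by (fastforce simp: bounded_iff)
  show ?thesis
  proof (rule that)
    fix \<nu> :: complex and k assume \<nu>: "norm \<nu> \<le> R"
    have small: "norm (rGamma (\<nu> + of_nat j + 1)) \<le> B" if "j \<le> m" for j
    proof (rule B)
      have "norm (\<nu> + of_nat j + 1) \<le> norm \<nu> + norm (of_nat j + 1 :: complex)"
        by (metis norm_triangle_ineq add.assoc)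
      also have "norm (of_nat j + 1 :: complex) = real (Suc j)"
        by (metis norm_of_nat of_nat_Suc add.commute)
      finally show "norm (\<nu> + of_nat j + 1) \<le> R + real m + 1" using \<nu> that by simp
    qed
    show "norm (rGamma (\<nu> + of_nat k + 1)) \<le> B"
    proof (cases "k \<le> m")
      case False
      define z where "z = \<nu> + of_nat m + 1"
      have "\<bar>Re \<nu>\<bar> \<le> R" using \<nu> abs_Re_le_cmod[of \<nu>] by linarith
      then have z: "Re z \<ge> 1" using m by (simp add: z_def)
      have "1 \<le> norm (pochhammer z n)" for n
      proof -
        have "1 \<le> norm (z + of_nat i)" for i
          using z complex_Re_le_cmod[of "z + of_nat i"] by simp
        then have "1 \<le> (\<Prod>i<n. norm (z + of_nat i))" by (intro prod_ge_1) auto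
        then show ?thesis by (simp add: pochhammer_prod prod_norm atLeast0LessThan)
      qed
      note p = this[of "k - m"]
      have "z + of_nat (k - m) = \<nu> + of_nat k + 1"
        using False by (simp add: z_def of_nat_diff)
      then have "rGamma z = pochhammer z (k - m) * rGamma (\<nu> + of_nat k + 1)"
        using pochhammer_rGamma[of z "k - m"] by simp
      then have "norm (rGamma z) = norm (pochhammer z (k - m)) * norm (rGamma (\<nu> + of_nat k + 1))"
        by (simp add: norm_mult)
      also have "\<dots> \<ge> 1 * norm (rGamma (\<nu> + of_nat k + 1))"
        by (intro mult_right_mono p) auto
      finally show ?thesis using small[of m] by (simp add: z_def)
    qed (use small in auto)
  qed
qed

lemma bessel_series_summable: "summable (\<lambda>k. rGamma (\<nu> + of_nat k + 1) / fact k * w ^ k :: complex)"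
proof -
  obtain B where B: "\<And>\<nu>' k. norm \<nu>' \<le> norm \<nu> \<Longrightarrow> norm (rGamma (\<nu>' + of_nat k + 1 :: complex)) \<le> B"
    using rGamma_shifts_bounded[of "norm \<nu>"] by blast
  show ?thesis
  proof (rule summable_comparison_test')
    show "summable (\<lambda>k. B * (norm w ^ k /\<^sub>R fact k))"
      by (intro summable_mult summable_exp_generic)
    show "norm (rGamma (\<nu> + of_nat k + 1) / fact k * w ^ k) \<le> B * (norm w ^ k /\<^sub>R fact k)" for k
    proof -
      have "norm (rGamma (\<nu> + of_nat k + 1) / fact k * w ^ k) =
          norm (rGamma (\<nu> + of_nat k + 1)) * (norm w ^ k /\<^sub>R fact k)"
        by (simp add: norm_mult norm_divide norm_power divide_inverse norm_inverse)
      also have "\<dots> \<le> B * (norm w ^ k /\<^sub>R fact k)"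
        by (intro mult_right_mono B) auto
      finally show ?thesis .
    qed
  qed
qed

lemma bessel_series_sums:
  "(\<lambda>k. rGamma (\<nu> + of_nat k + 1) / fact k * w ^ k) sums bessel_series \<nu> w"
  using summable_sums[OF bessel_series_summable[of \<nu> w]] by (simp add: bessel_series_def)

text \<open>In this normalisation differentiation is a pure shift of the order:
  \<open>Suc k / fact (Suc k)\<close> is \<open>1 / fact k\<close>, and the order absorbs the shift
  of the index.\<close>

lemma has_field_derivative_bessel_series:
  "(bessel_series \<nu> has_field_derivative bessel_series (\<nu> + 1) w) (at w)"
proof -
  have "((\<lambda>w. \<Sum>k. rGamma (\<nu> + of_nat k + 1) / fact k * w ^ k) has_field_derivative
      (\<Sum>k. diffs (\<lambda>k. rGamma (\<nu> + of_nat k + 1) / fact k) k * w ^ k)) (at w)"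
    by (intro termdiffs_strong_converges_everywhere bessel_series_summable)
  moreover have "diffs (\<lambda>k. rGamma (\<nu> + of_nat k + 1) / fact k) =
      (\<lambda>k. rGamma (\<nu> + 1 + of_nat k + 1) / fact k)"
    by (simp add: diffs_def fun_eq_iff add_ac fact_Suc del: of_nat_Suc) (simp add: add_ac)
  ultimately show ?thesis by (simp add: bessel_series_def[abs_def])
qed

lemma bessel_series_holomorphic: "bessel_series \<nu> holomorphic_on A"
  unfolding holomorphic_on_def field_differentiable_def
  using has_field_derivative_at_within[OF has_field_derivative_bessel_series] by blast

text \<open>After an index shift, \<open>w\<close> times the series of order
  \<open>\<nu> + 1\<close> is the series of order \<open>\<nu>\<close> with term \<open>k\<close>
  multiplied by \<open>k\<close>. Then
  \<open>(\<nu> + k) * rGamma (\<nu> + k + 1) = rGamma (\<nu> + k)\<close> finishes, at every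
  complex order.\<close>

lemma bessel_series_recurrence:
  "\<nu> * bessel_series \<nu> w + w * bessel_series (\<nu> + 1) w = bessel_series (\<nu> - 1) w"
proof -
  let ?c = "\<lambda>k. of_nat k * (rGamma (\<nu> + of_nat k + 1) / fact k * w ^ k)"
  have "(\<lambda>k. w * (rGamma (\<nu> + 1 + of_nat k + 1) / fact k * w ^ k)) sums (w * bessel_series (\<nu> + 1) w)"
    by (intro sums_mult bessel_series_sums)
  moreover have "w * (rGamma (\<nu> + 1 + of_nat k + 1) / fact k * w ^ k) = ?c (Suc k)" for k
  proof -
    have "(of_nat (Suc k) :: complex) / fact (Suc k) = 1 / fact k"
      by (simp add: divide_simps del: of_nat_Suc)
    moreover have "?c (Suc k) = rGamma (\<nu> + of_nat (Suc k) + 1) * w ^ Suc k * (of_nat (Suc k) / fact (Suc k))"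
      by (simp del: of_nat_Suc)
    ultimately show ?thesis by (simp add: add_ac)
  qed
  ultimately have "(\<lambda>k. ?c (Suc k)) sums (w * bessel_series (\<nu> + 1) w)"
    by (simp only:)
  then have "?c sums (w * bessel_series (\<nu> + 1) w + ?c 0)" by (rule sums_Suc)
  then have "(\<lambda>k. \<nu> * (rGamma (\<nu> + of_nat k + 1) / fact k * w ^ k) + ?c k) sums
      (\<nu> * bessel_series \<nu> w + w * bessel_series (\<nu> + 1) w)"
    by (intro sums_add sums_mult bessel_series_sums) simp
  moreover have "\<nu> * (rGamma (\<nu> + of_nat k + 1) / fact k * w ^ k) + ?c k =
      rGamma (\<nu> - 1 + of_nat k + 1) / fact k * w ^ k" for k
  proof -
    have "\<nu> * (rGamma (\<nu> + of_nat k + 1) / fact k * w ^ k) + ?c k =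
        ((\<nu> + of_nat k) * rGamma (\<nu> + of_nat k + 1)) / fact k * w ^ k"
      by (simp add: distrib_right add_divide_distrib mult.assoc)
    then show ?thesis by (simp add: rGamma_plus1)
  qed
  ultimately show ?thesis using sums_unique2 bessel_series_sums[of "\<nu> - 1" w] by simp
qed

section \<open>Differentiation in the order and the limit defining \<open>K\<^sub>1\<close>\<close>

definition bessel_series_order_deriv :: "complex \<Rightarrow> complex \<Rightarrow> complex" where
  "bessel_series_order_deriv \<nu> w = (\<Sum>k. deriv rGamma (\<nu> + of_nat k + 1) / fact k * w ^ k)"

text \<open>The terms are entire in the order and, by \<open>rGamma_shifts_bounded\<close>, share an
  exponential majorant on each unit disc, so the series may be differentiated termwise. The second
  conclusion makes the derivative in the order holomorphic in \<open>w\<close>.\<close>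

lemma bessel_series_order:
  shows has_field_derivative_bessel_series_order:
      "((\<lambda>\<nu>. bessel_series \<nu> w) has_field_derivative bessel_series_order_deriv \<nu> w) (at \<nu>)"
    and bessel_series_order_deriv_summable:
      "summable (\<lambda>k. deriv rGamma (\<nu> + of_nat k + 1) / fact k * w ^ k)"
proof -
  have d: "((\<lambda>\<nu>. rGamma (\<nu> + of_nat k + 1) / fact k * w ^ k) has_field_derivative
      deriv rGamma (\<nu> + of_nat k + 1) / fact k * w ^ k) (at \<nu>)" for k and \<nu> :: complex
  proof -
    have r: "(rGamma has_field_derivative deriv rGamma z) (at z)" for z :: complex
      by (simp add: DERIV_deriv_iff_field_differentiable field_differentiable_rGamma)
    have "((\<lambda>\<nu>. rGamma (\<nu> + of_nat k + 1)) has_field_derivative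
        deriv rGamma (\<nu> + of_nat k + 1) * 1) (at \<nu>)"
      by (rule DERIV_chain2[OF r]) (auto intro!: derivative_eq_intros)
    then show ?thesis by (auto intro!: DERIV_cdivide DERIV_cmult_right)
  qed
  have "\<exists>g g'. \<forall>\<nu>\<in>UNIV. (\<lambda>k. rGamma (\<nu> + of_nat k + 1) / fact k * w ^ k) sums g \<nu> \<and>
      (\<lambda>k. deriv rGamma (\<nu> + of_nat k + 1) / fact k * w ^ k) sums g' \<nu> \<and>
      (g has_field_derivative g' \<nu>) (at \<nu>)"
  proof (rule series_and_derivative_comparison_complex[OF open_UNIV d])
    fix \<nu> :: complex
    obtain B where B: "\<And>\<nu>' k. norm \<nu>' \<le> norm \<nu> + 1 \<Longrightarrow> norm (rGamma (\<nu>' + of_nat k + 1 :: complex)) \<le> B"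
      using rGamma_shifts_bounded[of "norm \<nu> + 1"] by blast
    have B0: "0 \<le> B" using order_trans[OF norm_ge_zero B[of \<nu> 0]] by simp
    define h where "h = (\<lambda>k. complex_of_real (B * (norm w ^ k /\<^sub>R fact k)))"
    have "summable h" unfolding h_def
      by (intro summable_of_real summable_mult summable_exp_generic)
    moreover have "range h \<subseteq> \<real>\<^sub>\<ge>\<^sub>0"
      unfolding h_def using B0 by (auto simp: nonneg_Reals_of_real_iff simp del: of_real_mult)
    moreover have "norm (rGamma (y + of_nat k + 1) / fact k * w ^ k) \<le> norm (h k)"
      if "y \<in> ball \<nu> 1" for y k
    proof -
      have "norm y \<le> norm \<nu> + 1"
        using that norm_triangle_sub[of y \<nu>] by (simp add: dist_norm norm_minus_commute)
      have "norm (rGamma (y + of_nat k + 1) / fact k * w ^ k) =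
          norm (rGamma (y + of_nat k + 1)) * (norm w ^ k /\<^sub>R fact k)"
        by (simp add: norm_mult norm_divide norm_power divide_inverse norm_inverse)
      also have "\<dots> \<le> B * (norm w ^ k /\<^sub>R fact k)"
        by (intro mult_right_mono B \<open>norm y \<le> _\<close>) auto
      also have "\<dots> = norm (h k)"
        unfolding h_def norm_of_real using B0 by simp
      finally show ?thesis .
    qed
    ultimately show "\<exists>d h. 0 < d \<and> summable h \<and> range h \<subseteq> \<real>\<^sub>\<ge>\<^sub>0 \<and> (\<forall>\<^sub>F k in sequentially.
        \<forall>y\<in>ball \<nu> d \<inter> UNIV. norm (rGamma (y + of_nat k + 1) / fact k * w ^ k) \<le> cmod (h k))"
      by (intro exI[of _ 1] exI[of _ h] conjI always_eventually allI ballI) auto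
  qed
  then obtain g g' where g: "\<And>\<nu>. (\<lambda>k. rGamma (\<nu> + of_nat k + 1) / fact k * w ^ k) sums g \<nu>"
      "\<And>\<nu>. (\<lambda>k. deriv rGamma (\<nu> + of_nat k + 1) / fact k * w ^ k) sums g' \<nu>"
      "\<And>\<nu>. (g has_field_derivative g' \<nu>) (at \<nu>)" by auto
  have "g = (\<lambda>\<nu>. bessel_series \<nu> w)" using sums_unique2[OF g(1) bessel_series_sums] by blast
  moreover have "g' = (\<lambda>\<nu>. bessel_series_order_deriv \<nu> w)"
    unfolding bessel_series_order_deriv_def using sums_unique[OF g(2)] by blast
  ultimately show "((\<lambda>\<nu>. bessel_series \<nu> w) has_field_derivative bessel_series_order_deriv \<nu> w) (at \<nu>)"
    "summable (\<lambda>k. deriv rGamma (\<nu> + of_nat k + 1) / fact k * w ^ k)"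
    using g(3) sums_summable[OF g(2)] by auto
qed

lemma bessel_series_order_deriv_holomorphic: "bessel_series_order_deriv \<nu> holomorphic_on A"
  unfolding bessel_series_order_deriv_def[abs_def] holomorphic_on_def field_differentiable_def
  using has_field_derivative_at_within[OF
      termdiffs_strong_converges_everywhere[OF bessel_series_order_deriv_summable]] by blast

definition besselI_log_order_deriv :: "complex \<Rightarrow> complex \<Rightarrow> complex" where
  "besselI_log_order_deriv \<nu> l =
     exp (\<nu> * (l - Ln 2)) * (bessel_series_order_deriv \<nu> ((exp l / 2)\<^sup>2) + (l - Ln 2) * bessel_series \<nu> ((exp l / 2)\<^sup>2))"

lemma has_field_derivative_besselI_log_order:
  "((\<lambda>\<nu>. besselI_log \<nu> l) has_field_derivative besselI_log_order_deriv \<nu> l) (at \<nu>)"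
  unfolding besselI_log_def besselI_log_order_deriv_def
  by (auto intro!: derivative_eq_intros has_field_derivative_bessel_series_order simp: algebra_simps)

text \<open>At order 1 the numerator of \<open>besselK_log_quotient\<close> therefore vanishes
  together with \<open>sin (pi * \<nu>)\<close>.\<close>

lemma besselI_log_minus_one: "besselI_log (-1) l = besselI_log 1 l"
proof -
  have "bessel_series (-1) ((exp l / 2)\<^sup>2) = (exp l / 2)\<^sup>2 * bessel_series 1 ((exp l / 2)\<^sup>2)"
    using bessel_series_recurrence[of 0 "(exp l / 2)\<^sup>2"] by simp
  then show ?thesis
    by (simp add: besselI_log_def exp_diff exp_minus power2_eq_square field_simps)
qed

text \<open>Dividing numerator and denominator by \<open>\<nu> - 1\<close> makes both of them
  difference quotients. The convergence serves the passage from orders below 1; the closed form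
  shows that \<open>K\<^sub>1\<close> is holomorphic in \<open>l\<close>.\<close>

lemma besselK_log_1:
  shows besselK_log_quotient_tendsto_1:
      "besselK_log_quotient l \<midarrow>1\<rightarrow> besselK_log 1 l"
    and besselK_log_1_eq:
      "besselK_log 1 l = (besselI_log_order_deriv 1 l + besselI_log_order_deriv (-1) l) / 2"
proof -
  let ?v = "(besselI_log_order_deriv 1 l + besselI_log_order_deriv (-1) l) / 2"
  have "((\<lambda>\<nu>. besselI_log (- \<nu>) l - besselI_log \<nu> l) has_field_derivative
      - besselI_log_order_deriv (-1) l - besselI_log_order_deriv 1 l) (at 1)"
    by (auto intro!: derivative_eq_intros has_field_derivative_besselI_log_order
        DERIV_chain2[where f = "\<lambda>\<nu>. besselI_log \<nu> l"])
  then have 1: "(\<lambda>\<nu>. (besselI_log (- \<nu>) l - besselI_log \<nu> l) / (\<nu> - 1)) \<midarrow>1\<rightarrow>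
      - besselI_log_order_deriv (-1) l - besselI_log_order_deriv 1 l"
    by (simp add: has_field_derivative_iff besselI_log_minus_one)
  have "((\<lambda>\<nu>::complex. sin (of_real pi * \<nu>)) has_field_derivative - of_real pi) (at 1)"
    by (auto intro!: derivative_eq_intros simp flip: cos_of_real)
  then have 2: "(\<lambda>\<nu>::complex. sin (of_real pi * \<nu>) / (\<nu> - 1)) \<midarrow>1\<rightarrow> - of_real pi"
    by (simp add: has_field_derivative_iff flip: sin_of_real)
  \<comment> \<open>Here \<open>v\<close> may be 0, and both sides are then 0 since division by 0
    gives 0. The rewriting is thus valid at all \<open>\<nu> \<noteq> 1\<close>, other integers
    included.\<close>
  have cancel: "p * (u / d) / (v / d) = p * u / v" if "d \<noteq> 0" for p u v d :: complex
    using that by simp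
  have "(\<lambda>\<nu>. of_real pi / 2 * ((besselI_log (- \<nu>) l - besselI_log \<nu> l) / (\<nu> - 1)) /
      (sin (of_real pi * \<nu>) / (\<nu> - 1))) \<midarrow>1\<rightarrow> of_real pi / 2 *
      (- besselI_log_order_deriv (-1) l - besselI_log_order_deriv 1 l) / - of_real pi"
    by (intro tendsto_divide tendsto_mult tendsto_const 1 2) simp
  also have "of_real pi / 2 * (- besselI_log_order_deriv (-1) l - besselI_log_order_deriv 1 l) /
      - of_real pi = ?v" by (simp add: field_simps)
  finally have lim: "(\<lambda>\<nu>. of_real pi / 2 * ((besselI_log (- \<nu>) l - besselI_log \<nu> l) / (\<nu> - 1)) /
      (sin (of_real pi * \<nu>) / (\<nu> - 1))) \<midarrow>1\<rightarrow> ?v" .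
  have "of_real pi / 2 * ((besselI_log (- \<nu>) l - besselI_log \<nu> l) / (\<nu> - 1)) /
      (sin (of_real pi * \<nu>) / (\<nu> - 1)) = besselK_log_quotient l \<nu>" if "\<nu> \<noteq> 1" for \<nu>
    unfolding besselK_log_quotient_def by (rule cancel) (use that in simp)
  then have "besselK_log_quotient l \<midarrow>1\<rightarrow> ?v"
    using LIM_equal[THEN iffD1, OF _ lim] by blast
  moreover from this have "besselK_log 1 l = ?v"
    by (simp add: besselK_log_def tendsto_Lim del: divide_const_simps)
  ultimately show "besselK_log_quotient l \<midarrow>1\<rightarrow> besselK_log 1 l" "besselK_log 1 l = ?v"
    by argo+
qed

lemma besselK_log_1_holomorphic:
  assumes "f holomorphic_on A"
  shows "(\<lambda>z. besselK_log 1 (f z)) holomorphic_on A"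
proof -
  have h: "(g \<circ> (\<lambda>l. (exp l / 2)\<^sup>2)) holomorphic_on UNIV" if "g holomorphic_on UNIV" for g
    by (intro holomorphic_on_compose_gen[OF _ that] holomorphic_intros) auto
  have "besselK_log 1 holomorphic_on UNIV"
    unfolding besselK_log_1_eq[abs_def] besselI_log_order_deriv_def
    using h[OF bessel_series_holomorphic] h[OF bessel_series_order_deriv_holomorphic]
    by (intro holomorphic_intros) (auto simp: o_def)
  from holomorphic_on_compose_gen[OF assms this] show ?thesis by (simp add: o_def)
qed

section \<open>Holomorphic parameter integrals\<close>

text \<open>By the mean value inequality on the ball, \<open>g\<close> dominates the difference
  quotients up to the limit, so dominated convergence applies along every sequence of parameters.
  The field is generic because the parameter is real in \<open>bessel_laplace\<close> and complex in
  the Hankel integrals.\<close>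

lemma has_field_derivative_integral_dominated:
  fixes f f' :: "'a::{real_normed_field, euclidean_space} \<Rightarrow> 'n::euclidean_space \<Rightarrow> 'a"
  assumes r: "r > 0"
    and int: "\<And>a. a \<in> ball a0 r \<Longrightarrow> f a integrable_on S"
    and der: "\<And>a c. a \<in> ball a0 r \<Longrightarrow> c \<in> S \<Longrightarrow> ((\<lambda>a. f a c) has_field_derivative f' a c) (at a)"
    and g: "g integrable_on S" "\<And>a c. a \<in> ball a0 r \<Longrightarrow> c \<in> S \<Longrightarrow> norm (f' a c) \<le> g c"
  shows "f' a0 integrable_on S"
    and "((\<lambda>a. integral S (f a)) has_field_derivative integral S (f' a0)) (at a0)"
proof -
  define q where "q = (\<lambda>a c. (f a c - f a0 c) / (a - a0))"
  have qint: "q a integrable_on S" if "a \<in> ball a0 r" for a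
    unfolding q_def using int[OF that] int[of a0] r
    by (intro integrable_on_divide integrable_diff) auto
  have qbound: "norm (q a c) \<le> g c" if a: "a \<in> ball a0 r" "a \<noteq> a0" and c: "c \<in> S" for a c
  proof -
    have "norm (f a c - f a0 c) \<le> g c * norm (a - a0)"
    proof (rule field_differentiable_bound[where S = "ball a0 r" and f' = "\<lambda>a. f' a c"])
      show "((\<lambda>a. f a c) has_field_derivative f' z c) (at z within ball a0 r)" if "z \<in> ball a0 r" for z
        using der[OF that c] by (rule has_field_derivative_at_within)
    qed (use a c r g in auto)
    then show ?thesis using a by (simp add: q_def norm_divide divide_simps)
  qed
  have main: "f' a0 integrable_on S \<and> (\<lambda>k. integral S (q (Y k))) \<longlonglongrightarrow> integral S (f' a0)"
    if Y: "\<And>k. Y k \<in> ball a0 r - {a0}" "Y \<longlonglongrightarrow> a0" for Y :: "nat \<Rightarrow> 'a"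
  proof -
    have lim: "(\<lambda>k. q (Y k) c) \<longlonglongrightarrow> f' a0 c" if "c \<in> S" for c
    proof -
      have "((\<lambda>a. q a c) \<longlongrightarrow> f' a0 c) (at a0)"
        using der[OF _ that, of a0] r by (simp add: has_field_derivative_iff q_def)
      moreover have "filterlim Y (at a0) sequentially"
        using Y by (auto simp: filterlim_at)
      ultimately show ?thesis by (rule filterlim_compose)
    qed
    show ?thesis
      using dominated_convergence[of "\<lambda>k. q (Y k)" S g "f' a0"] Y qint qbound g(1) lim by blast
  qed
  \<comment> \<open>Integrability of \<open>f' a0\<close> comes out of dominated convergence along a
    sequence of parameters, so one must be exhibited; the 2 in the denominator keeps it inside the
    open ball.\<close>
  define Y0 where "Y0 = (\<lambda>k. a0 + of_real (r / (2 + real k)))"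
  have lim0: "(\<lambda>k. a0 + of_real (r / (2 + real k))) \<longlonglongrightarrow> a0 + of_real 0"
    by (intro tendsto_intros tendsto_divide_0[OF tendsto_const] filterlim_at_top_imp_at_infinity
        filterlim_tendsto_add_at_top[OF tendsto_const] filterlim_real_sequentially)
  have "Y0 k \<in> ball a0 r - {a0}" for k
  proof -
    have "r / (2 + real k) < r" "r / (2 + real k) > 0" using r by (auto simp: field_simps add_pos_nonneg)
    then show ?thesis by (simp add: Y0_def dist_norm del: of_real_divide)
  qed
  then show "f' a0 integrable_on S" using main[of Y0] lim0 by (simp add: Y0_def)
  show "((\<lambda>a. integral S (f a)) has_field_derivative integral S (f' a0)) (at a0)"
    unfolding has_field_derivative_iff tendsto_at_iff_sequentially
  proof (intro allI impI)
    fix X :: "nat \<Rightarrow> 'a" assume X: "\<forall>i. X i \<in> UNIV - {a0}" "X \<longlonglongrightarrow> a0"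
    from X(2) r have "eventually (\<lambda>k. X k \<in> ball a0 r) sequentially"
      by (intro topological_tendstoD) auto
    then obtain N where N: "\<And>k. k \<ge> N \<Longrightarrow> X k \<in> ball a0 r" by (auto simp: eventually_sequentially)
    have "(\<lambda>k. integral S (q (X (k + N)))) \<longlonglongrightarrow> integral S (f' a0)"
      using main[of "\<lambda>k. X (k + N)"] X N LIMSEQ_ignore_initial_segment[OF X(2)] by auto
    then have "(\<lambda>k. integral S (q (X k))) \<longlonglongrightarrow> integral S (f' a0)" by (rule LIMSEQ_offset)
    moreover have "eventually (\<lambda>k. integral S (q (X k)) =
        (integral S (f (X k)) - integral S (f a0)) / (X k - a0)) sequentially"
      using eventually_ge_at_top[of N]
    proof eventually_elim
      case (elim k)
      show ?case using int[OF N[OF elim]] int[of a0] r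
        by (simp add: q_def integral_divide integral_diff)
    qed
    ultimately show "((\<lambda>y. (integral S (f y) - integral S (f a0)) / (y - a0)) \<circ> X) \<longlonglongrightarrow> integral S (f' a0)"
      by (simp add: o_def tendsto_cong)
  qed
qed

text \<open>The majorant is local in the parameter and lives on closed discs, as Cauchy's inequality
  needs. This makes the class closed under differentiation in the parameter, so that one estimate
  serves all derivatives.\<close>

definition dominated_integrand :: "complex set \<Rightarrow> real set \<Rightarrow> (complex \<Rightarrow> real \<Rightarrow> complex) \<Rightarrow> bool" where
  "dominated_integrand U S f \<longleftrightarrow>
     (\<forall>a\<in>U. f a integrable_on S) \<and> (\<forall>c\<in>S. (\<lambda>a. f a c) holomorphic_on U) \<and>
     (\<forall>a\<in>U. \<exists>r>0. \<exists>g. cball a r \<subseteq> U \<and> g integrable_on S \<and> (\<forall>z\<in>cball a r. \<forall>c\<in>S. norm (f z c) \<le> g c))"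

lemma dominated_integrand_deriv:
  assumes dom: "dominated_integrand U S f" and U: "open U"
    and der: "\<And>a c. a \<in> U \<Longrightarrow> c \<in> S \<Longrightarrow> ((\<lambda>a. f a c) has_field_derivative f' a c) (at a)"
  shows "dominated_integrand U S f'"
    and "\<And>a. a \<in> U \<Longrightarrow> ((\<lambda>a. integral S (f a)) has_field_derivative integral S (f' a)) (at a)"
proof -
  have holf: "(\<lambda>a. f a c) holomorphic_on U" if "c \<in> S" for c
    using dom that by (simp add: dominated_integrand_def)
  have intf: "f a integrable_on S" if "a \<in> U" for a
    using dom that by (simp add: dominated_integrand_def)
  have derf: "deriv (\<lambda>a. f a c) a = f' a c" if "a \<in> U" "c \<in> S" for a c
    using der[OF that] by (rule DERIV_imp_deriv)
  have loc: "\<exists>r>0. \<exists>g. cball a r \<subseteq> U \<and> g integrable_on S \<and> (\<forall>z\<in>cball a r. \<forall>c\<in>S. norm (f' z c) \<le> g c)"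
    if a: "a \<in> U" for a
  proof -
    from dom a obtain r g where r: "r > 0" "cball a r \<subseteq> U" and g: "g integrable_on S"
        "\<And>z c. z \<in> cball a r \<Longrightarrow> c \<in> S \<Longrightarrow> norm (f z c) \<le> g c"
      unfolding dominated_integrand_def by meson
    have "norm (f' z c) \<le> 2 / r * g c" if z: "z \<in> cball a (r / 2)" and c: "c \<in> S" for z c
    proof -
      \<comment> \<open>Cauchy's inequality is applied on the circle of radius \<open>r / 2\<close>
        about \<open>z\<close>, which stays in the disc where \<open>g\<close> dominates; the price
        is the factor \<open>2 / r\<close>.\<close>
      have sub: "cball z (r / 2) \<subseteq> cball a r" using z by (simp add: cball_subset_cball_iff dist_commute)
      have "norm ((deriv ^^ 1) (\<lambda>a. f a c) z) \<le> fact 1 * g c / (r / 2) ^ 1"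
      proof (rule Cauchy_inequality)
        show "(\<lambda>a. f a c) holomorphic_on ball z (r / 2)"
          using holomorphic_on_subset[OF holf[OF c]] sub r ball_subset_cball by blast
        show "continuous_on (cball z (r / 2)) (\<lambda>a. f a c)"
          using holomorphic_on_imp_continuous_on[OF holomorphic_on_subset[OF holf[OF c]]] sub r by blast
        show "norm (f x c) \<le> g c" if "norm (z - x) = r / 2" for x
        proof (rule g(2)[OF _ c])
          have "x \<in> cball z (r / 2)" using that by (simp add: dist_norm)
          then show "x \<in> cball a r" using sub by blast
        qed
      qed (use r in auto)
      moreover have "z \<in> cball z (r / 2)" using r by simp
      then have "z \<in> U" using sub r by blast
      ultimately show ?thesis using derf[OF _ c, of z] by (simp add: mult.commute)
    qed
    moreover have "(\<lambda>c. 2 / r * g c) integrable_on S" 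
      using integrable_cmul[OF g(1), of "2 / r"] by (simp only: real_scaleR_def)
    moreover have "cball a (r / 2) \<subseteq> U" using r subset_cball[of "r / 2" r a] by auto
    ultimately show ?thesis
      by (intro exI[of _ "r / 2"] conjI half_gt_zero[OF r(1)] exI[of _ "\<lambda>c. 2 / r * g c"] ballI)
  qed
  have *: "f' a integrable_on S \<and>
      ((\<lambda>a. integral S (f a)) has_field_derivative integral S (f' a)) (at a)" if a: "a \<in> U" for a
  proof -
    obtain r g where r: "r > 0" "cball a r \<subseteq> U" and g: "g integrable_on S"
        "\<And>z c. z \<in> cball a r \<Longrightarrow> c \<in> S \<Longrightarrow> norm (f' z c) \<le> g c"
      using loc[OF a] by blast
    have sub: "z \<in> U" "z \<in> cball a r" if "z \<in> ball a r" for z using that r by auto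
    have i: "f z integrable_on S" if "z \<in> ball a r" for z by (rule intf[OF sub(1)[OF that]])
    have d: "((\<lambda>a. f a c) has_field_derivative f' z c) (at z)" if "z \<in> ball a r" "c \<in> S" for z c
      by (rule der[OF sub(1)[OF that(1)] that(2)])
    have b: "norm (f' z c) \<le> g c" if "z \<in> ball a r" "c \<in> S" for z c
      by (rule g(2)[OF sub(2)[OF that(1)] that(2)])
    show ?thesis
      using has_field_derivative_integral_dominated[OF r(1) i d g(1) b] by (rule conjI)
  qed
  have "(\<lambda>a. f' a c) holomorphic_on U" if c: "c \<in> S" for c
    by (rule holomorphic_transform[OF holomorphic_deriv[OF holf[OF c] U] derf[OF _ c]])
  then show "dominated_integrand U S f'"
    unfolding dominated_integrand_def using conjunct1[OF *] loc by (intro conjI ballI)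
  show "\<And>a. a \<in> U \<Longrightarrow> ((\<lambda>a. integral S (f a)) has_field_derivative integral S (f' a)) (at a)"
    using conjunct2[OF *] .
qed

lemma holomorphic_on_integral_dominated:
  assumes dom: "dominated_integrand U S f" and U: "open U"
  shows "(\<lambda>a. integral S (f a)) holomorphic_on U"
proof (rule holomorphic_onI)
  fix a assume a: "a \<in> U"
  have "((\<lambda>a. f a c) has_field_derivative deriv (\<lambda>a. f a c) a) (at a)" if "a \<in> U" "c \<in> S" for a c
    using dom that U by (auto simp: dominated_integrand_def intro!: holomorphic_derivI)
  from dominated_integrand_deriv(2)[OF dom U this a]
  show "(\<lambda>a. integral S (f a)) field_differentiable at a within U"
    unfolding field_differentiable_def by (blast intro: has_field_derivative_at_within)
qed

section \<open>The Bessel functions of orders 0 and 1 on the real axis\<close>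

lemma has_real_derivative_Re_Im:
  assumes "(f has_field_derivative D) (at (complex_of_real s))"
  shows has_real_derivative_Re: "((\<lambda>s. Re (f (of_real s))) has_real_derivative Re D) (at s)"
    and has_real_derivative_Im: "((\<lambda>s. Im (f (of_real s))) has_real_derivative Im D) (at s)"
  unfolding has_real_derivative_iff_has_vector_derivative
  by (rule bounded_linear.has_vector_derivative[OF bounded_linear_Re has_vector_derivative_real_field[OF assms]]
      bounded_linear.has_vector_derivative[OF bounded_linear_Im has_vector_derivative_real_field[OF assms]])+

text \<open>\<open>J0\<close> and \<open>J1\<close> are \<open>besselJ 0\<close> and
  \<open>besselJ 1\<close> with the prefactor evaluated, which makes them visibly entire.\<close>

definition J0 :: "complex \<Rightarrow> complex" where "J0 z = bessel_series 0 (- ((z / 2)\<^sup>2))"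
definition J1 :: "complex \<Rightarrow> complex" where "J1 z = z / 2 * bessel_series 1 (- ((z / 2)\<^sup>2))"

lemma besselJ_0_eq: "besselJ 0 z = J0 z"
  by (simp add: besselJ_def bessel_prefactor_def J0_def)

lemma has_field_derivative_J0: "(J0 has_field_derivative - J1 z) (at z)"
proof -
  have "((\<lambda>z::complex. - ((z / 2)\<^sup>2)) has_field_derivative - (z / 2)) (at z)"
    by (auto intro!: derivative_eq_intros)
  from DERIV_chain2[OF has_field_derivative_bessel_series this, of 0]
  show ?thesis by (simp add: J0_def[abs_def] J1_def mult.commute)
qed

lemma has_field_derivative_times_J1: "((\<lambda>z. z * J1 z) has_field_derivative z * J0 z) (at z)"
proof -
  define w where "w = - ((z / 2)\<^sup>2)"
  have "bessel_series 1 w + w * bessel_series 2 w = bessel_series 0 w"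
    using bessel_series_recurrence[of 1 w] by simp
  moreover have "((\<lambda>z. z * J1 z) has_field_derivative
      z * (bessel_series 1 w + w * bessel_series 2 w)) (at z)"
  proof -
    have 1: "((\<lambda>z::complex. - ((z / 2)\<^sup>2)) has_field_derivative - (z / 2)) (at z)"
      by (auto intro!: derivative_eq_intros)
    have 2: "((\<lambda>z::complex. z\<^sup>2 / 2) has_field_derivative z) (at z)"
      by (auto intro!: derivative_eq_intros)
    have "(\<lambda>z. z * J1 z) = (\<lambda>z. z\<^sup>2 / 2 * bessel_series 1 (- ((z / 2)\<^sup>2)))"
      by (simp add: J1_def fun_eq_iff power2_eq_square)
    moreover have "z * bessel_series 1 w + bessel_series 2 w * - (z / 2) * (z\<^sup>2 / 2) =
        z * (bessel_series 1 w + w * bessel_series 2 w)"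
      by (simp add: w_def power2_eq_square algebra_simps)
    ultimately show ?thesis
      using DERIV_mult[OF 2 DERIV_chain2[OF has_field_derivative_bessel_series 1, of 1]]
      by (simp add: w_def)
  qed
  ultimately show ?thesis by (simp add: J0_def w_def)
qed

lemma has_field_derivative_J1:
  assumes "z \<noteq> 0"
  shows "(J1 has_field_derivative J0 z - J1 z / z) (at z)"
proof -
  have "((\<lambda>z. z * J1 z / z) has_field_derivative (z * J0 z * z - z * J1 z * 1) / (z * z)) (at z)"
    by (rule DERIV_divide[OF has_field_derivative_times_J1 DERIV_ident assms])
  also have "(z * J0 z * z - z * J1 z * 1) / (z * z) = J0 z - J1 z / z"
    using assms by (simp add: field_simps)
  finally show ?thesis
    by (rule has_field_derivative_transform_within_open[where S = "- {0}"]) (use assms in auto)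
qed

lemma bessel_energy_derivative:
  fixes A B :: "real \<Rightarrow> real"
  assumes "(A has_real_derivative - B u) (at u)" "(B has_real_derivative A u - B u / u) (at u)"
  shows "((\<lambda>s. (A s)\<^sup>2 + (B s)\<^sup>2) has_real_derivative - (2 * (B u)\<^sup>2 / u)) (at u)"
  by (rule derivative_eq_intros assms refl)+ (simp add: algebra_simps power2_eq_square)

text \<open>By \<open>J0' = - J1\<close> and \<open>J1' = J0 - J1 / s\<close> the cross terms cancel
  and the energy has the derivative \<open>- 2 * J1\<^sup>2 / s\<close>. The system has real
  coefficients, so this holds for real and imaginary parts separately and the two energies add
  up.\<close>

lemma J0_J1_energy_le:
  fixes s :: real
  assumes "s \<ge> 0"
  shows "(norm (J0 (of_real s)))\<^sup>2 + (norm (J1 (of_real s)))\<^sup>2 \<le> 1"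
proof -
  let ?E = "\<lambda>s. ((Re (J0 (of_real s)))\<^sup>2 + (Re (J1 (of_real s)))\<^sup>2) +
      ((Im (J0 (of_real s)))\<^sup>2 + (Im (J1 (of_real s)))\<^sup>2)"
  have "(\<lambda>z. - ((z / 2)\<^sup>2)) holomorphic_on (UNIV :: complex set)" by (intro holomorphic_intros) auto
  from holomorphic_on_compose_gen[OF this bessel_series_holomorphic subset_UNIV]
  have hol: "J0 holomorphic_on UNIV" "J1 holomorphic_on UNIV"
    unfolding J0_def[abs_def] J1_def[abs_def] by (auto intro!: holomorphic_intros simp: o_def)
  have cont: "continuous_on A (\<lambda>s. J1 (of_real s))" "continuous_on A (\<lambda>s. J0 (of_real s))" for A :: "real set"
    by (intro continuous_on_compose2[OF holomorphic_on_imp_continuous_on[OF hol(2)]]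
        continuous_on_compose2[OF holomorphic_on_imp_continuous_on[OF hol(1)]] continuous_intros subset_UNIV)+
  have "?E s \<le> ?E 0"
  proof (rule DERIV_nonpos_imp_decreasing_open[OF assms])
    fix u :: real assume u: "0 < u" "u < s"
    have 1: "((\<lambda>s. Re (J0 (of_real s))) has_real_derivative - Re (J1 (of_real u))) (at u)"
      "((\<lambda>s. Im (J0 (of_real s))) has_real_derivative - Im (J1 (of_real u))) (at u)"
      using has_real_derivative_Re_Im[OF has_field_derivative_J0] by auto
    have 2: "((\<lambda>s. Re (J1 (of_real s))) has_real_derivative Re (J0 (of_real u)) - Re (J1 (of_real u)) / u) (at u)"
      "((\<lambda>s. Im (J1 (of_real s))) has_real_derivative Im (J0 (of_real u)) - Im (J1 (of_real u)) / u) (at u)"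
      using has_real_derivative_Re_Im[OF has_field_derivative_J1, of u] u by auto
    have "(?E has_real_derivative - (2 * (Re (J1 (of_real u)))\<^sup>2 / u) + - (2 * (Im (J1 (of_real u)))\<^sup>2 / u)) (at u)"
      by (intro DERIV_add bessel_energy_derivative 1 2)
    moreover have "- (2 * (Re (J1 (of_real u)))\<^sup>2 / u) + - (2 * (Im (J1 (of_real u)))\<^sup>2 / u) \<le> 0"
      by (intro add_nonpos_nonpos) (use u in auto)
    ultimately show "\<exists>y. (?E has_real_derivative y) (at u) \<and> y \<le> 0" by blast
  qed (intro continuous_intros cont)
  moreover have "bessel_series 0 0 = 1" using besselJ_0_0 by (simp add: besselJ_0_eq J0_def)
  ultimately show ?thesis unfolding cmod_power2 by (simp add: J0_def[of 0] J1_def[of 0])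
qed

lemma norm_J0_J1_le_1:
  fixes s :: real
  assumes "s \<ge> 0"
  shows norm_J0_le_1: "norm (J0 (of_real s)) \<le> 1"
    and norm_J1_le_1: "norm (J1 (of_real s)) \<le> 1"
proof -
  note e = J0_J1_energy_le[OF assms]
  show "norm (J0 (of_real s)) \<le> 1"
  proof (rule power2_le_imp_le)
    show "(norm (J0 (of_real s)))\<^sup>2 \<le> 1\<^sup>2"
      unfolding power_one using e zero_le_power2[of "norm (J1 (of_real s))"] by linarith
  qed simp
  show "norm (J1 (of_real s)) \<le> 1"
  proof (rule power2_le_imp_le)
    show "(norm (J1 (of_real s)))\<^sup>2 \<le> 1\<^sup>2"
      unfolding power_one using e zero_le_power2[of "norm (J0 (of_real s))"] by linarith
  qed simp
qed

section \<open>The integral representation of \<open>K\<^sub>1\<close>\<close>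

text \<open>For \<open>w > 0\<close> this is
  \<open>2 * w powr (\<nu> / 2) * K\<^sub>\<nu> (2 * sqrt w)\<close>, normalised so that it extends
  continuously to \<open>w = 0\<close> when \<open>\<nu> > 0\<close>.\<close>

definition bessel_laplace :: "real \<Rightarrow> real \<Rightarrow> real" where
  "bessel_laplace \<nu> w = integral {0<..} (\<lambda>t. t powr (\<nu> - 1) * exp (- t - w / t))"

lemma Gamma_has_integral_open:
  fixes \<nu> :: real
  assumes "\<nu> > 0"
  shows "((\<lambda>t. t powr (\<nu> - 1) * exp (- t)) has_integral Gamma \<nu>) {0<..}"
proof -
  have "((\<lambda>t. t powr (\<nu> - 1) * exp (- t)) has_integral Gamma \<nu>) {0..}"
    using Gamma_integral_real[OF assms] by (simp add: exp_minus divide_inverse)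
  then show ?thesis
    by (rule has_integral_spike_set_eq[THEN iffD1, rotated -1])
      (auto intro: negligible_subset[OF negligible_sing[of 0]])
qed

lemma absolutely_integrable_bessel_laplace:
  fixes w \<nu> :: real
  assumes "w \<ge> 0" "\<nu> > 0"
  shows "(\<lambda>t. t powr (\<nu> - 1) * exp (- t - w / t)) absolutely_integrable_on {0<..}"
proof (rule measurable_bounded_by_integrable_imp_absolutely_integrable)
  show "(\<lambda>t. t powr (\<nu> - 1) * exp (- t - w / t)) \<in> borel_measurable (lebesgue_on {0<..})"
    by (rule continuous_imp_measurable_on_sets_lebesgue)
      (auto intro!: continuous_intros sets_completionI_sets)
  show "(\<lambda>t. t powr (\<nu> - 1) * exp (- t)) integrable_on {0<..}"
    using Gamma_has_integral_open[OF assms(2)] by blast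
  show "norm (t powr (\<nu> - 1) * exp (- t - w / t)) \<le> t powr (\<nu> - 1) * exp (- t)" if "t \<in> {0<..}" for t
    using that assms by (auto simp: abs_mult intro!: mult_left_mono)
qed (rule sets_completionI_sets, simp)

lemma bessel_laplace_0: "\<nu> > 0 \<Longrightarrow> bessel_laplace \<nu> 0 = Gamma \<nu>"
  using integral_unique[OF Gamma_has_integral_open[of \<nu>]] by (simp add: bessel_laplace_def)

text \<open>Substitute \<open>t = w / s\<close>. Up to sign, the left side is what differentiation
  in \<open>w\<close> produces; the substitution brings its exponent back to that of the positive
  order \<open>1 - \<nu>\<close>.\<close>

lemma bessel_laplace_reflect:
  assumes "w > 0" "\<nu> < 1"
  shows "integral {0<..} (\<lambda>t. t powr (\<nu> - 2) * exp (- t - w / t)) = w powr (\<nu> - 1) * bessel_laplace (1 - \<nu>) w"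
proof -
  let ?f = "\<lambda>t. t powr (\<nu> - 2) * exp (- t - w / t)"
  let ?h = "\<lambda>t. w powr (\<nu> - 1) * (t powr ((1 - \<nu>) - 1) * exp (- t - w / t))"
  have image: "(\<lambda>s. w / s) ` {0<..} = {0<..}"
  proof (intro equalityI subsetI)
    fix t :: real assume "t \<in> {0<..}"
    then show "t \<in> (\<lambda>s. w / s) ` {0<..}" using assms by (intro image_eqI[of _ _ "w / t"]) auto
  qed (use assms in auto)
  have eq: "\<bar>- w / s\<^sup>2\<bar> * ?f (w / s) = ?h s" if "s \<in> {0<..}" for s
  proof -
    have "w / s\<^sup>2 = w powr 1 * s powr (-2)"
      using that assms by (simp add: powr_minus powr_numeral divide_inverse)
    moreover have "(w / s) powr (\<nu> - 2) = w powr (\<nu> - 2) * s powr (2 - \<nu>)"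
      using that assms powr_minus_divide[of s "\<nu> - 2"] by (simp add: powr_divide)
    ultimately have "w / s\<^sup>2 * (w / s) powr (\<nu> - 2) = (w powr 1 * w powr (\<nu> - 2)) * (s powr (-2) * s powr (2 - \<nu>))"
      by simp
    also have "\<dots> = w powr (\<nu> - 1) * s powr (- \<nu>)"
      unfolding powr_add[symmetric] by simp
    finally have "\<bar>- w / s\<^sup>2\<bar> * (w / s) powr (\<nu> - 2) = w powr (\<nu> - 1) * s powr (- \<nu>)"
      using that assms by simp
    moreover have "- (w / s) - w / (w / s) = - s - w / s" using that assms by simp
    ultimately show ?thesis by (simp add: mult.assoc[symmetric] del: abs_divide)
  qed
  have abs_h: "?h absolutely_integrable_on {0<..}"
    using absolutely_integrable_bessel_laplace[of w "1 - \<nu>"] assms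
    by (intro set_integrable_mult_right) auto
  have int_h: "integral {0<..} ?h = w powr (\<nu> - 1) * bessel_laplace (1 - \<nu>) w"
    by (simp add: bessel_laplace_def)
  let ?k = "\<lambda>s. \<bar>- w / s\<^sup>2\<bar> * ?f (w / s)"
  have "?k absolutely_integrable_on {0<..}"
    using abs_h by (subst set_integrable_cong[OF refl refl eq]) auto
  moreover have "integral {0<..} ?k = w powr (\<nu> - 1) * bessel_laplace (1 - \<nu>) w"
    by (rule trans[OF integral_cong[OF eq] int_h])
  moreover have "((\<lambda>s. w / s) has_field_derivative - w / s\<^sup>2) (at s within {0<..})" if "s \<in> {0<..}" for s
    using that by (auto intro!: derivative_eq_intros simp: power2_eq_square)
  moreover have "inj_on (\<lambda>s. w / s) {0<..}" using assms by (auto simp: inj_on_def)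
  moreover have "{0<..} \<in> sets (lebesgue :: real measure)" by (rule sets_completionI_sets) simp
  note has_absolute_integral_change_of_variables_1'[OF this, of "\<lambda>s. w / s" "\<lambda>s. - w / s\<^sup>2" ?f
      "w powr (\<nu> - 1) * bessel_laplace (1 - \<nu>) w"]
  ultimately have "?f absolutely_integrable_on (\<lambda>s. w / s) ` {0<..} \<and>
      integral ((\<lambda>s. w / s) ` {0<..}) ?f = w powr (\<nu> - 1) * bessel_laplace (1 - \<nu>) w"
    by blast
  then show "integral {0<..} ?f = w powr (\<nu> - 1) * bessel_laplace (1 - \<nu>) w"
    unfolding image by blast
qed

lemma has_field_derivative_bessel_laplace:
  assumes w: "w > 0" and \<nu>: "0 < \<nu>" "\<nu> < 1"
  shows "(bessel_laplace \<nu> has_field_derivative - (w powr (\<nu> - 1) * bessel_laplace (1 - \<nu>) w)) (at w)"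
proof -
  let ?g = "\<lambda>t. 2 / w * (t powr (\<nu> - 1) * exp (- t))"
  have pos: "v > w / 2" if "v \<in> ball w (w / 2)" for v using that by (auto simp: dist_real_def abs_if split: if_splits)
  have bound: "norm (- (t powr (\<nu> - 2) * exp (- t - v / t))) \<le> ?g t"
    if v: "v \<in> ball w (w / 2)" and t: "t \<in> {0<..}" for v t
  proof -
    have v0: "v > 0" using pos[OF v] w by simp
    \<comment> \<open>Differentiation in \<open>v\<close> costs a factor \<open>1 / t\<close>, and
      \<open>t powr (\<nu> - 2)\<close> is not integrable at 0. The factor
      \<open>exp (- (v / t))\<close>, which is at most \<open>t / v\<close> and hence at most
      \<open>2 * t / w\<close>, restores the lost power.\<close>
    have "v / t \<le> exp (v / t)" using exp_ge_add_one_self[of "v / t"] by linarith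
    then have "exp (- (v / t)) \<le> t / v" using v0 t by (simp add: exp_minus field_simps)
    also have "\<dots> \<le> t * (2 / w)" using pos[OF v] v0 t w by (simp add: field_simps)
    finally have "t powr (\<nu> - 2) * (exp (- t) * exp (- (v / t))) \<le> t powr (\<nu> - 2) * (exp (- t) * (t * (2 / w)))"
      by (intro mult_left_mono) auto
    also have "\<dots> = 2 / w * (t powr (\<nu> - 2) * t powr 1 * exp (- t))" using t by simp
    also have "t powr (\<nu> - 2) * t powr 1 = t powr (\<nu> - 1)" unfolding powr_add[symmetric] by simp
    finally show ?thesis by (simp add: abs_mult flip: exp_add)
  qed
  have "((\<lambda>v. integral {0<..} (\<lambda>t. t powr (\<nu> - 1) * exp (- t - v / t))) has_field_derivative
      integral {0<..} (\<lambda>t. - (t powr (\<nu> - 2) * exp (- t - w / t)))) (at w)"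
  proof (rule has_field_derivative_integral_dominated(2)[where r = "w / 2" and g = ?g
        and f' = "\<lambda>v t. - (t powr (\<nu> - 2) * exp (- t - v / t))"])
    show "(\<lambda>t. t powr (\<nu> - 1) * exp (- t - v / t)) integrable_on {0<..}" if "v \<in> ball w (w / 2)" for v
      using absolutely_integrable_bessel_laplace[of v \<nu>] pos[OF that] w \<nu>
      by (intro set_lebesgue_integral_eq_integral(1)) auto
    show "((\<lambda>v. t powr (\<nu> - 1) * exp (- t - v / t)) has_field_derivative - (t powr (\<nu> - 2) * exp (- t - v / t))) (at v)"
      if "t \<in> {0<..}" for v t
    proof -
      have "t powr (\<nu> - 1) = t powr (\<nu> - 2) * t powr 1" unfolding powr_add[symmetric] by simp
      then show ?thesis using that by (auto intro!: derivative_eq_intros)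
    qed
    show "?g integrable_on {0<..}"
      using has_integral_mult_right[OF Gamma_has_integral_open[OF \<nu>(1)]] by blast
  qed (use w bound in auto)
  then show ?thesis using bessel_laplace_reflect[OF w \<nu>(2)] by (simp add: bessel_laplace_def[abs_def])
qed

lemma continuous_on_bessel_laplace:
  assumes \<nu>: "\<nu> > 0"
  shows "continuous_on {0..} (bessel_laplace \<nu>)"
  unfolding continuous_on_sequentially
proof (intro ballI allI impI)
  fix w and X :: "nat \<Rightarrow> real" assume w: "w \<in> {0..}" and X: "(\<forall>n. X n \<in> {0..}) \<and> X \<longlonglongrightarrow> w"
  show "(bessel_laplace \<nu> \<circ> X) \<longlonglongrightarrow> bessel_laplace \<nu> w"
    unfolding o_def bessel_laplace_def
  proof (rule dominated_convergence(2))
    show "(\<lambda>t. t powr (\<nu> - 1) * exp (- t - X k / t)) integrable_on {0<..}" for k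
      using absolutely_integrable_bessel_laplace[of "X k" \<nu>] X \<nu>
      by (intro set_lebesgue_integral_eq_integral(1)) auto
    show "(\<lambda>t. t powr (\<nu> - 1) * exp (- t)) integrable_on {0<..}"
      using Gamma_has_integral_open[OF \<nu>] by blast
    show "norm (t powr (\<nu> - 1) * exp (- t - X k / t)) \<le> t powr (\<nu> - 1) * exp (- t)" if "t \<in> {0<..}" for t k
      using that X by (auto simp: abs_mult intro!: mult_left_mono)
    show "(\<lambda>k. t powr (\<nu> - 1) * exp (- t - X k / t)) \<longlonglongrightarrow> t powr (\<nu> - 1) * exp (- t - w / t)"
      if "t \<in> {0<..}" for t
      using that X by (intro tendsto_intros) auto
  qed
qed

lemma bessel_laplace_tendsto_1:
  assumes w: "w \<ge> 0" and \<nu>: "\<nu> \<longlonglongrightarrow> 1" "\<And>n. \<nu> n \<in> {1/2..1}"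
  shows "(\<lambda>n. bessel_laplace (\<nu> n) w) \<longlonglongrightarrow> bessel_laplace 1 w"
  unfolding bessel_laplace_def
proof (rule dominated_convergence(2))
  \<comment> \<open>The first summand dominates for \<open>t \<le> 1\<close> because
    \<open>\<nu> k \<ge> 1 / 2\<close>, the second for \<open>t > 1\<close> because
    \<open>\<nu> k \<le> 1\<close>. Both keep the shape of a Gamma integrand.\<close>
  let ?g = "\<lambda>t::real. t powr (1 / 2 - 1) * exp (- t) + t powr (1 - 1) * exp (- t)"
  show "(\<lambda>t. t powr (\<nu> k - 1) * exp (- t - w / t)) integrable_on {0<..}" for k
    using absolutely_integrable_bessel_laplace[of w "\<nu> k"] w \<nu>(2)[of k]
    by (intro set_lebesgue_integral_eq_integral(1)) auto
  show "?g integrable_on {0<..}"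
    by (rule has_integral_integrable[OF has_integral_add[OF Gamma_has_integral_open Gamma_has_integral_open]])
      simp_all
  show "norm (t powr (\<nu> k - 1) * exp (- t - w / t)) \<le> ?g t" if t: "t \<in> {0<..}" for t k
  proof -
    have "t powr (\<nu> k - 1) \<le> t powr (1 / 2 - 1) + t powr (1 - 1)"
    proof (cases "t \<le> 1")
      case True
      then have "t powr (\<nu> k - 1) \<le> t powr (1 / 2 - 1)"
        using t \<nu>(2)[of k] by (intro powr_mono') auto
      then show ?thesis by (simp add: add_increasing2)
    next
      case False
      then have "t powr (\<nu> k - 1) \<le> t powr (1 - 1)"
        using \<nu>(2)[of k] by (intro powr_mono) auto
      then show ?thesis by (simp add: add_increasing)
    qed
    moreover have "exp (- t - w / t) \<le> exp (- t)" using t w by simp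
    ultimately have "t powr (\<nu> k - 1) * exp (- t - w / t) \<le> (t powr (1 / 2 - 1) + t powr (1 - 1)) * exp (- t)"
      by (intro mult_mono) auto
    then show ?thesis by (simp add: abs_mult distrib_right)
  qed
  show "(\<lambda>k. t powr (\<nu> k - 1) * exp (- t - w / t)) \<longlonglongrightarrow> t powr (1 - 1) * exp (- t - w / t)"
    if "t \<in> {0<..}" for t
    using that \<nu> by (intro tendsto_intros) auto
qed

text \<open>The weight \<open>exp (- \<phi>)\<close> absorbs the singular coefficients, which are integrable at \<open>0\<close>, so that the
  weighted energy \<open>y1\<^sup>2 + y2\<^sup>2\<close> is nonincreasing.\<close>

lemma coupled_system_unique:
  fixes y1 y2 :: "real \<Rightarrow> real"
  assumes \<nu>: "0 < \<nu>" "\<nu> < 1"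
    and cont: "continuous_on {0..} y1" "continuous_on {0..} y2"
    and zero: "y1 0 = 0" "y2 0 = 0"
    and d1: "\<And>w. w > 0 \<Longrightarrow> (y1 has_real_derivative - (w powr (\<nu> - 1) * y2 w)) (at w)"
    and d2: "\<And>w. w > 0 \<Longrightarrow> (y2 has_real_derivative - (w powr (- \<nu>) * y1 w)) (at w)"
    and w: "w \<ge> 0"
  shows "y1 w = 0"
proof -
  define \<phi> where "\<phi> = (\<lambda>w. w powr \<nu> / \<nu> + w powr (1 - \<nu>) / (1 - \<nu>))"
  define H where "H = (\<lambda>w. ((y1 w)\<^sup>2 + (y2 w)\<^sup>2) * exp (- \<phi> w))"
  have "H w \<le> H 0"
  proof (rule DERIV_nonpos_imp_decreasing_open[OF w])
    fix u assume u: "0 < u" "u < w"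
    let ?p = "u powr (\<nu> - 1)" and ?q = "u powr (- \<nu>)"
    have "(\<phi> has_real_derivative ?p + ?q) (at u)"
    proof -
      have "((\<lambda>w. w powr \<mu> / \<mu>) has_real_derivative u powr (\<mu> - 1)) (at u)" if "\<mu> \<noteq> 0" for \<mu>
        using DERIV_cdivide[OF has_real_derivative_powr[OF u(1), of \<mu>], of \<mu>] that by simp
      from DERIV_add[OF this[of \<nu>] this[of "1 - \<nu>"]] \<nu> show ?thesis by (simp add: \<phi>_def)
    qed
    \<comment> \<open>The coupling contributes \<open>- 2 * (?p + ?q) * y1 u * y2 u\<close> and the
      weight \<open>- (?p + ?q) * ((y1 u)\<^sup>2 + (y2 u)\<^sup>2)\<close>, which add up to a
      perfect square.\<close>
    then have "(H has_real_derivative - ((?p + ?q) * (y1 u + y2 u)\<^sup>2 * exp (- \<phi> u))) (at u)"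
      unfolding H_def using u by (auto intro!: derivative_eq_intros d1 d2 simp: algebra_simps power2_eq_square)
    moreover have "- ((?p + ?q) * (y1 u + y2 u)\<^sup>2 * exp (- \<phi> u)) \<le> 0" by simp
    ultimately show "\<exists>y. (H has_real_derivative y) (at u) \<and> y \<le> 0" by blast
  next
    have "continuous_on {0..w} y1" "continuous_on {0..w} y2"
      using cont by (auto elim: continuous_on_subset)
    moreover have "continuous_on {0..w} \<phi>"
      unfolding \<phi>_def using \<nu> by (intro continuous_intros continuous_on_powr') auto
    ultimately show "continuous_on {0..w} H" unfolding H_def by (intro continuous_intros)
  qed
  then have "(y1 w)\<^sup>2 + (y2 w)\<^sup>2 \<le> 0" by (simp add: H_def zero mult_le_0_iff)
  then show ?thesis by (simp add: sum_power2_le_zero_iff)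
qed

text \<open>For \<open>w > 0\<close> this is again
  \<open>2 * w powr (\<nu> / 2) * K\<^sub>\<nu> (2 * sqrt w)\<close>, now read off from the quotient
  that defines \<open>K\<^sub>\<nu>\<close>. The power of \<open>w\<close> cancels the singularity
  of \<open>I\<close> of order \<open>- \<nu>\<close> at the origin.\<close>

definition bessel_connection :: "real \<Rightarrow> real \<Rightarrow> complex" where
  "bessel_connection \<nu> w = of_real (pi / sin (pi * \<nu>)) *
     (bessel_series (- of_real \<nu>) (of_real w) - of_real (w powr \<nu>) * bessel_series (of_real \<nu>) (of_real w))"

text \<open>Differentiation raises the order \<open>- \<nu>\<close> of the first series to
  \<open>1 - \<nu>\<close>; by the recurrence it lowers the order of the second from
  \<open>\<nu>\<close> to \<open>\<nu> - 1\<close>. These are the two series of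
  \<open>bessel_connection (1 - \<nu>)\<close> in exchanged roles, whence the minus sign.\<close>

lemma has_vector_derivative_bessel_connection:
  assumes w: "w > 0" and \<nu>: "0 < \<nu>" "\<nu> < 1"
  shows "(bessel_connection \<nu> has_vector_derivative - (of_real (w powr (\<nu> - 1)) * bessel_connection (1 - \<nu>) w)) (at w)"
proof -
  have S: "((\<lambda>w. bessel_series \<mu> (of_real w)) has_vector_derivative bessel_series (\<mu> + 1) (of_real w)) (at w)" for \<mu>
    by (rule has_vector_derivative_real_field[OF has_field_derivative_bessel_series])
  have P: "((\<lambda>w. complex_of_real (w powr \<nu>)) has_vector_derivative of_real (\<nu> * w powr (\<nu> - 1))) (at w)"
    using w by (intro has_vector_derivative_of_real)
      (auto intro!: derivative_eq_intros simp flip: has_real_derivative_iff_has_vector_derivative)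
  let ?S = "\<lambda>\<mu>. bessel_series \<mu> (of_real w)"
  have split: "w powr \<nu> = w * w powr (\<nu> - 1)" using w by (simp add: powr_diff)
  have inv: "w powr (\<nu> - 1) * w powr (1 - \<nu>) = 1" using w by (simp flip: powr_add)
  have "(bessel_connection \<nu> has_vector_derivative of_real (pi / sin (pi * \<nu>)) *
      (?S (- of_real \<nu> + 1) - (of_real (w powr \<nu>) * ?S (of_real \<nu> + 1) + of_real (\<nu> * w powr (\<nu> - 1)) * ?S (of_real \<nu>)))) (at w)"
    unfolding bessel_connection_def[abs_def]
    by (intro has_vector_derivative_mult_right has_vector_derivative_diff has_vector_derivative_mult S P)
  also have "of_real (w powr \<nu>) * ?S (of_real \<nu> + 1) + of_real (\<nu> * w powr (\<nu> - 1)) * ?S (of_real \<nu>) =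
      of_real (w powr (\<nu> - 1)) * (of_real \<nu> * ?S (of_real \<nu>) + of_real w * ?S (of_real \<nu> + 1))"
    by (simp add: split algebra_simps)
  also have "\<dots> = of_real (w powr (\<nu> - 1)) * ?S (of_real \<nu> - 1)"
    by (simp only: bessel_series_recurrence)
  also have "of_real (pi / sin (pi * \<nu>)) * (?S (- of_real \<nu> + 1) - of_real (w powr (\<nu> - 1)) * ?S (of_real \<nu> - 1)) =
      - (of_real (w powr (\<nu> - 1)) * bessel_connection (1 - \<nu>) w)"
  proof -
    have "sin (pi * (1 - \<nu>)) = sin (pi * \<nu>)"
      by (simp add: right_diff_distrib sin_diff)
    moreover have "?S (- of_real \<nu> + 1) = of_real (w powr (\<nu> - 1)) * (of_real (w powr (1 - \<nu>)) * ?S (1 - of_real \<nu>))"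
      using inv by (simp flip: of_real_mult mult.assoc)
    ultimately show ?thesis by (simp add: bessel_connection_def algebra_simps)
  qed
  finally show ?thesis .
qed

lemma continuous_on_bessel_connection:
  assumes "\<nu> > 0"
  shows "continuous_on {0..} (bessel_connection \<nu>)"
proof -
  have "continuous_on {0..} (\<lambda>w. bessel_series \<mu> (of_real w))" for \<mu>
    by (intro continuous_on_compose2[OF holomorphic_on_imp_continuous_on[OF bessel_series_holomorphic[of \<mu> UNIV]]]
        continuous_intros) auto
  then show ?thesis unfolding bessel_connection_def[abs_def] using assms
    by (intro continuous_intros continuous_on_powr') auto
qed

lemma bessel_series_0_right: "bessel_series \<nu> 0 = rGamma (\<nu> + 1)"
  using sums_unique2[OF bessel_series_sums[of \<nu> 0] powser_sums_zero] by simp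

lemma bessel_connection_0:
  assumes \<nu>: "0 < \<nu>" "\<nu> < 1"
  shows "bessel_connection \<nu> 0 = of_real (Gamma \<nu>)"
proof -
  have nz: "Gamma (complex_of_real (1 - \<nu>)) \<noteq> 0"
  proof -
    have "0 < Gamma (1 - \<nu>)" by (rule Gamma_real_pos) (use \<nu> in simp)
    then show ?thesis unfolding Gamma_complex_of_real of_real_eq_0_iff by linarith
  qed
  \<comment> \<open>Since \<open>\<nu> > 0\<close>, the value \<open>0 powr \<nu> = 0\<close> agrees
    with the limit, and only the series of order \<open>- \<nu>\<close> contributes.\<close>
  have "bessel_connection \<nu> 0 = of_real (pi / sin (pi * \<nu>)) * rGamma (of_real (1 - \<nu>))"
    using \<nu> by (simp add: bessel_connection_def bessel_series_0_right)
  also have "of_real (pi / sin (pi * \<nu>)) = Gamma (complex_of_real \<nu>) * Gamma (of_real (1 - \<nu>))"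
    using Gamma_reflection_complex[of "of_real \<nu>"] by (simp flip: sin_of_real)
  finally show ?thesis using nz by (simp add: rGamma_inverse_Gamma Gamma_complex_of_real)
qed

lemma bessel_connection_eq_laplace:
  assumes \<nu>: "0 < \<nu>" "\<nu> < 1" and w: "w \<ge> 0"
  shows "bessel_connection \<nu> w = of_real (bessel_laplace \<nu> w)"
proof -
  have c: "continuous_on {0..} (bessel_connection \<mu>)" "continuous_on {0..} (bessel_laplace \<mu>)"
    if "\<mu> \<in> {\<nu>, 1 - \<nu>}" for \<mu>
    using continuous_on_bessel_connection[of \<mu>] continuous_on_bessel_laplace[of \<mu>] that \<nu> by auto
  have z: "bessel_connection \<mu> 0 = of_real (bessel_laplace \<mu> 0)" if "\<mu> \<in> {\<nu>, 1 - \<nu>}" for \<mu>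
    using bessel_connection_0[of \<mu>] bessel_laplace_0[of \<mu>] that \<nu> by auto
  have dRe: "((\<lambda>w. Re (bessel_connection \<mu> w)) has_real_derivative - (u powr (\<mu> - 1) * Re (bessel_connection (1 - \<mu>) u))) (at u)"
    and dIm: "((\<lambda>w. Im (bessel_connection \<mu> w)) has_real_derivative - (u powr (\<mu> - 1) * Im (bessel_connection (1 - \<mu>) u))) (at u)"
    if "\<mu> \<in> {\<nu>, 1 - \<nu>}" "u > 0" for \<mu> u
    using bounded_linear.has_vector_derivative[OF bounded_linear_Re has_vector_derivative_bessel_connection[of u \<mu>]]
      bounded_linear.has_vector_derivative[OF bounded_linear_Im has_vector_derivative_bessel_connection[of u \<mu>]] that \<nu>
    by (auto simp: has_real_derivative_iff_has_vector_derivative)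
  \<comment> \<open>\<open>coupled_system_unique\<close> is about real functions. The Laplace
    integral is real, so the imaginary parts solve the system by themselves with initial values
    0.\<close>
  have "Im (bessel_connection \<nu> w) = 0"
  proof (rule coupled_system_unique[OF \<nu>, of "\<lambda>w. Im (bessel_connection \<nu> w)" "\<lambda>w. Im (bessel_connection (1 - \<nu>) w)"])
    show "((\<lambda>w. Im (bessel_connection (1 - \<nu>) w)) has_real_derivative - (u powr - \<nu> * Im (bessel_connection \<nu> u))) (at u)"
      if "u > 0" for u using dIm[of "1 - \<nu>" u] that by simp
  qed (use c z dIm w in \<open>auto intro!: continuous_intros\<close>)
  moreover have "Re (bessel_connection \<nu> w) - bessel_laplace \<nu> w = 0"
  proof (rule coupled_system_unique[OF \<nu>, of "\<lambda>w. Re (bessel_connection \<nu> w) - bessel_laplace \<nu> w"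
        "\<lambda>w. Re (bessel_connection (1 - \<nu>) w) - bessel_laplace (1 - \<nu>) w"])
    show "((\<lambda>w. Re (bessel_connection \<nu> w) - bessel_laplace \<nu> w) has_real_derivative
        - (u powr (\<nu> - 1) * (Re (bessel_connection (1 - \<nu>) u) - bessel_laplace (1 - \<nu>) u))) (at u)" if "u > 0" for u
      using DERIV_diff[OF dRe[of \<nu> u] has_field_derivative_bessel_laplace[of u \<nu>]] that \<nu> by (simp add: algebra_simps)
    show "((\<lambda>w. Re (bessel_connection (1 - \<nu>) w) - bessel_laplace (1 - \<nu>) w) has_real_derivative
        - (u powr - \<nu> * (Re (bessel_connection \<nu> u) - bessel_laplace \<nu> u))) (at u)" if "u > 0" for u
      using DERIV_diff[OF dRe[of "1 - \<nu>" u] has_field_derivative_bessel_laplace[of u "1 - \<nu>"]] that \<nu> by (simp add: algebra_simps)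
  qed (use c z w in \<open>auto intro!: continuous_intros\<close>)
  ultimately show ?thesis by (simp add: complex_eq_iff)
qed

lemma besselK_log_quotient_of_real:
  assumes "z > 0"
  shows "besselK_log_quotient (of_real (ln z)) (of_real \<nu>) =
     of_real (exp (- \<nu> * (ln z - ln 2)) / 2) * bessel_connection \<nu> ((z / 2)\<^sup>2)"
proof -
  let ?L = "ln z - ln 2"
  have L2: "Ln 2 = complex_of_real (ln 2)" using Ln_of_real[of 2] by simp
  have w: "(exp (of_real (ln z)) / 2)\<^sup>2 = complex_of_real ((z / 2)\<^sup>2)"
    using assms by (simp add: exp_of_real)
  \<comment> \<open>Extracting \<open>exp (- \<nu> * ?L)\<close> from both functions
    \<open>I\<close> leaves exactly the power \<open>w powr \<nu>\<close> of
    \<open>bessel_connection\<close> at \<open>w = (z / 2)\<^sup>2\<close>.\<close>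
  have "((z / 2)\<^sup>2) powr \<nu> = exp (2 * \<nu> * ?L)"
    using assms by (simp add: powr_def ln_realpow ln_div)
  then have e: "exp (\<nu> * ?L) = exp (- \<nu> * ?L) * ((z / 2)\<^sup>2) powr \<nu>"
    by (simp add: algebra_simps flip: exp_add)
  have E: "exp (of_real \<mu> * (of_real (ln z) - Ln 2)) = complex_of_real (exp (\<mu> * ?L))" for \<mu>
    by (simp add: L2 flip: exp_of_real)
  let ?S = "\<lambda>\<mu>. bessel_series \<mu> (of_real ((z / 2)\<^sup>2))"
  have "besselK_log_quotient (of_real (ln z)) (of_real \<nu>) =
      of_real pi / 2 * (of_real (exp (- \<nu> * ?L)) * ?S (- of_real \<nu>) - of_real (exp (\<nu> * ?L)) * ?S (of_real \<nu>)) /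
      of_real (sin (pi * \<nu>))"
    unfolding besselK_log_quotient_def besselI_log_def w
    using E[of \<nu>] E[of "- \<nu>"] by (simp flip: sin_of_real)
  also have "\<dots> = of_real pi / 2 * (of_real (exp (- \<nu> * ?L)) * ?S (- of_real \<nu>) -
      of_real (exp (- \<nu> * ?L)) * of_real (((z / 2)\<^sup>2) powr \<nu>) * ?S (of_real \<nu>)) / of_real (sin (pi * \<nu>))"
    by (simp only: e of_real_mult)
  also have "\<dots> = of_real (exp (- \<nu> * ?L) / 2) * bessel_connection \<nu> ((z / 2)\<^sup>2)"
    by (simp only: bessel_connection_def of_real_divide of_real_numeral)
      (simp only: times_divide_eq_left times_divide_eq_right right_diff_distrib diff_divide_distrib mult_ac)
  finally show ?thesis .
qed

lemma besselK_log_1_of_real: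
  assumes z: "z > 0"
  shows "besselK_log 1 (of_real (ln z)) = of_real (bessel_laplace 1 ((z / 2)\<^sup>2) / z)"
proof -
  \<comment> \<open>The approach is from below because \<open>bessel_connection_eq_laplace\<close>
    covers the orders strictly between 0 and 1. Starting at \<open>1 / 2\<close> allows one majorant
    for all \<open>n\<close>.\<close>
  define \<nu> where "\<nu> = (\<lambda>n. 1 - 1 / (2 + real n))"
  have \<nu>: "\<nu> n \<in> {1/2..<1}" for n by (simp add: \<nu>_def field_simps)
  then have \<nu>_ne: "\<nu> n \<noteq> 1" for n by (metis atLeastLessThan_iff less_irrefl)
  have "(\<lambda>n. 1 - 1 / (2 + real n)) \<longlonglongrightarrow> 1 - 0"
    by (intro tendsto_intros tendsto_divide_0[OF tendsto_const] filterlim_at_top_imp_at_infinity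
        filterlim_tendsto_add_at_top[OF tendsto_const] filterlim_real_sequentially)
  then have \<nu>1: "\<nu> \<longlonglongrightarrow> 1" by (simp add: \<nu>_def)
  have "filterlim (\<lambda>n. complex_of_real (\<nu> n)) (at 1) sequentially"
    using tendsto_of_real[OF \<nu>1, where 'a = complex] \<nu>_ne by (auto simp: filterlim_at eventually_sequentially less_imp_neq)
  from filterlim_compose[OF besselK_log_quotient_tendsto_1 this]
  have "(\<lambda>n. besselK_log_quotient (of_real (ln z)) (of_real (\<nu> n))) \<longlonglongrightarrow> besselK_log 1 (of_real (ln z))" .
  moreover have "besselK_log_quotient (of_real (ln z)) (of_real (\<nu> n)) =
      of_real (exp (- \<nu> n * (ln z - ln 2)) / 2 * bessel_laplace (\<nu> n) ((z / 2)\<^sup>2))" for n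
    using besselK_log_quotient_of_real[OF z] bessel_connection_eq_laplace[of "\<nu> n" "(z / 2)\<^sup>2"] \<nu>[of n] by simp
  moreover have "(\<lambda>n. complex_of_real (exp (- \<nu> n * (ln z - ln 2)) / 2 * bessel_laplace (\<nu> n) ((z / 2)\<^sup>2))) \<longlonglongrightarrow>
      of_real (exp (- 1 * (ln z - ln 2)) / 2 * bessel_laplace 1 ((z / 2)\<^sup>2))"
    using \<nu> by (intro tendsto_intros \<nu>1 bessel_laplace_tendsto_1) (auto simp: less_imp_le)
  ultimately have "besselK_log 1 (of_real (ln z)) =
      of_real (exp (- 1 * (ln z - ln 2)) / 2 * bessel_laplace 1 ((z / 2)\<^sup>2))"
    using LIMSEQ_unique by fastforce
  also have "exp (- 1 * (ln z - ln 2)) / 2 = 1 / z" using z by (simp add: exp_diff)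
  finally show ?thesis by simp
qed

section \<open>The Hankel transform at \<open>a = 0\<close>\<close>

text \<open>For a nonnegative function integrability is absolute, which is what the change of
  variables demands.\<close>

lemma has_integral_substitution_pos:
  fixes f g g' :: "real \<Rightarrow> real"
  assumes f: "(f has_integral b) {0<..}" "\<And>x. x > 0 \<Longrightarrow> f x \<ge> 0"
    and g: "\<And>x. x > 0 \<Longrightarrow> (g has_real_derivative g' x) (at x)" "bij_betw g {0<..} {0<..}"
    and g': "\<And>x. x > 0 \<Longrightarrow> g' x \<ge> 0"
  shows "((\<lambda>x. g' x * f (g x)) has_integral b) {0<..}"
proof -
  have L: "{0<..} \<in> sets (lebesgue :: real measure)" by (rule sets_completionI_sets) simp
  have "f absolutely_integrable_on g ` {0<..} \<and> integral (g ` {0<..}) f = b"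
    unfolding bij_betw_imp_surj_on[OF g(2)]
    using nonnegative_absolutely_integrable_1[of f "{0<..}"] f by (auto simp: has_integral_iff)
  then have "(\<lambda>x. \<bar>g' x\<bar> * f (g x)) absolutely_integrable_on {0<..} \<and> integral {0<..} (\<lambda>x. \<bar>g' x\<bar> * f (g x)) = b"
    using has_absolute_integral_change_of_variables_1'[OF L _ bij_betw_imp_inj_on[OF g(2)], of g' f b]
      has_field_derivative_at_within[OF g(1)] by auto
  then have "((\<lambda>x. \<bar>g' x\<bar> * f (g x)) has_integral b) {0<..}"
    using set_lebesgue_integral_eq_integral(1) by (auto simp: has_integral_iff)
  then show ?thesis by (rule has_integral_eq[rotated]) (use g' in auto)
qed

section \<open>Gaussian moments and Weber's integral\<close>

lemma bij_betw_pos_scale: "s > 0 \<Longrightarrow> bij_betw (\<lambda>x. s * x) {0<..} {0<..}" for s :: real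
  by (rule bij_betwI[where g = "\<lambda>y. y / s"]) auto

lemma has_integral_power_exp:
  assumes "s > (0::real)"
  shows "((\<lambda>u. u ^ k * exp (- s * u)) has_integral fact k / s ^ (k + 1)) {0<..}"
proof -
  have "((\<lambda>v. v powr (real (k + 1) - 1) * exp (- v)) has_integral Gamma (real (k + 1))) {0<..}"
    by (rule Gamma_has_integral_open) simp
  moreover have "Gamma (real (k + 1)) = fact k" using Gamma_fact[of k, where 'a = real] by (simp add: add.commute)
  ultimately have "((\<lambda>v. v powr (real (k + 1) - 1) * exp (- v)) has_integral fact k) {0<..}" by (simp only:)
  then have "((\<lambda>v::real. v ^ k * exp (- v)) has_integral fact k) {0<..}"
    by (rule has_integral_eq[rotated]) (auto simp: powr_realpow)
  then have "((\<lambda>u. s * ((s * u) ^ k * exp (- (s * u)))) has_integral fact k) {0<..}"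
    by (rule has_integral_substitution_pos) (use assms bij_betw_pos_scale in \<open>auto intro!: derivative_eq_intros\<close>)
  from has_integral_mult_right[OF this, of "1 / s ^ (k + 1)"] show ?thesis
    using assms by (simp add: power_mult_distrib)
qed

lemma has_integral_odd_gaussian_moment:
  assumes "u > (0::real)"
  shows "((\<lambda>c. c ^ (2 * k + 1) * exp (- u * c\<^sup>2)) has_integral fact k / (2 * u ^ (k + 1))) {0<..}"
proof -
  have "bij_betw (\<lambda>c::real. c\<^sup>2) {0<..} {0<..}"
    by (rule bij_betwI[where g = sqrt]) auto
  then have "((\<lambda>c. 2 * c * ((c\<^sup>2) ^ k * exp (- u * c\<^sup>2))) has_integral fact k / u ^ (k + 1)) {0<..}"
    by (intro has_integral_substitution_pos[OF has_integral_power_exp[OF assms]])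
      (auto intro!: derivative_eq_intros)
  from has_integral_mult_right[OF this, of "1 / 2"] show ?thesis
    by (simp add: mult_ac flip: power_mult)
qed

lemma sum_power_fact_le_exp: "0 \<le> x \<Longrightarrow> (\<Sum>k<n. x ^ k / fact k) \<le> exp (x::real)"
  using sum_le_suminf[of "\<lambda>k. x ^ k / fact k" "{..<n}"] exp_converges[of x]
  by (simp add: sums_iff field_simps)

lemma J0_sums: "(\<lambda>k. (- ((z / 2)\<^sup>2)) ^ k / (fact k)\<^sup>2) sums J0 z"
proof -
  have "rGamma (of_nat k + 1 :: complex) = 1 / fact k" for k
    using Gamma_fact[of k, where 'a = complex] by (simp add: rGamma_inverse_Gamma add.commute divide_inverse)
  then show ?thesis
    using bessel_series_sums[of 0 "- ((z / 2)\<^sup>2)"] by (simp add: J0_def power2_eq_square)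
qed

text \<open>Integrate the series of \<open>J0\<close> termwise: the moment
  \<open>fact k / (2 * u ^ (k + 1))\<close> cancels one of the two factorials in the coefficient,
  and an exponential series remains.\<close>

lemma Weber_integral:
  fixes u t :: real
  assumes u: "u > 0"
  shows "((\<lambda>c. of_real (c * exp (- u * c\<^sup>2)) * J0 (of_real (c * t))) has_integral
      of_real (exp (- (t\<^sup>2 / (4 * u))) / (2 * u))) {0<..}"
proof -
  define a where "a = (\<lambda>k. of_real ((- (t\<^sup>2 / 4)) ^ k / (fact k)\<^sup>2) :: complex)"
  define P where "P = (\<lambda>n c. \<Sum>k<n. of_real (c ^ (2 * k + 1) * exp (- u * c\<^sup>2)) * a k)"
  have P_eq: "P n c = of_real (c * exp (- u * c\<^sup>2)) * (\<Sum>k<n. (- ((of_real (c * t) / 2)\<^sup>2)) ^ k / (fact k)\<^sup>2)" for n c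
    unfolding P_def a_def sum_distrib_left
  proof (intro sum.cong refl)
    fix k
    have "- ((of_real (c * t) / 2)\<^sup>2) = complex_of_real (c\<^sup>2 * (- (t\<^sup>2 / 4)))"
      by (simp add: power_mult_distrib power_divide)
    then have "(- ((of_real (c * t) / 2)\<^sup>2)) ^ k = complex_of_real ((c\<^sup>2 * (- (t\<^sup>2 / 4))) ^ k)"
      by (simp only: of_real_power)
    also have "\<dots> = of_real (c ^ (2 * k)) * of_real ((- (t\<^sup>2 / 4)) ^ k)"
      by (simp only: power_mult_distrib power_mult of_real_mult)
    finally show "of_real (c ^ (2 * k + 1) * exp (- u * c\<^sup>2)) * of_real ((- (t\<^sup>2 / 4)) ^ k / (fact k)\<^sup>2) =
      of_real (c * exp (- u * c\<^sup>2)) * ((- ((complex_of_real (c * t) / 2)\<^sup>2)) ^ k / (fact k)\<^sup>2)"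
      by (simp add: mult_ac)
  qed
  have intP: "(P n has_integral (\<Sum>k<n. of_real (fact k / (2 * u ^ (k + 1))) * a k)) {0<..}" for n
    unfolding P_def
    by (intro has_integral_sum has_integral_mult_left has_integral_of_real has_integral_odd_gaussian_moment u) auto
  \<comment> \<open>Half of the Gaussian decay pays for the partial sums. Term \<open>k\<close> is
    bounded by the product of \<open>(t\<^sup>2 / (2 * u)) ^ k / fact k\<close> and
    \<open>(u / 2 * c\<^sup>2) ^ k / fact k\<close>; the first factor is at most an exponential free
    of \<open>c\<close>, and the second ones sum to at most
    \<open>exp (u / 2 * c\<^sup>2)\<close>.\<close>
  let ?g = "\<lambda>c. exp (t\<^sup>2 / (2 * u)) * (c ^ (2 * 0 + 1) * exp (- (u / 2) * c\<^sup>2))"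
  have bound: "norm (P n c) \<le> ?g c" if c: "c \<in> {0<..}" for n c
  proof -
    have "norm (\<Sum>k<n. (- ((complex_of_real (c * t) / 2)\<^sup>2)) ^ k / (fact k)\<^sup>2) \<le>
        (\<Sum>k<n. exp (t\<^sup>2 / (2 * u)) * ((u / 2 * c\<^sup>2) ^ k / fact k))"
    proof (rule sum_norm_le)
      fix k
      have "norm ((- ((complex_of_real (c * t) / 2)\<^sup>2)) ^ k / (fact k)\<^sup>2) = ((c * t / 2)\<^sup>2) ^ k / (fact k)\<^sup>2"
        by (simp add: norm_power norm_divide norm_mult power_divide power_mult_distrib)
      also have "(c * t / 2)\<^sup>2 = t\<^sup>2 / (2 * u) * (u / 2 * c\<^sup>2)"
        using u by (simp add: power2_eq_square field_simps)
      also have "(t\<^sup>2 / (2 * u) * (u / 2 * c\<^sup>2)) ^ k / (fact k)\<^sup>2 =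
          (t\<^sup>2 / (2 * u)) ^ k / fact k * ((u / 2 * c\<^sup>2) ^ k / fact k)"
        by (simp only: power_mult_distrib power2_eq_square[of "fact k"] times_divide_times_eq)
      also have "\<dots> \<le> exp (t\<^sup>2 / (2 * u)) * ((u / 2 * c\<^sup>2) ^ k / fact k)"
      proof (rule mult_right_mono)
        have "(t\<^sup>2 / (2 * u)) ^ k / fact k \<le> (\<Sum>j<Suc k. (t\<^sup>2 / (2 * u)) ^ j / fact j)"
          using u by (intro member_le_sum) auto
        also have "\<dots> \<le> exp (t\<^sup>2 / (2 * u))" using u by (intro sum_power_fact_le_exp) auto
        finally show "(t\<^sup>2 / (2 * u)) ^ k / fact k \<le> exp (t\<^sup>2 / (2 * u))" .
      qed (use u in auto)
      finally show "norm ((- ((complex_of_real (c * t) / 2)\<^sup>2)) ^ k / (fact k)\<^sup>2) \<le>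
          exp (t\<^sup>2 / (2 * u)) * ((u / 2 * c\<^sup>2) ^ k / fact k)" .
    qed
    also have "\<dots> \<le> exp (t\<^sup>2 / (2 * u)) * exp (u / 2 * c\<^sup>2)"
      unfolding sum_distrib_left[symmetric] using u by (intro mult_left_mono sum_power_fact_le_exp) auto
    finally have "norm (P n c) \<le> c * exp (- u * c\<^sup>2) * (exp (t\<^sup>2 / (2 * u)) * exp (u / 2 * c\<^sup>2))"
      unfolding P_eq norm_mult[of "of_real (c * exp (- u * c\<^sup>2))"] norm_of_real
      by (rule mult_mono[rotated]) (use c in \<open>auto simp: abs_mult\<close>)
    also have "\<dots> = exp (t\<^sup>2 / (2 * u)) * (c * (exp (- u * c\<^sup>2) * exp (u / 2 * c\<^sup>2)))"
      by (simp only: mult_ac)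
    also have "\<dots> = ?g c" unfolding exp_add[symmetric] by simp
    finally show ?thesis .
  qed
  have lim: "(\<lambda>n. P n c) \<longlonglongrightarrow> of_real (c * exp (- u * c\<^sup>2)) * J0 (of_real (c * t))" for c
    unfolding P_eq using J0_sums[of "of_real (c * t)"] unfolding sums_def by (intro tendsto_mult tendsto_const)
  have g: "?g integrable_on {0<..}"
    using u by (intro has_integral_integrable[OF has_integral_mult_right[OF has_integral_odd_gaussian_moment]]) auto
  note dc = dominated_convergence[OF has_integral_integrable[OF intP] g bound lim]
  have "(\<lambda>n. \<Sum>k<n. complex_of_real (fact k / (2 * u ^ (k + 1))) * a k) \<longlonglongrightarrow>
      of_real (exp (- (t\<^sup>2 / (4 * u))) / (2 * u))"
  proof -
    have "of_real (fact k / (2 * u ^ (k + 1))) * a k = complex_of_real ((- (t\<^sup>2 / (4 * u))) ^ k /\<^sub>R fact k * (1 / (2 * u)))" for k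
    proof -
      have "(- (t\<^sup>2 / (4 * u))) ^ k = (- (t\<^sup>2 / 4)) ^ k / u ^ k"
        by (simp flip: power_divide)
      moreover have "fact k / (2 * u ^ (k + 1)) * ((- (t\<^sup>2 / 4)) ^ k / (fact k)\<^sup>2) =
          (- (t\<^sup>2 / 4)) ^ k / u ^ k / fact k * (1 / (2 * u))"
        using u by (simp add: field_simps power2_eq_square)
      ultimately have "fact k / (2 * u ^ (k + 1)) * ((- (t\<^sup>2 / 4)) ^ k / (fact k)\<^sup>2) =
          (- (t\<^sup>2 / (4 * u))) ^ k /\<^sub>R fact k * (1 / (2 * u))"
        by (simp only: real_scaleR_def divide_inverse[of _ "fact k"] mult.commute[of "inverse (fact k)"])
      then show ?thesis unfolding a_def of_real_mult[symmetric] by (simp only:)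
    qed
    then have "(\<lambda>k. of_real (fact k / (2 * u ^ (k + 1))) * a k) sums complex_of_real (exp (- (t\<^sup>2 / (4 * u))) * (1 / (2 * u)))"
      using sums_of_real[OF sums_mult2[OF exp_converges[of "- (t\<^sup>2 / (4 * u))"], of "1 / (2 * u)"]] by (simp only:)
    then show ?thesis by (simp add: sums_def)
  qed
  then have "integral {0<..} (\<lambda>c. of_real (c * exp (- u * c\<^sup>2)) * J0 (of_real (c * t))) =
      of_real (exp (- (t\<^sup>2 / (4 * u))) / (2 * u))"
    using dc(2) unfolding integral_unique[OF intP] by (rule LIMSEQ_unique[rotated])
  then show ?thesis using dc(1) by (simp only: has_integral_iff simp_thms)
qed

text \<open>A bridge to Fubini's theorem, which is used for Bochner integrals over
  \<open>lborel\<close>, while the other results are about Henstock-Kurzweil integrals.\<close>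

lemma integral_lborel_eq_HK:
  fixes h :: "real \<Rightarrow> 'a::euclidean_space"
  assumes [measurable]: "h \<in> borel_measurable borel" "S \<in> sets borel"
    and h: "h absolutely_integrable_on S"
  shows "integrable lborel (\<lambda>x. indicat_real S x *\<^sub>R h x)"
    and "(\<integral>x. indicat_real S x *\<^sub>R h x \<partial>lborel) = integral S h"
proof -
  have m: "(\<lambda>x. indicat_real S x *\<^sub>R h x) \<in> borel_measurable lborel" by measurable
  show "integrable lborel (\<lambda>x. indicat_real S x *\<^sub>R h x)"
    using h integrable_completion[OF m] by (simp add: set_integrable_def)
  show "(\<integral>x. indicat_real S x *\<^sub>R h x \<partial>lborel) = integral S h"
    using set_lebesgue_integral_eq_integral(2)[OF h] integral_completion[OF m]
    by (simp add: set_lebesgue_integral_def)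
qed

lemma J0_measurable [measurable]: "J0 \<in> borel_measurable borel"
  by (intro borel_measurable_continuous_onI continuous_at_imp_continuous_on ballI
      DERIV_isCont[OF has_field_derivative_J0])

lemma absolutely_integrable_bounded_J0:
  assumes g: "(g has_integral I) {0<..}" "\<And>c. c > 0 \<Longrightarrow> g c \<ge> 0" and t: "t \<ge> 0"
    and [measurable]: "g \<in> borel_measurable borel"
  shows "(\<lambda>c. of_real (g c) * J0 (of_real (c * t))) absolutely_integrable_on {0<..}"
proof (rule measurable_bounded_by_integrable_imp_absolutely_integrable)
  have "(\<lambda>c. of_real (g c) * J0 (of_real (c * t))) \<in> borel_measurable borel" by measurable
  then have "(\<lambda>c. of_real (g c) * J0 (of_real (c * t))) \<in> borel_measurable lebesgue"
    by (simp add: measurable_completion)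
  then show "(\<lambda>c. of_real (g c) * J0 (of_real (c * t))) \<in> borel_measurable (lebesgue_on {0<..})"
    by (rule measurable_restrict_space1)
  show "norm (of_real (g c) * J0 (of_real (c * t))) \<le> g c" if "c \<in> {0<..}" for c
    using that t g(2)[of c] norm_J0_le_1[of "c * t"] mult_left_mono[of "norm (J0 (of_real (c * t)))" 1 "g c"]
    by (simp add: norm_mult)
qed (use g(1) in \<open>auto intro: sets_completionI_sets\<close>)

lemma has_integral_antiderivative_to_inf:
  fixes G h :: "real \<Rightarrow> real"
  assumes G: "\<And>c. c \<ge> 0 \<Longrightarrow> (G has_real_derivative h c) (at c)" "(G \<longlongrightarrow> L) at_top"
    and h: "\<And>c. c \<ge> 0 \<Longrightarrow> h c \<ge> 0"
  shows "(h has_integral L - G 0) {0..}"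
proof (rule has_integral_to_inf)
  have I: "(h has_integral G y - G 0) {0..y}" if "y \<ge> 0" for y
    using that by (intro fundamental_theorem_of_calculus)
      (auto intro: has_field_derivative_at_within G(1) simp flip: has_real_derivative_iff_has_vector_derivative)
  then show "h integrable_on {0..y}" for y
    by (cases "y \<ge> 0") (auto intro: has_integral_integrable)
  have "eventually (\<lambda>y. integral {0..y} h = G y - G 0) at_top"
    using eventually_ge_at_top[of 0] by eventually_elim (use I in auto)
  moreover have "((\<lambda>y. G y - G 0) \<longlongrightarrow> L - G 0) at_top" by (intro tendsto_intros G)
  ultimately show "((\<lambda>y. integral {0..y} h) \<longlongrightarrow> L - G 0) at_top" by (simp add: tendsto_cong)
qed (use h in auto)

lemma has_integral_Ici_iff_Ioi:
  fixes f :: "real \<Rightarrow> 'a::banach"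
  shows "(f has_integral I) {a..} \<longleftrightarrow> (f has_integral I) {a<..}"
  by (rule has_integral_spike_set_eq; rule negligible_subset[OF negligible_sing[of a]]) auto

lemma has_integral_inverse_square_kernel:
  fixes b :: real
  assumes "b > 0"
  shows "((\<lambda>c. c / (c\<^sup>2 + b\<^sup>2)\<^sup>2) has_integral 1 / (2 * b\<^sup>2)) {0<..}"
proof -
  have pos: "c\<^sup>2 + b\<^sup>2 > 0" for c using assms by (simp add: add_nonneg_pos)
  have "((\<lambda>c. c / (c\<^sup>2 + b\<^sup>2)\<^sup>2) has_integral 0 - (- 1 / 2 * inverse (0\<^sup>2 + b\<^sup>2))) {0..}"
  proof (rule has_integral_antiderivative_to_inf[where G = "\<lambda>c. - 1 / 2 * inverse (c\<^sup>2 + b\<^sup>2)"])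
    show "((\<lambda>c. - 1 / 2 * inverse (c\<^sup>2 + b\<^sup>2)) has_real_derivative c / (c\<^sup>2 + b\<^sup>2)\<^sup>2) (at c)" for c
    proof -
      have alg: "- 1 / 2 * - (inverse s * (2 * c) * inverse s) = c / s\<^sup>2" for s :: real
        by (cases "s = 0") (simp_all add: power2_eq_square field_simps)
      have "((\<lambda>c. c\<^sup>2 + b\<^sup>2) has_real_derivative 2 * c) (at c)"
        by (auto intro!: derivative_eq_intros)
      moreover have "c\<^sup>2 + b\<^sup>2 \<noteq> 0" using pos[of c] by linarith
      ultimately show ?thesis unfolding alg[symmetric] by (intro DERIV_cmult DERIV_inverse')
    qed
    show "((\<lambda>c. - 1 / 2 * inverse (c\<^sup>2 + b\<^sup>2)) \<longlongrightarrow> 0) at_top"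
      by real_asymp
  qed auto
  also have "0 - (- 1 / 2 * inverse (0\<^sup>2 + b\<^sup>2)) = 1 / (2 * b\<^sup>2)" by (simp add: inverse_eq_divide)
  finally show ?thesis unfolding has_integral_Ici_iff_Ioi .
qed

lemma hankel_base_eq:
  assumes b: "b > 0" and t: "t > 0"
  shows "integral {0<..} (\<lambda>c. of_real (c / (c\<^sup>2 + b\<^sup>2)\<^sup>2) * J0 (of_real (c * t))) =
     of_real (bessel_laplace 1 ((b * t / 2)\<^sup>2) / (2 * b\<^sup>2))"
proof -
  let ?i = "indicat_real {0<..}"
  \<comment> \<open>Integrating \<open>u * exp (- (c\<^sup>2 + b\<^sup>2) * u)\<close> over
    \<open>u > 0\<close> gives \<open>1 / (c\<^sup>2 + b\<^sup>2)\<^sup>2\<close>. In the other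
    order the \<open>c\<close>-integral is Weber's, and its factor \<open>1 / (2 * u)\<close>
    cancels \<open>u\<close>.\<close>
  define H where "H = (\<lambda>c u. of_real (c * (u * exp (- (c\<^sup>2 + b\<^sup>2) * u))) * J0 (of_real (c * t)))"
  define f where "f = (\<lambda>c u. ?i c *\<^sub>R ?i u *\<^sub>R H c u)"
  have Hm [measurable]: "case_prod H \<in> borel_measurable (borel \<Otimes>\<^sub>M borel)"
    unfolding H_def by measurable
  have pos: "c\<^sup>2 + b\<^sup>2 > 0" for c using b by (simp add: add_nonneg_pos)
  have int_u: "((\<lambda>u. u * exp (- (c\<^sup>2 + b\<^sup>2) * u)) has_integral 1 / (c\<^sup>2 + b\<^sup>2)\<^sup>2) {0<..}" for c
    using has_integral_power_exp[OF pos, of 1 c] by (simp add: power2_eq_square)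
  then have abs_u: "(\<lambda>u. u * exp (- (c\<^sup>2 + b\<^sup>2) * u)) absolutely_integrable_on {0<..}" for c
    by (intro nonnegative_absolutely_integrable_1) auto
  have H_u: "H c = (\<lambda>u. (u * exp (- (c\<^sup>2 + b\<^sup>2) * u)) *\<^sub>R (of_real c * J0 (of_real (c * t))))" for c
    by (simp add: H_def scaleR_conv_of_real mult_ac)
  have absH_u: "H c absolutely_integrable_on {0<..}" for c
    unfolding H_u using abs_u by (rule absolutely_integrable_scaleR_right)
  have intH_u: "integral {0<..} (H c) = of_real (c / (c\<^sup>2 + b\<^sup>2)\<^sup>2) * J0 (of_real (c * t))" for c
    unfolding H_u integral_unique[OF has_integral_scaleR_left[OF int_u]] by (simp add: scaleR_conv_of_real)
  have intnH_u: "(\<lambda>u. norm (H c u)) absolutely_integrable_on {0<..}"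
      "integral {0<..} (\<lambda>u. norm (H c u)) = c / (c\<^sup>2 + b\<^sup>2)\<^sup>2 * norm (J0 (of_real (c * t)))" if "c > 0" for c
  proof -
    have "((\<lambda>u. u * exp (- (c\<^sup>2 + b\<^sup>2) * u) * norm (of_real c * J0 (of_real (c * t)))) has_integral
        1 / (c\<^sup>2 + b\<^sup>2)\<^sup>2 * norm (of_real c * J0 (of_real (c * t)))) {0<..}"
      by (intro has_integral_mult_left int_u)
    then have "((\<lambda>u. norm (H c u)) has_integral
        1 / (c\<^sup>2 + b\<^sup>2)\<^sup>2 * norm (of_real c * J0 (of_real (c * t)))) {0<..}"
      by (rule has_integral_eq[rotated]) (use that in \<open>auto simp: H_u norm_mult abs_mult\<close>)
    also have "1 / (c\<^sup>2 + b\<^sup>2)\<^sup>2 * norm (of_real c * J0 (of_real (c * t))) =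
        c / (c\<^sup>2 + b\<^sup>2)\<^sup>2 * norm (J0 (of_real (c * t)))"
      using that by (simp add: norm_mult)
    finally have "((\<lambda>u. norm (H c u)) has_integral c / (c\<^sup>2 + b\<^sup>2)\<^sup>2 * norm (J0 (of_real (c * t)))) {0<..}" .
    then show "integral {0<..} (\<lambda>u. norm (H c u)) = c / (c\<^sup>2 + b\<^sup>2)\<^sup>2 * norm (J0 (of_real (c * t)))"
      by (rule integral_unique)
    show "(\<lambda>u. norm (H c u)) absolutely_integrable_on {0<..}" using absH_u by (rule absolutely_integrable_norm[unfolded o_def])
  qed
  have base_abs: "(\<lambda>c. of_real (c / (c\<^sup>2 + b\<^sup>2)\<^sup>2) * J0 (of_real (c * t))) absolutely_integrable_on {0<..}"
    using t by (intro absolutely_integrable_bounded_J0[OF has_integral_inverse_square_kernel[OF b]]) auto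
  have "integrable (lborel \<Otimes>\<^sub>M lborel) (case_prod f)"
  proof (rule lborel_pair.Fubini_integrable)
    show "case_prod f \<in> borel_measurable (lborel \<Otimes>\<^sub>M lborel)" unfolding f_def by measurable
    have "(\<integral>u. norm (case_prod f (c, u)) \<partial>lborel) = ?i c *\<^sub>R norm (of_real (c / (c\<^sup>2 + b\<^sup>2)\<^sup>2) * J0 (of_real (c * t)))" for c
    proof (cases "c > 0")
      case True
      have "(\<integral>u. norm (case_prod f (c, u)) \<partial>lborel) = (\<integral>u. ?i u *\<^sub>R norm (H c u) \<partial>lborel)"
        using True by (simp add: f_def)
      also have "\<dots> = c / (c\<^sup>2 + b\<^sup>2)\<^sup>2 * norm (J0 (of_real (c * t)))"
        using True intnH_u by (subst integral_lborel_eq_HK(2)) auto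
      finally show ?thesis unfolding norm_mult norm_of_real using True by simp
    qed (simp add: f_def)
    moreover have "integrable lborel (\<lambda>c. ?i c *\<^sub>R norm (of_real (c / (c\<^sup>2 + b\<^sup>2)\<^sup>2) * J0 (of_real (c * t))))"
      using base_abs by (intro integral_lborel_eq_HK(1) absolutely_integrable_norm[unfolded o_def]) auto
    ultimately show "integrable lborel (\<lambda>c. \<integral>u. norm (case_prod f (c, u)) \<partial>lborel)" by (simp only:)
    have "integrable lborel (\<lambda>u. f c u)" for c
      unfolding f_def using absH_u by (intro integrable_scaleR_right integral_lborel_eq_HK(1)) auto
    then show "AE c in lborel. integrable lborel (\<lambda>u. case_prod f (c, u))" by simp
  qed
  then have swap: "(\<integral>u. (\<integral>c. f c u \<partial>lborel) \<partial>lborel) = (\<integral>c. (\<integral>u. f c u \<partial>lborel) \<partial>lborel)"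
    by (rule lborel_pair.Fubini_integral)
  have "(\<integral>u. f c u \<partial>lborel) = ?i c *\<^sub>R (of_real (c / (c\<^sup>2 + b\<^sup>2)\<^sup>2) * J0 (of_real (c * t)))" for c
    using integral_lborel_eq_HK(2)[of "H c" "{0<..}"] absH_u intH_u
    by (cases "c > 0") (simp_all add: f_def)
  then have 1: "(\<integral>c. (\<integral>u. f c u \<partial>lborel) \<partial>lborel) =
      integral {0<..} (\<lambda>c. of_real (c / (c\<^sup>2 + b\<^sup>2)\<^sup>2) * J0 (of_real (c * t)))"
    using base_abs by (subst integral_lborel_eq_HK(2)[symmetric]) auto
  \<comment> \<open>Chosen so that \<open>t\<^sup>2 / (4 * u) = w / (b\<^sup>2 * u)\<close>; the
    substitution \<open>v = b\<^sup>2 * u\<close> then yields the integrand of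
    \<open>bessel_laplace 1 w\<close>.\<close>
  define w where "w = (b * t / 2)\<^sup>2"
  have inner: "(\<integral>c. f c u \<partial>lborel) = ?i u *\<^sub>R complex_of_real (exp (- b\<^sup>2 * u - w / (b\<^sup>2 * u)) / 2)" for u
  proof (cases "u > 0")
    case True
    have W: "(\<lambda>c. of_real (c * exp (- u * c\<^sup>2)) * J0 (of_real (c * t))) absolutely_integrable_on {0<..}"
      using t has_integral_odd_gaussian_moment[OF True, of 0] by (intro absolutely_integrable_bounded_J0) auto
    have H_c: "H c u = of_real (u * exp (- b\<^sup>2 * u)) * (of_real (c * exp (- u * c\<^sup>2)) * J0 (of_real (c * t)))" for c
    proof -
      have "exp (- (c\<^sup>2 + b\<^sup>2) * u) = exp (- b\<^sup>2 * u) * exp (- u * c\<^sup>2)"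
        unfolding exp_add[symmetric] by (simp add: algebra_simps)
      then show ?thesis by (simp add: H_def mult_ac)
    qed
    have "(\<integral>c. f c u \<partial>lborel) = (\<integral>c. ?i c *\<^sub>R H c u \<partial>lborel)"
      using True by (simp add: f_def)
    also have "\<dots> = integral {0<..} (\<lambda>c. H c u)"
      unfolding H_c by (intro integral_lborel_eq_HK(2) set_integrable_mult_right W) auto
    also have "\<dots> = of_real (u * exp (- b\<^sup>2 * u)) * of_real (exp (- (t\<^sup>2 / (4 * u))) / (2 * u))"
      unfolding H_c by (rule integral_unique[OF has_integral_mult_right[OF Weber_integral[OF True]]])
    also have "\<dots> = of_real (exp (- b\<^sup>2 * u) * exp (- (t\<^sup>2 / (4 * u))) / 2)"
      using True by simp
    also have "exp (- b\<^sup>2 * u) * exp (- (t\<^sup>2 / (4 * u))) = exp (- b\<^sup>2 * u - w / (b\<^sup>2 * u))"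
      unfolding exp_add[symmetric] using b by (simp add: w_def power2_eq_square)
    finally show ?thesis using True by simp
  qed (simp add: f_def)
  have 2: "(\<integral>u. (\<integral>c. f c u \<partial>lborel) \<partial>lborel) = of_real (bessel_laplace 1 w / (2 * b\<^sup>2))"
  proof -
    have "(\<lambda>v. v powr (1 - 1) * exp (- v - w / v)) absolutely_integrable_on {0<..}"
      by (rule absolutely_integrable_bessel_laplace) (auto simp: w_def)
    then have "((\<lambda>v. v powr (1 - 1) * exp (- v - w / v)) has_integral bessel_laplace 1 w) {0<..}"
      unfolding bessel_laplace_def by (rule integrable_integral[OF set_lebesgue_integral_eq_integral(1)])
    then have "((\<lambda>u. b\<^sup>2 * ((b\<^sup>2 * u) powr (1 - 1) * exp (- (b\<^sup>2 * u) - w / (b\<^sup>2 * u)))) has_integral bessel_laplace 1 w) {0<..}"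
      by (rule has_integral_substitution_pos)
        (use b bij_betw_pos_scale[of "b\<^sup>2"] in \<open>auto intro!: derivative_eq_intros\<close>)
    from has_integral_mult_right[OF this, of "1 / (2 * b\<^sup>2)"]
    have r: "((\<lambda>u. exp (- b\<^sup>2 * u - w / (b\<^sup>2 * u)) / 2) has_integral 1 / (2 * b\<^sup>2) * bessel_laplace 1 w) {0<..}"
      by (rule has_integral_eq[rotated]) (use b in auto)
    then have "(\<lambda>u. exp (- b\<^sup>2 * u - w / (b\<^sup>2 * u)) / 2) absolutely_integrable_on {0<..}"
      by (intro nonnegative_absolutely_integrable_1) auto
    then have "(\<lambda>u. complex_of_real (exp (- b\<^sup>2 * u - w / (b\<^sup>2 * u)) / 2)) absolutely_integrable_on {0<..}"
      by (rule absolutely_integrable_linear[OF _ bounded_linear_of_real, unfolded o_def])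
    then have "(\<integral>u. ?i u *\<^sub>R complex_of_real (exp (- b\<^sup>2 * u - w / (b\<^sup>2 * u)) / 2) \<partial>lborel) =
        integral {0<..} (\<lambda>u. complex_of_real (exp (- b\<^sup>2 * u - w / (b\<^sup>2 * u)) / 2))"
      by (intro integral_lborel_eq_HK(2)) auto
    also have "\<dots> = of_real (1 / (2 * b\<^sup>2) * bessel_laplace 1 w)"
      by (rule integral_unique[OF has_integral_of_real[OF r]])
    finally show ?thesis unfolding inner by simp
  qed
  show ?thesis using 1 2 swap by (simp add: w_def)
qed

section \<open>The modified Bessel equation of order 0\<close>

lemma besselI_0_eq_J0: "besselI 0 z = J0 (\<i> * z)"
  by (simp add: besselI_def bessel_prefactor_def J0_def power_divide power_mult_distrib)

lemma has_field_derivative_besselI_0: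
  "((\<lambda>a. besselI 0 (a * x)) has_field_derivative - (\<i> * x) * J1 (\<i> * (a * x))) (at a)"
  and has_field_derivative_times_besselI_0_deriv:
  "((\<lambda>a. a * (- (\<i> * x) * J1 (\<i> * (a * x)))) has_field_derivative x\<^sup>2 * a * besselI 0 (a * x)) (at a)"
proof -
  have d: "((\<lambda>a. \<i> * (a * x)) has_field_derivative \<i> * x) (at a)"
    by (auto intro!: derivative_eq_intros)
  show "((\<lambda>a. besselI 0 (a * x)) has_field_derivative - (\<i> * x) * J1 (\<i> * (a * x))) (at a)"
    using DERIV_chain2[OF has_field_derivative_J0 d] by (simp add: besselI_0_eq_J0 mult_ac)
  have "((\<lambda>a. \<i> * (a * x) * J1 (\<i> * (a * x))) has_field_derivative
      \<i> * (a * x) * J0 (\<i> * (a * x)) * (\<i> * x)) (at a)"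
    by (rule DERIV_chain2[OF has_field_derivative_times_J1 d])
  from DERIV_minus[OF this]
  show "((\<lambda>a. a * (- (\<i> * x) * J1 (\<i> * (a * x)))) has_field_derivative x\<^sup>2 * a * besselI 0 (a * x)) (at a)"
    by (simp add: besselI_0_eq_J0 mult_ac power2_eq_square)
qed

text \<open>For the Taylor coefficients the equation says that \<open>(n + 1)\<^sup>2\<close> times
  coefficient \<open>n + 1\<close> is \<open>k\<close> times coefficient \<open>n - 1\<close>. The
  case \<open>n = 0\<close> kills the odd coefficients and \<open>G 0 = 0\<close> the even ones; the
  logarithmic second solution is excluded by holomorphy at 0. The identity theorem spreads the zero
  germ over \<open>U\<close>.\<close>

lemma regular_Bessel_ode_zero:
  assumes U: "open U" "connected U" "0 \<in> U" and zero: "G 0 = 0"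
    and d1: "\<And>a. a \<in> U \<Longrightarrow> (G has_field_derivative G1 a) (at a)"
    and d2: "\<And>a. a \<in> U \<Longrightarrow> ((\<lambda>a. a * G1 a) has_field_derivative k * a * G a) (at a)"
    and a: "a \<in> U"
  shows "G a = (0::complex)"
proof -
  have hol: "G holomorphic_on U"
    using d1 has_field_derivative_at_within unfolding holomorphic_on_def field_differentiable_def by blast
  define g where "g = fps_expansion G 0"
  have g: "G has_fps_expansion g"
    unfolding g_def by (rule has_fps_expansion_fps_expansion[OF U(1,3) hol])
  have nhds: "eventually (\<lambda>a. a \<in> U) (nhds 0)" using U by (intro eventually_nhds_in_open)
  have "(\<lambda>a. a * deriv G a) has_fps_expansion fps_X * fps_deriv g"
    by (intro fps_expansion_intros g)
  then have "deriv (\<lambda>a. a * deriv G a) has_fps_expansion fps_deriv (fps_X * fps_deriv g)"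
    by (rule has_fps_expansion_deriv)
  moreover have "eventually (\<lambda>a. deriv (\<lambda>a. a * deriv G a) a = k * a * G a) (nhds 0)"
    using nhds
  proof eventually_elim
    case (elim a)
    have "eventually (\<lambda>a. a * deriv G a = a * G1 a) (nhds a)"
      using eventually_nhds_in_open[OF U(1) elim] by eventually_elim (simp add: DERIV_imp_deriv[OF d1])
    from DERIV_cong_ev[OF refl this refl]
    have "((\<lambda>a. a * deriv G a) has_field_derivative k * a * G a) (at a)"
      using d2[OF elim] by blast
    then show ?case by (rule DERIV_imp_deriv)
  qed
  note has_fps_expansion_cong[OF this refl, THEN iffD1]
  ultimately have "(\<lambda>a. k * a * G a) has_fps_expansion fps_deriv (fps_X * fps_deriv g)" by blast
  moreover have "(\<lambda>a. k * a * G a) has_fps_expansion fps_const k * fps_X * g"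
    by (intro fps_expansion_intros g)
  ultimately have eq: "fps_deriv (fps_X * fps_deriv g) = fps_const k * fps_X * g"
    by (rule fps_expansion_unique_complex)
  have g0: "fps_nth g 0 = 0" using zero by (simp add: g_def fps_expansion_def)
  \<comment> \<open>The case \<open>n = 0\<close> is separate because \<open>n - 1\<close> is
    truncated: the constant coefficient of \<open>fps_const k * fps_X * g\<close> is 0.\<close>
  have rec: "(of_nat (Suc n))\<^sup>2 * fps_nth g (Suc n) = (if n = 0 then 0 else k * fps_nth g (n - 1))" for n
    using arg_cong[OF eq, of "\<lambda>f. fps_nth f n"]
    by (simp add: power2_eq_square mult.assoc del: fps_deriv_mult of_nat_Suc fps_deriv_linear)
  have "fps_nth g n = 0" for n
  proof (induction n rule: less_induct)
    case (less n)
    show ?case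
    proof (cases n)
      case (Suc m)
      have "(of_nat (Suc m))\<^sup>2 * fps_nth g (Suc m) = 0"
        unfolding rec[of m] using less.IH[of "m - 1"] Suc by simp
      then show ?thesis using Suc by (simp del: of_nat_Suc)
    qed (simp add: g0)
  qed
  then have "g = 0" by (simp add: fps_eq_iff)
  with g have "eventually (\<lambda>a. G a = 0) (nhds 0)"
    by (auto simp: has_fps_expansion_def)
  then obtain S where S: "open S" "0 \<in> S" "\<And>a. a \<in> S \<Longrightarrow> G a = 0"
    by (auto simp: eventually_nhds)
  show ?thesis
    by (rule analytic_continuation_open[of "S \<inter> U" U G "\<lambda>_. 0"]) (use S U hol a in \<open>auto intro: holomorphic_intros\<close>)
qed

lemma regular_Bessel_ode_unique:
  assumes U: "open U" "connected U" "0 \<in> U"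
    and d1: "\<And>a. a \<in> U \<Longrightarrow> (F has_field_derivative F1 a) (at a)"
    and d2: "\<And>a. a \<in> U \<Longrightarrow> ((\<lambda>a. a * F1 a) has_field_derivative x\<^sup>2 * a * F a) (at a)"
    and a: "a \<in> U"
  shows "F a = F 0 * besselI 0 (a * x)"
proof -
  have "F a - F 0 * besselI 0 (a * x) = 0"
  proof (rule regular_Bessel_ode_zero[OF U, where k = "x\<^sup>2" and G = "\<lambda>a. F a - F 0 * besselI 0 (a * x)"
        and ?G1.0 = "\<lambda>a. F1 a - F 0 * (- (\<i> * x) * J1 (\<i> * (a * x)))"])
    fix a assume a: "a \<in> U"
    show "((\<lambda>a. F a - F 0 * besselI 0 (a * x)) has_field_derivative
        F1 a - F 0 * (- (\<i> * x) * J1 (\<i> * (a * x)))) (at a)"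
      by (intro DERIV_diff DERIV_cmult d1 a has_field_derivative_besselI_0)
    have "((\<lambda>a. a * F1 a - F 0 * (a * (- (\<i> * x) * J1 (\<i> * (a * x))))) has_field_derivative
        x\<^sup>2 * a * F a - F 0 * (x\<^sup>2 * a * besselI 0 (a * x))) (at a)"
      by (intro DERIV_diff DERIV_cmult d2 a has_field_derivative_times_besselI_0_deriv)
    then show "((\<lambda>a. a * (F1 a - F 0 * (- (\<i> * x) * J1 (\<i> * (a * x))))) has_field_derivative
        x\<^sup>2 * a * (F a - F 0 * besselI 0 (a * x))) (at a)"
      by (simp add: algebra_simps)
  qed (use a in \<open>simp_all add: besselI_0_0\<close>)
  then show ?thesis by simp
qed

section \<open>The kernel\<close>

text \<open>The sum of the two principal logarithms is the branch from
  \<open>is_log_branch_bracket\<close>; the principal logarithm of the product may jump. The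
  variable \<open>z\<close> is complex so that derivatives in \<open>c\<close> are field
  derivatives.\<close>

definition inv_sqrt_bracket :: "complex \<Rightarrow> complex \<Rightarrow> complex \<Rightarrow> complex" where
  "inv_sqrt_bracket b a z = exp (- (Ln (z\<^sup>2 + (b + a)\<^sup>2) + Ln (z\<^sup>2 + (b - a)\<^sup>2)) / 2)"

definition slit_bracket :: "complex \<Rightarrow> complex \<Rightarrow> complex \<Rightarrow> bool" where
  "slit_bracket b a z \<longleftrightarrow> z\<^sup>2 + (b + a)\<^sup>2 \<notin> \<real>\<^sub>\<le>\<^sub>0 \<and> z\<^sup>2 + (b - a)\<^sup>2 \<notin> \<real>\<^sub>\<le>\<^sub>0"

lemma slit_bracket_of_real: "\<bar>Re a\<bar> < Re b \<Longrightarrow> slit_bracket b a (of_real c)"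
  unfolding slit_bracket_def by (intro conjI sq_plus_sq_notin_nonpos_Reals) auto

lemma inv_sqrt_bracket_square:
  assumes "slit_bracket b a z"
  shows "(inv_sqrt_bracket b a z)\<^sup>2 * ((z\<^sup>2 + (b + a)\<^sup>2) * (z\<^sup>2 + (b - a)\<^sup>2)) = 1"
proof -
  have nz: "z\<^sup>2 + (b + a)\<^sup>2 \<noteq> 0" "z\<^sup>2 + (b - a)\<^sup>2 \<noteq> 0"
    using assms unfolding slit_bracket_def by (metis nonpos_Reals_zero_I)+
  have "2 * (- w / 2) = - w" for w :: complex by simp
  then have "(inv_sqrt_bracket b a z)\<^sup>2 = exp (- (Ln (z\<^sup>2 + (b + a)\<^sup>2) + Ln (z\<^sup>2 + (b - a)\<^sup>2)))"
    unfolding inv_sqrt_bracket_def exp_double[symmetric] by (simp only:)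
  also have "\<dots> = inverse ((z\<^sup>2 + (b + a)\<^sup>2) * (z\<^sup>2 + (b - a)\<^sup>2))"
    unfolding exp_minus exp_add using nz by simp
  finally show ?thesis by (simp only: left_inverse[OF no_zero_divisors[OF nz]])
qed

text \<open>The relation \<open>(r s)\<^sup>2 * (P s * Q s) = 1\<close> clears the denominators of
  the logarithmic derivative. All derivatives of the kernel thus become polynomials times odd powers
  of \<open>r\<close>.\<close>

lemma has_field_derivative_inv_sqrt_bracket:
  assumes P: "(P has_field_derivative P') (at s)" "P s \<notin> \<real>\<^sub>\<le>\<^sub>0"
    and Q: "(Q has_field_derivative Q') (at s)" "Q s \<notin> \<real>\<^sub>\<le>\<^sub>0"
    and r: "\<And>s. r s = exp (- (Ln (P s) + Ln (Q s)) / 2)" "(r s)\<^sup>2 * (P s * Q s) = 1"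
  shows "(r has_field_derivative - ((r s) ^ 3) * (P' * Q s + P s * Q') / 2) (at s)"
proof -
  have nz: "P s \<noteq> 0" "Q s \<noteq> 0" using r(2) by auto
  have "((\<lambda>s. exp (- (Ln (P s) + Ln (Q s)) / 2)) has_field_derivative
      exp (- (Ln (P s) + Ln (Q s)) / 2) * (- (inverse (P s) * P' + inverse (Q s) * Q') / 2)) (at s)"
    by (intro DERIV_chain2[OF DERIV_exp] DERIV_cdivide DERIV_minus DERIV_add
        DERIV_chain2[OF has_field_derivative_Ln] P Q)
  also have "exp (- (Ln (P s) + Ln (Q s)) / 2) * (- (inverse (P s) * P' + inverse (Q s) * Q') / 2) =
      r s * ((r s)\<^sup>2 * (P s * Q s)) * (- (inverse (P s) * P' + inverse (Q s) * Q') / 2)"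
    by (simp only: r(2) mult_1_right r(1)[symmetric])
  also have "\<dots> = - ((r s) ^ 3) * (P' * Q s + P s * Q') / 2"
    using nz by (simp add: power2_eq_square power3_eq_cube field_simps)
  finally show ?thesis by (simp add: r(1)[abs_def])
qed

lemma has_field_derivative_inv_sqrt_bracket_param:
  assumes "slit_bracket b a z"
  shows "((\<lambda>a. inv_sqrt_bracket b a z) has_field_derivative
      - 2 * a * (a\<^sup>2 - b\<^sup>2 + z\<^sup>2) * (inv_sqrt_bracket b a z) ^ 3) (at a)"
proof -
  have "((\<lambda>a. inv_sqrt_bracket b a z) has_field_derivative - ((inv_sqrt_bracket b a z) ^ 3) *
      (2 * (b + a) * (z\<^sup>2 + (b - a)\<^sup>2) + (z\<^sup>2 + (b + a)\<^sup>2) * - (2 * (b - a))) / 2) (at a)"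
    using assms unfolding slit_bracket_def
    by (intro has_field_derivative_inv_sqrt_bracket[where P = "\<lambda>a. z\<^sup>2 + (b + a)\<^sup>2" and Q = "\<lambda>a. z\<^sup>2 + (b - a)\<^sup>2"]
        inv_sqrt_bracket_square[OF assms] inv_sqrt_bracket_def)
      (auto intro!: derivative_eq_intros)
  also have "- ((inv_sqrt_bracket b a z) ^ 3) *
      (2 * (b + a) * (z\<^sup>2 + (b - a)\<^sup>2) + (z\<^sup>2 + (b + a)\<^sup>2) * - (2 * (b - a))) / 2 =
      - 2 * a * (a\<^sup>2 - b\<^sup>2 + z\<^sup>2) * (inv_sqrt_bracket b a z) ^ 3"
  proof -
    have "2 * (b + a) * (z\<^sup>2 + (b - a)\<^sup>2) + (z\<^sup>2 + (b + a)\<^sup>2) * - (2 * (b - a)) = 4 * a * (a\<^sup>2 - b\<^sup>2 + z\<^sup>2)"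
      by (simp add: power2_eq_square algebra_simps)
    then show ?thesis by simp
  qed
  finally show ?thesis .
qed

lemma has_field_derivative_inv_sqrt_bracket_var:
  assumes "slit_bracket b a z"
  shows "((\<lambda>z. inv_sqrt_bracket b a z) has_field_derivative
      - 2 * z * (a\<^sup>2 + b\<^sup>2 + z\<^sup>2) * (inv_sqrt_bracket b a z) ^ 3) (at z)"
proof -
  have "((\<lambda>z. inv_sqrt_bracket b a z) has_field_derivative - ((inv_sqrt_bracket b a z) ^ 3) *
      (2 * z * (z\<^sup>2 + (b - a)\<^sup>2) + (z\<^sup>2 + (b + a)\<^sup>2) * (2 * z)) / 2) (at z)"
    using assms unfolding slit_bracket_def
    by (intro has_field_derivative_inv_sqrt_bracket[where P = "\<lambda>z. z\<^sup>2 + (b + a)\<^sup>2" and Q = "\<lambda>z. z\<^sup>2 + (b - a)\<^sup>2"]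
        inv_sqrt_bracket_square[OF assms] inv_sqrt_bracket_def)
      (auto intro!: derivative_eq_intros)
  also have "- ((inv_sqrt_bracket b a z) ^ 3) *
      (2 * z * (z\<^sup>2 + (b - a)\<^sup>2) + (z\<^sup>2 + (b + a)\<^sup>2) * (2 * z)) / 2 =
      - 2 * z * (a\<^sup>2 + b\<^sup>2 + z\<^sup>2) * (inv_sqrt_bracket b a z) ^ 3"
  proof -
    have "2 * z * (z\<^sup>2 + (b - a)\<^sup>2) + (z\<^sup>2 + (b + a)\<^sup>2) * (2 * z) = 4 * z * (a\<^sup>2 + b\<^sup>2 + z\<^sup>2)"
      by (simp add: power2_eq_square algebra_simps)
    then show ?thesis by simp
  qed
  finally show ?thesis .
qed

definition hankel_kernel :: "complex \<Rightarrow> complex \<Rightarrow> complex \<Rightarrow> complex" where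
  "hankel_kernel b a z = (b\<^sup>2 + z\<^sup>2 - a\<^sup>2) * (inv_sqrt_bracket b a z) ^ 3"

text \<open>Suffixes stand for partial derivatives, and \<open>times_hankel_kernel_z_z\<close> for the \<open>z\<close>-derivative of
  \<open>z * hankel_kernel_z b a z\<close>; \<open>z\<close> is the integration variable \<open>c\<close> made complex.\<close>

definition hankel_kernel_a :: "complex \<Rightarrow> complex \<Rightarrow> complex \<Rightarrow> complex" where
  "hankel_kernel_a b a z = - 2 * a * (inv_sqrt_bracket b a z) ^ 3 -
     6 * a * (a\<^sup>2 - b\<^sup>2 + z\<^sup>2) * (b\<^sup>2 + z\<^sup>2 - a\<^sup>2) * (inv_sqrt_bracket b a z) ^ 5"

definition hankel_kernel_aa :: "complex \<Rightarrow> complex \<Rightarrow> complex \<Rightarrow> complex" where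
  "hankel_kernel_aa b a z = - 2 * (inv_sqrt_bracket b a z) ^ 3 +
     (24 * a\<^sup>2 * (a\<^sup>2 - b\<^sup>2 + z\<^sup>2) - 6 * (a\<^sup>2 - b\<^sup>2 + z\<^sup>2) * (b\<^sup>2 + z\<^sup>2 - a\<^sup>2) - 12 * a\<^sup>2 * (b\<^sup>2 + z\<^sup>2 - a\<^sup>2))
       * (inv_sqrt_bracket b a z) ^ 5 +
     60 * a\<^sup>2 * (a\<^sup>2 - b\<^sup>2 + z\<^sup>2)\<^sup>2 * (b\<^sup>2 + z\<^sup>2 - a\<^sup>2) * (inv_sqrt_bracket b a z) ^ 7"

definition hankel_kernel_z :: "complex \<Rightarrow> complex \<Rightarrow> complex \<Rightarrow> complex" where
  "hankel_kernel_z b a z = 2 * z * (inv_sqrt_bracket b a z) ^ 3 -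
     6 * z * (a\<^sup>2 + b\<^sup>2 + z\<^sup>2) * (b\<^sup>2 + z\<^sup>2 - a\<^sup>2) * (inv_sqrt_bracket b a z) ^ 5"

definition times_hankel_kernel_z_z :: "complex \<Rightarrow> complex \<Rightarrow> complex \<Rightarrow> complex" where
  "times_hankel_kernel_z_z b a z = 4 * z * (inv_sqrt_bracket b a z) ^ 3 -
     (24 * z ^ 3 * (a\<^sup>2 + b\<^sup>2 + z\<^sup>2) + 12 * z * (a\<^sup>2 + b\<^sup>2 + z\<^sup>2) * (b\<^sup>2 + z\<^sup>2 - a\<^sup>2) + 12 * z ^ 3 * (b\<^sup>2 + z\<^sup>2 - a\<^sup>2))
       * (inv_sqrt_bracket b a z) ^ 5 +
     60 * z ^ 3 * (a\<^sup>2 + b\<^sup>2 + z\<^sup>2)\<^sup>2 * (b\<^sup>2 + z\<^sup>2 - a\<^sup>2) * (inv_sqrt_bracket b a z) ^ 7"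

lemma has_field_derivative_power_of_cubic:
  assumes "(r has_field_derivative d * (r s) ^ 3) (at s)"
  shows "((\<lambda>s. (r s) ^ Suc n) has_field_derivative of_nat (Suc n) * d * (r s) ^ (n + 3)) (at s)"
  using DERIV_power[OF assms, of "Suc n"] by (simp add: power_add mult_ac del: of_nat_Suc power_Suc)

lemma hankel_kernel_derivatives:
  assumes s: "slit_bracket b a z"
  shows has_field_derivative_hankel_kernel: "((\<lambda>a. hankel_kernel b a z) has_field_derivative hankel_kernel_a b a z) (at a)"
    and has_field_derivative_hankel_kernel_a: "((\<lambda>a. hankel_kernel_a b a z) has_field_derivative hankel_kernel_aa b a z) (at a)"
    and has_field_derivative_hankel_kernel_var: "((\<lambda>z. hankel_kernel b a z) has_field_derivative hankel_kernel_z b a z) (at z)"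
    and has_field_derivative_times_hankel_kernel_z: "((\<lambda>z. z * hankel_kernel_z b a z) has_field_derivative times_hankel_kernel_z_z b a z) (at z)"
proof -
  note pa = has_field_derivative_power_of_cubic[OF has_field_derivative_inv_sqrt_bracket_param[OF s]]
  note pz = has_field_derivative_power_of_cubic[OF has_field_derivative_inv_sqrt_bracket_var[OF s]]
  note a3 = pa[of 2, simplified] and a5 = pa[of 4, simplified]
  note z3 = pz[of 2, simplified] and z5 = pz[of 4, simplified]
  show "((\<lambda>a. hankel_kernel b a z) has_field_derivative hankel_kernel_a b a z) (at a)"
    unfolding hankel_kernel_def hankel_kernel_a_def
    by (rule derivative_eq_intros a3 refl)+ (simp add: algebra_simps power2_eq_square)
  show "((\<lambda>a. hankel_kernel_a b a z) has_field_derivative hankel_kernel_aa b a z) (at a)"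
    unfolding hankel_kernel_a_def hankel_kernel_aa_def
    by (rule derivative_eq_intros a3 a5 refl)+ (simp add: algebra_simps power2_eq_square)
  show "((\<lambda>z. hankel_kernel b a z) has_field_derivative hankel_kernel_z b a z) (at z)"
    unfolding hankel_kernel_def hankel_kernel_z_def
    by (rule derivative_eq_intros z3 refl)+ (simp add: algebra_simps power2_eq_square)
  show "((\<lambda>z. z * hankel_kernel_z b a z) has_field_derivative times_hankel_kernel_z_z b a z) (at z)"
    unfolding hankel_kernel_z_def times_hankel_kernel_z_z_def
    by (rule derivative_eq_intros z3 z5 refl)+ (simp add: algebra_simps power2_eq_square power3_eq_cube)
qed

text \<open>This is the Laplace equation multiplied by \<open>a * z\<close>, which makes sense at
  \<open>a = 0\<close> and \<open>z = 0\<close> too. The \<open>r ^ 3\<close> terms cancel, and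
  \<open>r ^ 5 = r ^ 7 * D\<close> reduces the rest to the polynomial identity
  \<open>E5 * D + E7 = 0\<close>.\<close>

lemma hankel_kernel_harmonic:
  assumes "slit_bracket b a z"
  shows "z * (hankel_kernel_a b a z + a * hankel_kernel_aa b a z) + a * times_hankel_kernel_z_z b a z = 0"
proof -
  define r where "r = inv_sqrt_bracket b a z"
  define D where "D = (z\<^sup>2 + (b + a)\<^sup>2) * (z\<^sup>2 + (b - a)\<^sup>2)"
  define M where "M = a\<^sup>2 - b\<^sup>2 + z\<^sup>2"
  define L where "L = a\<^sup>2 + b\<^sup>2 + z\<^sup>2"
  define N where "N = b\<^sup>2 + z\<^sup>2 - a\<^sup>2"
  define E5 where "E5 = 24 * a\<^sup>2 * M - 12 * M * N - 12 * a\<^sup>2 * N - 24 * z\<^sup>2 * L - 12 * L * N - 12 * z\<^sup>2 * N"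
  define E7 where "E7 = 60 * N * (a\<^sup>2 * M\<^sup>2 + z\<^sup>2 * L\<^sup>2)"
  have D: "r\<^sup>2 * D = 1" unfolding r_def D_def by (rule inv_sqrt_bracket_square[OF assms])
  have "E5 * D + E7 = 0"
    unfolding E5_def E7_def D_def M_def L_def N_def by algebra
  then have "r ^ 7 * (E5 * D + E7) = 0" by simp
  moreover have "r ^ 7 * (E5 * D + E7) = E5 * (r ^ 5 * (r\<^sup>2 * D)) + E7 * r ^ 7"
    by (simp add: algebra_simps flip: power_add)
  ultimately have E: "E5 * r ^ 5 + E7 * r ^ 7 = 0" unfolding D by simp
  have "z * (hankel_kernel_a b a z + a * hankel_kernel_aa b a z) + a * times_hankel_kernel_z_z b a z = a * z * (E5 * r ^ 5 + E7 * r ^ 7)"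
    unfolding hankel_kernel_a_def hankel_kernel_aa_def times_hankel_kernel_z_z_def r_def[symmetric] M_def[symmetric] L_def[symmetric] N_def[symmetric] E5_def E7_def
    by (simp add: algebra_simps power2_eq_square power3_eq_cube)
  then show ?thesis using E by simp
qed

section \<open>Decay of the kernel, uniform on bounded parts of narrower strips\<close>

lemma norm_of_real_plus_ge:
  assumes "\<rho> > 0" "\<bar>Im v\<bar> \<ge> \<rho>" "norm v \<le> R" "c \<ge> 0"
  shows "\<rho> / (1 + R + \<rho>) * (1 + c) \<le> norm (of_real c + v)"
proof -
  have R: "R \<ge> 0" using assms(3) norm_ge_zero order_trans by blast
  have 1: "\<rho> \<le> norm (of_real c + v)" using assms(2) abs_Im_le_cmod[of "of_real c + v"] by simp
  have 2: "c - R \<le> norm (of_real c + v)"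
    using norm_diff_ineq[of "complex_of_real c" v] assms by simp
  have "\<rho> * (1 + c) \<le> norm (of_real c + v) * (1 + R + \<rho>)"
  \<comment> \<open>At \<open>c = R + \<rho>\<close> the lower bounds \<open>\<rho>\<close> and
    \<open>c - R\<close> coincide; the constant is the one for which the claim is sharp
    there.\<close>
  proof (cases "c \<le> R + \<rho>")
    case True
    then have "\<rho> * (1 + c) \<le> \<rho> * (1 + R + \<rho>)" using assms(1) by simp
    also have "\<dots> \<le> norm (of_real c + v) * (1 + R + \<rho>)" using 1 R assms(1) by (intro mult_right_mono) auto
    finally show ?thesis .
  next
    case False
    have "0 \<le> (c - R - \<rho>) * (1 + R)" using False R by simp
    also have "\<dots> = (c - R) * (1 + R + \<rho>) - \<rho> * (1 + c)" by (simp add: algebra_simps)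
    finally have "\<rho> * (1 + c) \<le> (c - R) * (1 + R + \<rho>)" by simp
    also have "\<dots> \<le> norm (of_real c + v) * (1 + R + \<rho>)" using 2 R assms(1) by (intro mult_right_mono) auto
    finally show ?thesis .
  qed
  then show ?thesis using R assms(1) by (simp add: field_simps)
qed

text \<open>The sum factors as \<open>(c + \<i> * w) * (c - \<i> * w)\<close>, and both factors have
  an imaginary part of modulus \<open>\<bar>Re w\<bar>\<close>.\<close>

lemma norm_sq_plus_sq_ge:
  assumes "\<rho> > 0" "\<bar>Re w\<bar> \<ge> \<rho>" "norm w \<le> R" "c \<ge> 0"
  shows "(\<rho> / (1 + R + \<rho>))\<^sup>2 * (1 + c)\<^sup>2 \<le> norm ((of_real c)\<^sup>2 + w\<^sup>2)"
proof -
  let ?d = "\<rho> / (1 + R + \<rho>) * (1 + c)"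
  have R: "R \<ge> 0" using assms(3) norm_ge_zero order_trans by blast
  have "?d * ?d \<le> norm (of_real c + \<i> * w) * norm (of_real c + - (\<i> * w))"
    using assms R by (intro mult_mono norm_of_real_plus_ge) (auto simp: norm_mult)
  also have "\<dots> = norm ((of_real c)\<^sup>2 + w\<^sup>2)"
    unfolding norm_mult[symmetric] by (simp add: algebra_simps power2_eq_square)
  finally show ?thesis by (simp add: power2_eq_square mult_ac)
qed

lemma inv_sqrt_bracket_bound:
  assumes "\<rho> > 0" "\<bar>Re a\<bar> \<le> Re b - \<rho>" "norm a + norm b \<le> R" "c \<ge> 0"
  shows "norm (inv_sqrt_bracket b a (of_real c)) \<le> ((1 + R + \<rho>) / \<rho>)\<^sup>2 / (1 + c)\<^sup>2"
proof -
  let ?r = "norm (inv_sqrt_bracket b a (of_real c))" and ?d = "\<rho> / (1 + R + \<rho>)"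
  have R: "R \<ge> 0" using assms(3) norm_ge_zero[of a] norm_ge_zero[of b] by linarith
  have "\<bar>Re (b + a)\<bar> \<ge> \<rho>" "\<bar>Re (b - a)\<bar> \<ge> \<rho>" using assms(2) by auto
  moreover have "norm (b + a) \<le> R" "norm (b - a) \<le> R"
    using assms(3) norm_triangle_ineq[of b a] norm_triangle_ineq4[of b a] by linarith+
  ultimately have "(?d\<^sup>2 * (1 + c)\<^sup>2) * (?d\<^sup>2 * (1 + c)\<^sup>2) \<le>
      norm ((of_real c)\<^sup>2 + (b + a)\<^sup>2) * norm ((of_real c)\<^sup>2 + (b - a)\<^sup>2)"
    using assms by (intro mult_mono norm_sq_plus_sq_ge) auto
  then have "?r\<^sup>2 * ((?d\<^sup>2 * (1 + c)\<^sup>2) * (?d\<^sup>2 * (1 + c)\<^sup>2)) \<le>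
      ?r\<^sup>2 * (norm ((of_real c)\<^sup>2 + (b + a)\<^sup>2) * norm ((of_real c)\<^sup>2 + (b - a)\<^sup>2))"
    by (rule mult_left_mono) simp
  also have "\<dots> = norm ((inv_sqrt_bracket b a (of_real c))\<^sup>2 *
      (((of_real c)\<^sup>2 + (b + a)\<^sup>2) * ((of_real c)\<^sup>2 + (b - a)\<^sup>2)))"
    by (simp only: norm_mult norm_power)
  also have "\<dots> = 1"
    using inv_sqrt_bracket_square[OF slit_bracket_of_real[of a b c]] assms(1,2) by simp
  finally have "(?r * (?d\<^sup>2 * (1 + c)\<^sup>2))\<^sup>2 \<le> 1\<^sup>2" by (simp add: power2_eq_square mult_ac)
  then have "?r * (?d\<^sup>2 * (1 + c)\<^sup>2) \<le> 1" by (rule power2_le_imp_le) simp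
  then show ?thesis using assms(1,4) R by (simp add: field_simps power_divide)
qed

lemma norm_quadratic_le:
  fixes u :: complex and c :: real
  assumes "norm u \<le> A" "c \<ge> 0"
  shows "norm (u + (of_real c)\<^sup>2) \<le> (A + 1) * (1 + c)\<^sup>2"
proof -
  have A: "A \<ge> 0" using assms(1) norm_ge_zero order_trans by blast
  have "norm (u + (of_real c)\<^sup>2) \<le> A + c\<^sup>2"
    using norm_triangle_ineq[of u "(complex_of_real c)\<^sup>2"] assms(1) by (simp add: norm_power)
  also have "\<dots> \<le> A * (1 + c)\<^sup>2 + 1 * (1 + c)\<^sup>2"
  proof (rule add_mono)
    show "A \<le> A * (1 + c)\<^sup>2" using A assms(2) mult_left_mono[of 1 "(1 + c)\<^sup>2" A] by (simp add: one_le_power)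
    show "c\<^sup>2 \<le> 1 * (1 + c)\<^sup>2" unfolding mult_1 by (rule power_mono) (use assms(2) in auto)
  qed
  finally show ?thesis by (simp add: distrib_right)
qed

lemma bracket_power_simps:
  fixes s k N :: real
  assumes "s \<noteq> 0"
  shows "s\<^sup>2 * (k / s\<^sup>2) ^ 3 = k ^ 3 / s ^ 4"
    and "s\<^sup>2 * (N * s\<^sup>2) * (N * s\<^sup>2) * (k / s\<^sup>2) ^ 5 = N\<^sup>2 * k ^ 5 / s ^ 4"
proof -
  have 3: "(s\<^sup>2) ^ 3 = s ^ 4 * s\<^sup>2" and 5: "(s\<^sup>2) ^ 5 = s ^ 4 * (s\<^sup>2 * s\<^sup>2 * s\<^sup>2)"
    by (simp_all flip: power_mult power_add)
  show "s\<^sup>2 * (k / s\<^sup>2) ^ 3 = k ^ 3 / s ^ 4"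
  proof -
    have "s\<^sup>2 * (k / s\<^sup>2) ^ 3 = k ^ 3 * s\<^sup>2 / (s ^ 4 * s\<^sup>2)" unfolding power_divide 3 by (simp only: times_divide_eq_right mult.commute)
    also have "\<dots> = k ^ 3 / s ^ 4" using assms by (intro mult_divide_mult_cancel_right) simp
    finally show ?thesis .
  qed
  have "s\<^sup>2 * (N * s\<^sup>2) * (N * s\<^sup>2) * (k / s\<^sup>2) ^ 5 = (N\<^sup>2 * k ^ 5) * (s\<^sup>2 * s\<^sup>2 * s\<^sup>2) / (s ^ 4 * (s\<^sup>2 * s\<^sup>2 * s\<^sup>2))"
    unfolding power_divide 5 by (simp add: power2_eq_square[of N] mult_ac)
  also have "\<dots> = N\<^sup>2 * k ^ 5 / s ^ 4" using assms by (intro mult_divide_mult_cancel_right) simp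
  finally show "s\<^sup>2 * (N * s\<^sup>2) * (N * s\<^sup>2) * (k / s\<^sup>2) ^ 5 = N\<^sup>2 * k ^ 5 / s ^ 4" .
qed

text \<open>The polynomial factor grows at most like \<open>(1 + c)\<^sup>2\<close> against a cube
  that decays like \<open>(1 + c)\<^sup>2\<close> to the power -3. The second estimate is for the
  boundary term of the integration by parts.\<close>

lemma hankel_kernel_bound:
  fixes b :: complex
  assumes "\<rho> > 0" "norm b \<le> B" "A \<ge> 0"
  obtains K :: real where "K \<ge> 0"
    "\<And>a (c :: real). \<bar>Re a\<bar> \<le> Re b - \<rho> \<Longrightarrow> norm a \<le> A \<Longrightarrow> c \<ge> 0 \<Longrightarrow> norm (hankel_kernel b a (of_real c)) \<le> K / (1 + c) ^ 4"
    "\<And>a (c :: real). \<bar>Re a\<bar> \<le> Re b - \<rho> \<Longrightarrow> norm a \<le> A \<Longrightarrow> c \<ge> 0 \<Longrightarrow> norm (of_real c * hankel_kernel_z b a (of_real c)) \<le> K / (1 + c) ^ 4"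
proof -
  have B: "B \<ge> 0" using assms(2) norm_ge_zero order_trans by blast
  define k where "k = ((1 + (A + B) + \<rho>) / \<rho>)\<^sup>2"
  define N where "N = A\<^sup>2 + B\<^sup>2 + 1"
  have k: "k \<ge> 0" and N: "N \<ge> 0" by (auto simp: k_def N_def)
  have r: "norm (inv_sqrt_bracket b a (of_real c)) \<le> k / (1 + c)\<^sup>2"
    if "\<bar>Re a\<bar> \<le> Re b - \<rho>" "norm a \<le> A" "c \<ge> 0" for a and c :: real
    unfolding k_def using that assms by (intro inv_sqrt_bracket_bound) auto
  have q: "norm (b\<^sup>2 + (of_real c)\<^sup>2 - a\<^sup>2) \<le> N * (1 + c)\<^sup>2" "norm (a\<^sup>2 + b\<^sup>2 + (of_real c)\<^sup>2) \<le> N * (1 + c)\<^sup>2"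
    if "norm a \<le> A" "c \<ge> 0" for a :: complex and c :: real
  proof -
    have "(norm a)\<^sup>2 \<le> A\<^sup>2" "(norm b)\<^sup>2 \<le> B\<^sup>2" using that assms by (auto intro: power_mono)
    then have "norm (b\<^sup>2 - a\<^sup>2) \<le> A\<^sup>2 + B\<^sup>2" "norm (a\<^sup>2 + b\<^sup>2) \<le> A\<^sup>2 + B\<^sup>2"
      using norm_triangle_ineq4[of "b\<^sup>2" "a\<^sup>2"] norm_triangle_ineq[of "a\<^sup>2" "b\<^sup>2"] by (simp_all add: norm_power)
    from this[THEN norm_quadratic_le, OF that(2)]
    show "norm (b\<^sup>2 + (of_real c)\<^sup>2 - a\<^sup>2) \<le> N * (1 + c)\<^sup>2" "norm (a\<^sup>2 + b\<^sup>2 + (of_real c)\<^sup>2) \<le> N * (1 + c)\<^sup>2"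
      by (simp_all add: N_def algebra_simps)
  qed
  have hankel_kernel: "norm (hankel_kernel b a (of_real c)) \<le> N * k ^ 3 / (1 + c) ^ 4"
    if *: "\<bar>Re a\<bar> \<le> Re b - \<rho>" "norm a \<le> A" "c \<ge> 0" for a and c :: real
  proof -
    have "norm (hankel_kernel b a (of_real c)) \<le> (N * (1 + c)\<^sup>2) * (k / (1 + c)\<^sup>2) ^ 3"
      unfolding hankel_kernel_def norm_mult norm_power using q(1)[OF *(2,3)] r[OF *] N *(3)
      by (intro mult_mono power_mono) auto
    also have "\<dots> = N * k ^ 3 / (1 + c) ^ 4"
      using bracket_power_simps(1)[of "1 + c" k] *(3) by (simp add: mult.assoc)
    finally show ?thesis .
  qed
  have hkz: "norm (of_real c * hankel_kernel_z b a (of_real c)) \<le> (2 * k ^ 3 + 6 * N\<^sup>2 * k ^ 5) / (1 + c) ^ 4"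
    if *: "\<bar>Re a\<bar> \<le> Re b - \<rho>" "norm a \<le> A" "c \<ge> 0" for a and c :: real
  proof -
    let ?r = "inv_sqrt_bracket b a (of_real c)" and ?c = "complex_of_real c"
    have "of_real c * hankel_kernel_z b a (of_real c) = 2 * (?c\<^sup>2 * ?r ^ 3) -
        6 * (?c\<^sup>2 * (a\<^sup>2 + b\<^sup>2 + ?c\<^sup>2) * (b\<^sup>2 + ?c\<^sup>2 - a\<^sup>2) * ?r ^ 5)"
      by (simp add: hankel_kernel_z_def algebra_simps power2_eq_square)
    then have "norm (of_real c * hankel_kernel_z b a (of_real c)) \<le> 2 * norm (?c\<^sup>2 * ?r ^ 3) +
        6 * norm (?c\<^sup>2 * (a\<^sup>2 + b\<^sup>2 + ?c\<^sup>2) * (b\<^sup>2 + ?c\<^sup>2 - a\<^sup>2) * ?r ^ 5)"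
      using norm_triangle_ineq4[of "2 * (?c\<^sup>2 * ?r ^ 3)" "6 * (?c\<^sup>2 * (a\<^sup>2 + b\<^sup>2 + ?c\<^sup>2) * (b\<^sup>2 + ?c\<^sup>2 - a\<^sup>2) * ?r ^ 5)"]
      by (simp only: norm_mult norm_numeral)
    moreover have "norm (?c\<^sup>2 * ?r ^ 3) \<le> k ^ 3 / (1 + c) ^ 4"
    proof -
      have "norm (?c\<^sup>2 * ?r ^ 3) \<le> (1 + c)\<^sup>2 * (k / (1 + c)\<^sup>2) ^ 3"
        unfolding norm_mult norm_power using r[OF *] *(3) by (intro mult_mono power_mono) auto
      also have "\<dots> = k ^ 3 / (1 + c) ^ 4"
        by (rule bracket_power_simps) (use *(3) in simp)
      finally show ?thesis .
    qed
    moreover have "norm (?c\<^sup>2 * (a\<^sup>2 + b\<^sup>2 + ?c\<^sup>2) * (b\<^sup>2 + ?c\<^sup>2 - a\<^sup>2) * ?r ^ 5) \<le> N\<^sup>2 * k ^ 5 / (1 + c) ^ 4"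
    proof -
      have "norm (?c\<^sup>2 * (a\<^sup>2 + b\<^sup>2 + ?c\<^sup>2) * (b\<^sup>2 + ?c\<^sup>2 - a\<^sup>2) * ?r ^ 5) \<le>
          (1 + c)\<^sup>2 * (N * (1 + c)\<^sup>2) * (N * (1 + c)\<^sup>2) * (k / (1 + c)\<^sup>2) ^ 5"
        unfolding norm_mult norm_power using r[OF *] q[OF *(2,3)] *(3) N k
        by (intro mult_mono power_mono mult_nonneg_nonneg) auto
      also have "\<dots> = N\<^sup>2 * k ^ 5 / (1 + c) ^ 4"
        by (rule bracket_power_simps) (use *(3) in simp)
      finally show ?thesis .
    qed
    ultimately have "norm (of_real c * hankel_kernel_z b a (of_real c)) \<le>
        2 * (k ^ 3 / (1 + c) ^ 4) + 6 * (N\<^sup>2 * k ^ 5 / (1 + c) ^ 4)" by linarith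
    then show ?thesis by (simp only: add_divide_distrib times_divide_eq_right mult.assoc)
  qed
  show ?thesis
  proof (rule that[of "N * k ^ 3 + (2 * k ^ 3 + 6 * N\<^sup>2 * k ^ 5)"])
    show "0 \<le> N * k ^ 3 + (2 * k ^ 3 + 6 * N\<^sup>2 * k ^ 5)" using k N by simp
    fix a and c :: real assume *: "\<bar>Re a\<bar> \<le> Re b - \<rho>" "norm a \<le> A" "c \<ge> 0"
    have "N * k ^ 3 / (1 + c) ^ 4 \<le> (N * k ^ 3 + (2 * k ^ 3 + 6 * N\<^sup>2 * k ^ 5)) / (1 + c) ^ 4"
      "(2 * k ^ 3 + 6 * N\<^sup>2 * k ^ 5) / (1 + c) ^ 4 \<le> (N * k ^ 3 + (2 * k ^ 3 + 6 * N\<^sup>2 * k ^ 5)) / (1 + c) ^ 4"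
      using k N *(3) by (intro divide_right_mono; simp)+
    with hankel_kernel[OF *] hkz[OF *]
    show "norm (hankel_kernel b a (of_real c)) \<le> (N * k ^ 3 + (2 * k ^ 3 + 6 * N\<^sup>2 * k ^ 5)) / (1 + c) ^ 4"
      "norm (of_real c * hankel_kernel_z b a (of_real c)) \<le> (N * k ^ 3 + (2 * k ^ 3 + 6 * N\<^sup>2 * k ^ 5)) / (1 + c) ^ 4"
      by linarith+
  qed
qed

section \<open>Integrability and antiderivatives on the half-line\<close>

lemma integrable_inverse_square: "(\<lambda>c. K / (1 + c)\<^sup>2) integrable_on {0::real..}"
proof -
  have "((\<lambda>c. 1 / (1 + c)\<^sup>2) has_integral 0 - (- 1 / (1 + 0))) {0::real..}"
  proof (rule has_integral_antiderivative_to_inf[where G = "\<lambda>c. - 1 / (1 + c)"])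
    show "((\<lambda>c. - 1 / (1 + c)) has_real_derivative 1 / (1 + c)\<^sup>2) (at c)" if "c \<ge> 0" for c :: real
      using that by (auto intro!: derivative_eq_intros simp: power2_eq_square)
    show "((\<lambda>c::real. - 1 / (1 + c)) \<longlongrightarrow> 0) at_top" by real_asymp
  qed auto
  from has_integral_mult_right[OF this, of K] show ?thesis by (auto simp: integrable_on_def)
qed

lemma integrable_continuous_dominated:
  fixes f :: "real \<Rightarrow> complex"
  assumes "continuous_on {0..} f" "\<And>c. c \<ge> 0 \<Longrightarrow> norm (f c) \<le> K / (1 + c)\<^sup>2"
  shows "f integrable_on {0..}"
proof -
  have L: "{0..} \<in> sets (lebesgue :: real measure)" by (rule sets_completionI_sets) simp
  have "f absolutely_integrable_on {0..}"
    by (rule measurable_bounded_by_integrable_imp_absolutely_integrable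
        [OF continuous_imp_measurable_on_sets_lebesgue[OF assms(1) L] L integrable_inverse_square[of K]])
      (use assms(2) in auto)
  then show ?thesis by (rule set_lebesgue_integral_eq_integral(1))
qed

text \<open>For complex integrands, domination takes the place of the sign condition in
  \<open>has_integral_antiderivative_to_inf\<close>: truncate at \<open>n\<close> and pass to the
  limit.\<close>

lemma has_integral_antiderivative_dominated:
  fixes G :: "real \<Rightarrow> complex"
  assumes G: "\<And>c. c \<ge> 0 \<Longrightarrow> (G has_vector_derivative f c) (at c)" "(\<lambda>n. G (real n)) \<longlonglongrightarrow> L"
    and g: "\<And>c. c \<ge> 0 \<Longrightarrow> norm (f c) \<le> g c" "g integrable_on {0..}"
  shows "(f has_integral L - G 0) {0..}"
proof -
  define h where "h = (\<lambda>n c. if c \<in> {0..real n} then f c else 0)"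
  have h: "(h n has_integral G (real n) - G 0) {0..}" for n
    unfolding h_def by (subst has_integral_restrict)
      (auto intro!: fundamental_theorem_of_calculus has_vector_derivative_at_within G(1))
  have lim: "(\<lambda>n. h n c) \<longlonglongrightarrow> f c" if "c \<in> {0..}" for c
  proof (rule tendsto_eventually)
    obtain m where "c \<le> real m" using real_arch_simple by blast
    then have "h n c = f c" if "n \<ge> m" for n
      using that \<open>c \<in> {0..}\<close> of_nat_mono[OF that, where 'a = real] by (simp add: h_def)
    then show "eventually (\<lambda>n. h n c = f c) sequentially"
      by (rule eventually_sequentiallyI)
  qed
  have "norm (h n c) \<le> g c" if "c \<in> {0..}" for n c
    using that g(1)[of c] norm_ge_zero[of "f c"] unfolding h_def by (auto simp del: norm_ge_zero)
  note dc = dominated_convergence[OF has_integral_integrable[OF h] g(2) this lim]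
  have "(\<lambda>n. G (real n) - G 0) \<longlonglongrightarrow> L - G 0" by (intro tendsto_intros G)
  then have "integral {0..} f = L - G 0"
    using dc(2) unfolding integral_unique[OF h] by (rule LIMSEQ_unique[rotated])
  then show ?thesis using dc(1) by (simp only: has_integral_iff simp_thms)
qed

section \<open>The integral\<close>

definition hankel_integrand :: "real \<Rightarrow> complex \<Rightarrow> complex \<Rightarrow> real \<Rightarrow> complex" where
  "hankel_integrand t b a c = of_real c * J0 (of_real (c * t)) * hankel_kernel b a (of_real c)"

lemma continuous_on_of_real_arg:
  assumes "\<And>c. isCont f (of_real c :: complex)"
  shows "continuous_on S (\<lambda>c. f (of_real c))"
proof (rule continuous_on_compose2[where g = f and f = of_real])
  show "continuous_on (range of_real) f"
    using assms by (auto intro: continuous_at_imp_continuous_on)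
  show "continuous_on S (of_real :: real \<Rightarrow> complex)" by (rule continuous_on_of_real_id)
qed auto

lemma continuous_on_J0_of_real: "continuous_on S (\<lambda>c. J0 (of_real (c * t)))"
proof (rule continuous_on_compose2[where g = "\<lambda>s. J0 (of_real s)" and f = "\<lambda>c. c * t"])
  show "continuous_on UNIV (\<lambda>s. J0 (of_real s))"
    by (rule continuous_on_of_real_arg[OF DERIV_isCont[OF has_field_derivative_J0]])
qed (auto intro!: continuous_intros)

lemma norm_J0_weighted_le:
  assumes "norm u \<le> K / (1 + c) ^ 4" "c \<ge> 0" "t \<ge> 0"
  shows "norm (of_real c * J0 (of_real (c * t)) * u) \<le> K / (1 + c)\<^sup>2"
proof -
  have K: "0 \<le> K" using order_trans[OF norm_ge_zero assms(1)] assms(2) by (simp add: zero_le_divide_iff)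
  have "norm (of_real c * J0 (of_real (c * t)) * u) \<le> (1 + c) * 1 * (K / (1 + c) ^ 4)"
    unfolding norm_mult using assms norm_J0_le_1[of "c * t"] by (intro mult_mono) auto
  \<comment> \<open>One power of decay is given away to reach the majorant of
    \<open>integrable_inverse_square\<close>.\<close>
  also have "\<dots> \<le> (1 + c)\<^sup>2 * 1 * (K / (1 + c) ^ 4)"
    using K assms(2) power_increasing[of 1 2 "1 + c"] by (intro mult_right_mono) auto
  also have "\<dots> = K / (1 + c)\<^sup>2"
  proof -
    have p: "(1 + c) ^ 4 = (1 + c)\<^sup>2 * (1 + c)\<^sup>2" by (simp flip: power_add)
    have "(1 + c)\<^sup>2 * 1 * (K / (1 + c) ^ 4) = K * (1 + c)\<^sup>2 / ((1 + c)\<^sup>2 * (1 + c)\<^sup>2)"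
      by (simp only: p mult_1_right times_divide_eq_right mult.commute)
    also have "\<dots> = K / (1 + c)\<^sup>2" using assms(2) by (intro mult_divide_mult_cancel_right) simp
    finally show ?thesis .
  qed
  finally show ?thesis .
qed

lemma dominated_hankel_integrand:
  assumes t: "t \<ge> 0"
  shows "dominated_integrand {a. \<bar>Re a\<bar> < Re b} {0..} (hankel_integrand t b)"
  unfolding dominated_integrand_def
proof (intro conjI ballI)
  have loc: "\<exists>r>0. \<exists>K. cball a r \<subseteq> {a. \<bar>Re a\<bar> < Re b} \<and>
      (\<forall>z\<in>cball a r. \<forall>c\<in>{0..}. norm (hankel_integrand t b z c) \<le> K / (1 + c)\<^sup>2)"
    if a: "a \<in> {a. \<bar>Re a\<bar> < Re b}" for a
  proof -
    \<comment> \<open>Half the distance from \<open>a\<close> to the boundary of the strip: on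
      \<open>cball a r\<close> a margin \<open>r\<close> is left, the \<open>\<rho>\<close> of
      \<open>hankel_kernel_bound\<close>.\<close>
    define r where "r = (Re b - \<bar>Re a\<bar>) / 2"
    have r: "r > 0" using a by (simp add: r_def)
    obtain K where K: "\<And>z c. \<bar>Re z\<bar> \<le> Re b - r \<Longrightarrow> norm z \<le> norm a + r \<Longrightarrow> c \<ge> 0 \<Longrightarrow>
        norm (hankel_kernel b z (of_real c)) \<le> K / (1 + c) ^ 4"
      using hankel_kernel_bound[of r b "norm b" "norm a + r"] r by (metis add_nonneg_nonneg less_imp_le norm_ge_zero order_refl)
    have z: "\<bar>Re z\<bar> \<le> Re b - r" "norm z \<le> norm a + r" if "z \<in> cball a r" for z
    proof -
      have d: "norm (z - a) \<le> r" using that by (simp add: dist_norm norm_minus_commute)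
      have "\<bar>Re z - Re a\<bar> \<le> r" using abs_Re_le_cmod[of "z - a"] d by simp
      then show "\<bar>Re z\<bar> \<le> Re b - r" unfolding r_def by (simp add: field_simps abs_if split: if_splits)
      show "norm z \<le> norm a + r" using norm_triangle_sub[of z a] d by simp
    qed
    have "cball a r \<subseteq> {a. \<bar>Re a\<bar> < Re b}" using z(1) r by fastforce
    moreover have "\<forall>z\<in>cball a r. \<forall>c\<in>{0..}. norm (hankel_integrand t b z c) \<le> K / (1 + c)\<^sup>2"
    proof (intro ballI)
      fix z c assume "z \<in> cball a r" "c \<in> {0::real..}"
      then show "norm (hankel_integrand t b z c) \<le> K / (1 + c)\<^sup>2"
        unfolding hankel_integrand_def using z[of z] t by (intro norm_J0_weighted_le K) simp_all
    qed
    ultimately show ?thesis using r by blast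
  qed
  show "\<exists>r>0. \<exists>g. cball a r \<subseteq> {a. \<bar>Re a\<bar> < Re b} \<and> g integrable_on {0..} \<and>
      (\<forall>z\<in>cball a r. \<forall>c\<in>{0..}. norm (hankel_integrand t b z c) \<le> g c)"
    if "a \<in> {a. \<bar>Re a\<bar> < Re b}" for a
    using loc[OF that] integrable_inverse_square by meson
  show "hankel_integrand t b a integrable_on {0..}" if a: "a \<in> {a. \<bar>Re a\<bar> < Re b}" for a
  proof -
    obtain r K where "r > 0" "\<forall>z\<in>cball a r. \<forall>c\<in>{0..}. norm (hankel_integrand t b z c) \<le> K / (1 + c)\<^sup>2"
      using loc[OF a] by meson
    then have bound: "norm (hankel_integrand t b a c) \<le> K / (1 + c)\<^sup>2" if "c \<ge> 0" for c
      using that by (auto dest!: bspec[of _ _ a])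
    have "isCont (\<lambda>z. hankel_kernel b a z) (of_real c)" for c
      using has_field_derivative_hankel_kernel_var[OF slit_bracket_of_real] a by (intro DERIV_isCont) auto
    then have "continuous_on {0..} (hankel_integrand t b a)"
      unfolding hankel_integrand_def[abs_def]
      by (intro continuous_on_mult continuous_on_J0_of_real continuous_on_of_real_arg continuous_on_of_real continuous_on_id)
    then show ?thesis using bound by (rule integrable_continuous_dominated)
  qed
  show "(\<lambda>a. hankel_integrand t b a c) holomorphic_on {a. \<bar>Re a\<bar> < Re b}" for c
  proof -
    have "(\<lambda>a. hankel_kernel b a (of_real c)) holomorphic_on {a. \<bar>Re a\<bar> < Re b}"
      unfolding holomorphic_on_def field_differentiable_def
      using has_field_derivative_at_within[OF has_field_derivative_hankel_kernel[OF slit_bracket_of_real]] by blast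
    then show ?thesis unfolding hankel_integrand_def by (intro holomorphic_on_mult holomorphic_on_const)
  qed
qed

lemma open_strip: "open {a::complex. \<bar>Re a\<bar> < B}"
  by (intro open_Collect_less continuous_intros)

lemma connected_strip: "connected {a::complex. \<bar>Re a\<bar> < B}"
proof -
  have "{a::complex. \<bar>Re a\<bar> < B} = {a. Re a < B} \<inter> {a. Re a > - B}" by auto
  then show ?thesis
    by (metis convex_connected convex_Int convex_halfspace_Re_lt convex_halfspace_Re_gt)
qed

text \<open>Green's identity for the radial Laplacian, applied to the kernel and to \<open>J0 (c t)\<close>.\<close>

lemma hankel_integral_by_parts:
  assumes a: "\<bar>Re a\<bar> < Re b" and t: "t \<ge> 0"
    and g: "\<And>c. c \<ge> 0 \<Longrightarrow> norm (J0 (of_real (c * t)) * times_hankel_kernel_z_z b a (of_real c) +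
        of_real (t\<^sup>2 * c) * J0 (of_real (c * t)) * hankel_kernel b a (of_real c)) \<le> g c" "g integrable_on {0..}"
  shows "((\<lambda>c. J0 (of_real (c * t)) * times_hankel_kernel_z_z b a (of_real c) +
        of_real (t\<^sup>2 * c) * J0 (of_real (c * t)) * hankel_kernel b a (of_real c)) has_integral 0) {0..}"
proof -
  \<comment> \<open>The boundary term of Green's identity. In its derivative the products of
    \<open>J1\<close> and \<open>hankel_kernel_z\<close> cancel; it vanishes at \<open>c = 0\<close>
    and is of order \<open>1 / (1 + c) ^ 3\<close> at infinity.\<close>
  define W where "W = (\<lambda>z. J0 (z * of_real t) * (z * hankel_kernel_z b a z) + z * of_real t * J1 (z * of_real t) * hankel_kernel b a z)"
  have dW: "((\<lambda>c. W (of_real c)) has_vector_derivative J0 (of_real (c * t)) * times_hankel_kernel_z_z b a (of_real c) +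
      of_real (t\<^sup>2 * c) * J0 (of_real (c * t)) * hankel_kernel b a (of_real c)) (at c)" for c
  proof (rule has_vector_derivative_real_field)
    let ?z = "complex_of_real c"
    have s: "slit_bracket b a ?z" using a by (rule slit_bracket_of_real)
    have l: "((\<lambda>z. z * of_real t) has_field_derivative of_real t) (at ?z)"
      by (auto intro!: derivative_eq_intros)
    have "(W has_field_derivative
        (- J1 (?z * of_real t) * of_real t * (?z * hankel_kernel_z b a ?z) + times_hankel_kernel_z_z b a ?z * J0 (?z * of_real t)) +
        (?z * of_real t * J0 (?z * of_real t) * of_real t * hankel_kernel b a ?z + hankel_kernel_z b a ?z * (?z * of_real t * J1 (?z * of_real t)))) (at ?z)"
      unfolding W_def
      by (intro DERIV_add DERIV_mult DERIV_chain2[OF has_field_derivative_J0 l]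
          DERIV_chain2[OF has_field_derivative_times_J1 l] has_field_derivative_times_hankel_kernel_z[OF s]
          has_field_derivative_hankel_kernel_var[OF s])
    then show "(W has_field_derivative J0 (of_real (c * t)) * times_hankel_kernel_z_z b a ?z +
      of_real (t\<^sup>2 * c) * J0 (of_real (c * t)) * hankel_kernel b a ?z) (at ?z)"
      by (simp add: algebra_simps power2_eq_square)
  qed
  obtain K where K: "K \<ge> 0" "\<And>c. c \<ge> 0 \<Longrightarrow> norm (hankel_kernel b a (of_real c)) \<le> K / (1 + c) ^ 4"
      "\<And>c. c \<ge> 0 \<Longrightarrow> norm (of_real c * hankel_kernel_z b a (of_real c)) \<le> K / (1 + c) ^ 4"
  proof -
    have "Re b - \<bar>Re a\<bar> > 0" using a by simp
    from hankel_kernel_bound[OF this order_refl norm_ge_zero[of a]] obtain K where "K \<ge> 0"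
      "\<And>a' c. \<bar>Re a'\<bar> \<le> Re b - (Re b - \<bar>Re a\<bar>) \<Longrightarrow> norm a' \<le> norm a \<Longrightarrow> c \<ge> 0 \<Longrightarrow> norm (hankel_kernel b a' (of_real c)) \<le> K / (1 + c) ^ 4"
      "\<And>a' c. \<bar>Re a'\<bar> \<le> Re b - (Re b - \<bar>Re a\<bar>) \<Longrightarrow> norm a' \<le> norm a \<Longrightarrow> c \<ge> 0 \<Longrightarrow> norm (of_real c * hankel_kernel_z b a' (of_real c)) \<le> K / (1 + c) ^ 4"
      by blast
    then show ?thesis by (intro that[of K]) auto
  qed
  have bW: "norm (W (of_real c)) \<le> (1 + t) * K * (1 + c) / (1 + c) ^ 4" if c: "c \<ge> 0" for c
  proof -
    have J: "norm (J0 (of_real c * of_real t)) \<le> 1" "norm (J1 (of_real c * of_real t)) \<le> 1"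
      using norm_J0_le_1[of "c * t"] norm_J1_le_1[of "c * t"] c t by simp_all
    have "norm (J0 (of_real c * of_real t) * (of_real c * hankel_kernel_z b a (of_real c))) \<le> 1 * (K / (1 + c) ^ 4)"
      unfolding norm_mult[of "J0 _"] by (intro mult_mono J K c) auto
    moreover have "norm (of_real c * of_real t * J1 (of_real c * of_real t) * hankel_kernel b a (of_real c)) \<le> c * t * 1 * (K / (1 + c) ^ 4)"
      unfolding norm_mult using c t by (intro mult_mono J K) auto
    ultimately have "norm (W (of_real c)) \<le> (1 + c * t) * (K / (1 + c) ^ 4)"
      unfolding W_def distrib_right by (rule norm_triangle_mono[THEN order_trans]) simp
    also have "\<dots> \<le> ((1 + t) * (1 + c)) * (K / (1 + c) ^ 4)"
      using K(1) c t by (intro mult_right_mono) (auto simp: algebra_simps)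
    finally show ?thesis by (simp add: mult_ac)
  qed
  have "(\<lambda>n. (1 + t) * K * (1 + real n) / (1 + real n) ^ 4) \<longlonglongrightarrow> 0" by real_asymp
  then have "(\<lambda>n. W (of_real (real n))) \<longlonglongrightarrow> 0"
    by (rule Lim_null_comparison[rotated]) (intro always_eventually allI bW, simp)
  from has_integral_antiderivative_dominated[OF dW this g]
  show ?thesis by (simp add: W_def)
qed

lemma hankel_integral_eq:
  assumes a: "\<bar>Re a\<bar> < Re b" and t: "t \<ge> 0"
  shows "integral {0..} (hankel_integrand t b a) =
     integral {0..} (hankel_integrand t b 0) * besselI 0 (a * of_real t)"
proof -
  let ?U = "{a. \<bar>Re a\<bar> < Re b}"
  define f where "f = hankel_integrand t b"
  define f1 where "f1 = (\<lambda>a c. of_real c * J0 (of_real (c * t)) * hankel_kernel_a b a (of_real c))"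
  define f2 where "f2 = (\<lambda>a c. of_real c * J0 (of_real (c * t)) * hankel_kernel_aa b a (of_real c))"
  have df: "((\<lambda>a. f a c) has_field_derivative f1 a c) (at a)" if "a \<in> ?U" "c \<in> {0..}" for a c
    unfolding f_def f1_def hankel_integrand_def using that
    by (intro DERIV_cmult has_field_derivative_hankel_kernel slit_bracket_of_real) auto
  have df1: "((\<lambda>a. f1 a c) has_field_derivative f2 a c) (at a)" if "a \<in> ?U" "c \<in> {0..}" for a c
    unfolding f1_def f2_def using that
    by (intro DERIV_cmult has_field_derivative_hankel_kernel_a slit_bracket_of_real) auto
  have dom: "dominated_integrand ?U {0..} f" unfolding f_def by (rule dominated_hankel_integrand[OF t])
  note D = dominated_integrand_deriv[OF dom open_strip df]
  note D1 = dominated_integrand_deriv[OF D(1) open_strip df1]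
  define F1 where "F1 = (\<lambda>a. integral {0..} (f1 a))"
  have ode: "((\<lambda>a. a * F1 a) has_field_derivative (of_real t)\<^sup>2 * a * integral {0..} (f a)) (at a)"
    if a: "a \<in> ?U" for a
  proof -
    have int: "f a integrable_on {0..}" "f1 a integrable_on {0..}" "f2 a integrable_on {0..}"
      using dom D(1) D1(1) a by (auto simp: dominated_integrand_def)
    have loc: "\<exists>g. g integrable_on {0..} \<and> (\<forall>c\<in>{0..}. norm (h a c) \<le> g c)" if "dominated_integrand ?U {0..} h" for h
    proof -
      from that a obtain r g where "r > 0" "g integrable_on {0..}" "\<forall>z\<in>cball a r. \<forall>c\<in>{0..}. norm (h z c) \<le> g c"
        unfolding dominated_integrand_def by meson
      then show ?thesis by (intro exI[of _ g]) auto
    qed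
    obtain g0 where g0: "g0 integrable_on {0..}" "\<forall>c\<in>{0..}. norm (f a c) \<le> g0 c"
      using loc[OF dom] by blast
    obtain g1 where g1: "g1 integrable_on {0..}" "\<forall>c\<in>{0..}. norm (f1 a c) \<le> g1 c"
      using loc[OF D(1)] by blast
    obtain g2 where g2: "g2 integrable_on {0..}" "\<forall>c\<in>{0..}. norm (f2 a c) \<le> g2 c"
      using loc[OF D1(1)] by blast
    note g = g0(1) g1(1) g2(1) and gb = g0(2)[rule_format] g1(2)[rule_format] g2(2)[rule_format]
    let ?w = "\<lambda>c. J0 (of_real (c * t)) * times_hankel_kernel_z_z b a (of_real c) +
        of_real (t\<^sup>2 * c) * J0 (of_real (c * t)) * hankel_kernel b a (of_real c)"
    \<comment> \<open>Harmonicity trades the \<open>c\<close>-derivatives for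
      \<open>a\<close>-derivatives. This yields the differential equation and also a majorant for
      \<open>?w\<close>, out of those for \<open>f\<close>, \<open>f1\<close> and
      \<open>f2\<close>.\<close>
    have w: "a * ?w c = of_real (t\<^sup>2) * a * f a c - (f1 a c + a * f2 a c)" for c
    proof -
      have "a * times_hankel_kernel_z_z b a (of_real c) = - (of_real c * (hankel_kernel_a b a (of_real c) + a * hankel_kernel_aa b a (of_real c)))"
        using hankel_kernel_harmonic[OF slit_bracket_of_real[of a b c]] a by (simp add: eq_neg_iff_add_eq_0 add.commute)
      then have "J0 (of_real (c * t)) * (a * times_hankel_kernel_z_z b a (of_real c)) =
          J0 (of_real (c * t)) * - (of_real c * (hankel_kernel_a b a (of_real c) + a * hankel_kernel_aa b a (of_real c)))"
        by (simp only:)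
      also have "\<dots> = - (f1 a c + a * f2 a c)"
        by (simp add: f1_def f2_def algebra_simps)
      finally have "a * (J0 (of_real (c * t)) * times_hankel_kernel_z_z b a (of_real c)) = - (f1 a c + a * f2 a c)"
        by (simp only: mult.left_commute)
      then show ?thesis by (simp add: f_def hankel_integrand_def algebra_simps)
    qed
    have zero: "((\<lambda>c. a * ?w c) has_integral 0) {0..}"
    \<comment> \<open>The majorants control \<open>a * ?w c\<close>, hence \<open>?w c\<close> after
      division by \<open>norm a\<close>; for \<open>a = 0\<close> the product is identically
      0.\<close>
    proof (cases "a = 0")
      case False
      have "norm (?w c) \<le> (t\<^sup>2 * norm a * g0 c + (g1 c + norm a * g2 c)) / norm a" if "c \<ge> 0" for c
      proof -
        have "norm (a * ?w c) \<le> norm (of_real (t\<^sup>2) * a * f a c) + norm (f1 a c + a * f2 a c)"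
          unfolding w by (rule norm_triangle_ineq4)
        also have "norm (of_real (t\<^sup>2) * a * f a c) \<le> t\<^sup>2 * norm a * g0 c"
          unfolding norm_mult norm_of_real using gb(1)[of c] that by (simp add: mult_left_mono)
        also have "norm (f1 a c + a * f2 a c) \<le> g1 c + norm a * g2 c"
          using gb(2,3)[of c] that
          by (intro norm_triangle_mono) (auto simp: norm_mult mult_left_mono)
        finally have "norm (?w c) * norm a \<le> t\<^sup>2 * norm a * g0 c + (g1 c + norm a * g2 c)"
          by (simp only: norm_mult[of a] mult.commute[of "norm a" "norm (?w c)"])
        then show ?thesis using False by (subst pos_le_divide_eq) auto
      qed
      moreover have "(\<lambda>c. (t\<^sup>2 * norm a * g0 c + (g1 c + norm a * g2 c)) / norm a) integrable_on {0..}"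
        using integrable_cmul[OF g(1), of "t\<^sup>2 * norm a"] integrable_cmul[OF g(3), of "norm a"] g(2)
        unfolding real_scaleR_def by (intro integrable_on_divide integrable_add)
      ultimately have "(?w has_integral 0) {0..}"
        using a t by (intro hankel_integral_by_parts) auto
      from has_integral_mult_right[OF this, of a] show ?thesis by simp
    qed simp
    have "((\<lambda>c. of_real (t\<^sup>2) * a * f a c - (f1 a c + a * f2 a c)) has_integral
        of_real (t\<^sup>2) * a * integral {0..} (f a) - (F1 a + a * integral {0..} (f2 a))) {0..}"
      unfolding F1_def
      by (intro has_integral_diff has_integral_add has_integral_mult_right integrable_integral int)
    then have "of_real (t\<^sup>2) * a * integral {0..} (f a) - (F1 a + a * integral {0..} (f2 a)) = 0"
      using has_integral_unique zero unfolding w by blast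
    then have eq: "F1 a + a * integral {0..} (f2 a) = (of_real t)\<^sup>2 * a * integral {0..} (f a)" by simp
    have "((\<lambda>a. a * F1 a) has_field_derivative 1 * F1 a + integral {0..} (f2 a) * a) (at a)"
      unfolding F1_def by (intro DERIV_mult DERIV_ident D1(2) a)
    then show ?thesis unfolding eq[symmetric] by (simp add: mult.commute)
  qed
  have "0 \<in> ?U" using a by auto
  then show ?thesis
    using regular_Bessel_ode_unique[OF open_strip connected_strip, of "Re b" "\<lambda>a. integral {0..} (f a)" F1 "of_real t" a]
      D(2) ode a unfolding F1_def f_def by blast
qed

section \<open>Evaluation at \<open>a = 0\<close> for complex \<open>b\<close>\<close>

lemma hankel_integrand_0:
  assumes "Re b > 0"
  shows "hankel_integrand t b 0 c = of_real c * J0 (of_real (c * t)) / ((of_real c)\<^sup>2 + b\<^sup>2)\<^sup>2"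
proof -
  have s: "slit_bracket b 0 (of_real c)" using assms by (intro slit_bracket_of_real) simp
  let ?P = "(of_real c)\<^sup>2 + b\<^sup>2"
  have P: "?P \<noteq> 0" using s unfolding slit_bracket_def by (metis add.right_neutral nonpos_Reals_zero_I)
  have "inv_sqrt_bracket b 0 (of_real c) = exp (- Ln ?P)" by (simp add: inv_sqrt_bracket_def)
  also have "\<dots> = inverse ?P" unfolding exp_minus using P by simp
  finally have "hankel_kernel b 0 (of_real c) = ?P * inverse ?P ^ 3" by (simp add: hankel_kernel_def add.commute)
  also have "\<dots> = 1 / ?P\<^sup>2" using P by (simp add: power3_eq_cube power2_eq_square inverse_eq_divide)
  finally show ?thesis by (simp add: hankel_integrand_def)
qed

lemma dominated_base_integrand:
  assumes t: "t \<ge> 0"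
  shows "dominated_integrand {b. Re b > 0} {0..} (\<lambda>b c. of_real c * J0 (of_real (c * t)) / ((of_real c)\<^sup>2 + b\<^sup>2)\<^sup>2)"
  unfolding dominated_integrand_def
proof (intro conjI ballI)
  let ?f = "\<lambda>b c. of_real c * J0 (of_real (c * t)) / ((of_real c)\<^sup>2 + b\<^sup>2)\<^sup>2"
  have nz: "(of_real c)\<^sup>2 + b\<^sup>2 \<noteq> 0" if "Re b > 0" for b and c :: real
    using sq_plus_sq_notin_nonpos_Reals[of b c] that by (metis less_irrefl nonpos_Reals_zero_I)
  have loc: "\<exists>r>0. \<exists>K. cball b r \<subseteq> {b. Re b > 0} \<and> (\<forall>z\<in>cball b r. \<forall>c\<in>{0..}. norm (?f z c) \<le> K / (1 + c)\<^sup>2)"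
    if b: "b \<in> {b. Re b > 0}" for b
  proof -
    define r where "r = Re b / 2"
    define d where "d = (r / (1 + (norm b + r) + r))\<^sup>2"
    have r: "r > 0" using b by (simp add: r_def)
    have d: "d > 0" unfolding d_def using r norm_ge_zero[of b] by (intro zero_less_power divide_pos_pos) linarith+
    have z: "r \<le> Re z" "norm z \<le> norm b + r" if "z \<in> cball b r" for z
    proof -
      have d: "norm (z - b) \<le> r" using that by (simp add: dist_norm norm_minus_commute)
      have "\<bar>Re z - Re b\<bar> \<le> r" using abs_Re_le_cmod[of "z - b"] d by simp
      then show "r \<le> Re z" unfolding r_def by (simp add: field_simps abs_if split: if_splits)
      show "norm z \<le> norm b + r" using norm_triangle_sub[of z b] d by simp
    qed
    have "norm (?f z c) \<le> (1 / d\<^sup>2) / (1 + c)\<^sup>2" if zc: "z \<in> cball b r" "c \<ge> 0" for z c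
    proof -
      have "d * (1 + c)\<^sup>2 \<le> norm ((of_real c)\<^sup>2 + z\<^sup>2)"
        unfolding d_def using z[OF zc(1)] r zc by (intro norm_sq_plus_sq_ge) auto
      then have "(d * (1 + c)\<^sup>2)\<^sup>2 \<le> (norm ((of_real c)\<^sup>2 + z\<^sup>2))\<^sup>2"
        using d by (intro power_mono) auto
      moreover have "(d * (1 + c)\<^sup>2)\<^sup>2 > 0" using d zc(2) by simp
      ultimately have "1 / (norm ((of_real c)\<^sup>2 + z\<^sup>2))\<^sup>2 \<le> 1 / (d * (1 + c)\<^sup>2)\<^sup>2"
        by (intro frac_le) simp_all
      moreover have "1 / (d * (1 + c)\<^sup>2)\<^sup>2 = (1 / d\<^sup>2) / (1 + c) ^ 4"
        by (simp add: power_mult_distrib flip: power_mult)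
      ultimately have "norm (1 / ((of_real c)\<^sup>2 + z\<^sup>2)\<^sup>2) \<le> (1 / d\<^sup>2) / (1 + c) ^ 4"
        by (simp only: norm_divide norm_power norm_one)
      from norm_J0_weighted_le[OF this zc(2) t] show ?thesis by simp
    qed
    moreover have "cball b r \<subseteq> {b. Re b > 0}" using z(1) r by fastforce
    ultimately show ?thesis using r by (meson atLeast_iff)
  qed
  show "\<exists>r>0. \<exists>g. cball b r \<subseteq> {b. Re b > 0} \<and> g integrable_on {0..} \<and>
      (\<forall>z\<in>cball b r. \<forall>c\<in>{0..}. norm (?f z c) \<le> g c)" if "b \<in> {b. Re b > 0}" for b
    using loc[OF that] integrable_inverse_square by meson
  show "?f b integrable_on {0..}" if b: "b \<in> {b. Re b > 0}" for b
  proof -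
    obtain r K where "r > 0" "\<forall>z\<in>cball b r. \<forall>c\<in>{0..}. norm (?f z c) \<le> K / (1 + c)\<^sup>2"
      using loc[OF b] by meson
    then have bound: "norm (?f b c) \<le> K / (1 + c)\<^sup>2" if "c \<ge> 0" for c
      using that by (auto dest!: bspec[of _ _ b])
    have "continuous_on {0..} (?f b)"
      using nz b by (intro continuous_on_divide continuous_on_mult continuous_on_J0_of_real continuous_intros) auto
    then show ?thesis using bound by (rule integrable_continuous_dominated)
  qed
  show "(\<lambda>b. ?f b c) holomorphic_on {b. Re b > 0}" for c
    using nz by (intro holomorphic_intros) auto
qed

text \<open>Both sides are holomorphic in \<open>b\<close> on the right half-plane and agree for
  \<open>b > 0\<close> by \<open>hankel_base_eq\<close> and
  \<open>besselK_log_1_of_real\<close>.\<close>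

lemma hankel_integral_0:
  assumes b: "Re b > 0" and t: "t > 0"
  shows "integral {0..} (hankel_integrand t b 0) = of_real t / (2 * b) * besselK_log 1 (Ln b + of_real (ln t))"
proof -
  let ?f = "\<lambda>b c. of_real c * J0 (of_real (c * t)) / ((of_real c)\<^sup>2 + b\<^sup>2)\<^sup>2"
  let ?U = "{b. Re b > 0}"
  have op: "open ?U" by (rule open_halfspace_Re_gt)
  have "integral {0..} (?f b) - of_real t / (2 * b) * besselK_log 1 (Ln b + of_real (ln t)) = 0"
  proof (rule analytic_continuation[where S = ?U and U = "of_real ` {0<..}" and \<xi> = 1
        and f = "\<lambda>b. integral {0..} (?f b) - of_real t / (2 * b) * besselK_log 1 (Ln b + of_real (ln t))"])
    show "(\<lambda>b. integral {0..} (?f b) - of_real t / (2 * b) * besselK_log 1 (Ln b + of_real (ln t))) holomorphic_on ?U"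
      using t by (intro holomorphic_on_diff holomorphic_on_integral_dominated[OF dominated_base_integrand op]
          holomorphic_on_mult besselK_log_1_holomorphic holomorphic_intros)
        (auto simp: complex_nonpos_Reals_iff)
    show "connected ?U" by (intro convex_connected convex_halfspace_Re_gt)
    show "(1::complex) islimpt of_real ` {0<..}"
    proof (rule islimptI)
      fix T :: "complex set" assume T: "1 \<in> T" "open T"
      then obtain e where e: "e > 0" "ball 1 e \<subseteq> T" using openE by blast
      have "complex_of_real (1 + e / 2) \<in> T" using e by (intro subsetD[OF e(2)]) (simp add: dist_norm)
      then show "\<exists>y\<in>of_real ` {0<..}. y \<in> T \<and> y \<noteq> (1::complex)"
        using e by (intro bexI[of _ "complex_of_real (1 + e / 2)"] conjI imageI) simp_all
    qed
    fix z :: complex assume "z \<in> of_real ` {0<..}"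
    then obtain \<beta> where \<beta>: "\<beta> > 0" "z = of_real \<beta>" by auto
    have fz: "?f z = (\<lambda>c. of_real (c / (c\<^sup>2 + \<beta>\<^sup>2)\<^sup>2) * J0 (of_real (c * t)))"
      by (simp add: \<beta>(2) fun_eq_iff)
    have "integral {0..} (?f z) = integral {0<..} (?f z)"
    proof -
      have "(?f z has_integral integral {0..} (?f z)) {0..}"
        using dominated_base_integrand[of t] \<beta> t by (intro integrable_integral) (auto simp: dominated_integrand_def)
      then show ?thesis unfolding has_integral_Ici_iff_Ioi by (rule integral_unique[symmetric])
    qed
    also have "\<dots> = of_real (bessel_laplace 1 ((\<beta> * t / 2)\<^sup>2) / (2 * \<beta>\<^sup>2))"
      unfolding fz by (rule hankel_base_eq[OF \<beta>(1) t])
    finally have I: "integral {0..} (?f z) = of_real (bessel_laplace 1 ((\<beta> * t / 2)\<^sup>2) / (2 * \<beta>\<^sup>2))" .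
    have "Ln z + of_real (ln t) = of_real (ln (\<beta> * t))"
      using \<beta> t by (simp add: Ln_of_real ln_mult)
    then have "of_real t / (2 * z) * besselK_log 1 (Ln z + of_real (ln t)) =
        of_real (t / (2 * \<beta>) * (bessel_laplace 1 ((\<beta> * t / 2)\<^sup>2) / (\<beta> * t)))"
      using besselK_log_1_of_real[of "\<beta> * t"] \<beta> t by simp
    also have "t / (2 * \<beta>) * (bessel_laplace 1 ((\<beta> * t / 2)\<^sup>2) / (\<beta> * t)) = bessel_laplace 1 ((\<beta> * t / 2)\<^sup>2) / (2 * \<beta>\<^sup>2)"
      using \<beta> t by (simp add: power2_eq_square)
    finally show "integral {0..} (?f z) - of_real t / (2 * z) * besselK_log 1 (Ln z + of_real (ln t)) = 0"
      unfolding I by simp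
  qed (use op b in auto)
  moreover have "hankel_integrand t b 0 = ?f b" using hankel_integrand_0[OF b] by (simp add: fun_eq_iff)
  ultimately show ?thesis by simp
qed

lemma has_integral_hankel_integrand:
  assumes a: "\<bar>Re a\<bar> < Re b" and t: "t > 0"
  shows "(hankel_integrand t b a has_integral
    of_real t / (2 * b) * besselI 0 (a * of_real t) * besselK_log 1 (Ln b + of_real (ln t))) {0..}"
proof -
  have "hankel_integrand t b a integrable_on {0..}"
    using dominated_hankel_integrand[of t b] a t by (auto simp: dominated_integrand_def)
  moreover have "Re b > 0" using a by linarith
  ultimately show ?thesis
    using hankel_integral_eq[OF a, of t] hankel_integral_0[of b t] t
    by (simp add: has_integral_iff mult_ac)
qed

section \<open>Continuation to complex \<open>x\<close>\<close>

lemma besselI_0_holomorphic: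
  assumes "f holomorphic_on A"
  shows "(\<lambda>z. besselI 0 (f z)) holomorphic_on A"
proof -
  have "besselI 0 holomorphic_on UNIV"
    using has_field_derivative_besselI_0[of 1] unfolding holomorphic_on_def field_differentiable_def
    by (auto intro: has_field_derivative_at_within)
  from holomorphic_on_compose_gen[OF assms this] show ?thesis by (simp add: o_def)
qed

lemma branch_powr_bracket:
  assumes "\<bar>Re a\<bar> < Re b" "c \<ge> 0"
  shows "branch_powr (\<lambda>c. (a\<^sup>2 + b\<^sup>2 + (of_real c)\<^sup>2)\<^sup>2 - 4 * a\<^sup>2 * b\<^sup>2) (- 3 / 2) c =
    inv_sqrt_bracket b a (of_real c) ^ 3"
proof -
  have "- 3 / 2 * w = of_nat 3 * (- w / 2)" for w :: complex by simp
  then show ?thesis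
    unfolding branch_powr_eq[OF is_log_branch_bracket[OF assms(1)] assms(2)] inv_sqrt_bracket_def
    by (simp only: exp_of_nat_mult)
qed

theorem theorem14:
  fixes a b x :: complex
  assumes "\<bar>Re a\<bar> < Re b" and "x \<notin> \<real>\<^sub>\<le>\<^sub>0"
  shows
    "let f = (\<lambda>x c. of_real c * besselJ 0 (of_real c * x) * (b\<^sup>2 + (of_real c)\<^sup>2 - a\<^sup>2) *
               branch_powr (\<lambda>c. (a\<^sup>2 + b\<^sup>2 + (of_real c)\<^sup>2)\<^sup>2 - 4 * a\<^sup>2 * b\<^sup>2) (- 3 / 2) c)
     in (x \<in> \<real> \<longrightarrow>
           (f x has_integral x / (2 * b) * besselI 0 (a * x) * besselK 1 (b * x)) {0..}) \<and>
        has_continued_integral f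
          (x / (2 * b) * besselI 0 (a * x) * besselK_log 1 (Ln b + Ln x)) x"
proof -
  define f where "f = (\<lambda>x c. of_real c * besselJ 0 (of_real c * x) * (b\<^sup>2 + (of_real c)\<^sup>2 - a\<^sup>2) *
               branch_powr (\<lambda>c. (a\<^sup>2 + b\<^sup>2 + (of_real c)\<^sup>2)\<^sup>2 - 4 * a\<^sup>2 * b\<^sup>2) (- 3 / 2) c)"
  \<comment> \<open>The arguments of \<open>b\<close> and \<open>x\<close> may add up to more than
    \<open>pi\<close> in modulus. The sum of logarithms, unlike \<open>Ln (b * x)\<close>, stays
    holomorphic on the whole cut plane.\<close>
  define F where "F = (\<lambda>x. x / (2 * b) * besselI 0 (a * x) * besselK_log 1 (Ln b + Ln x))"
  have b: "Re b > 0" using assms(1) by linarith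
  then have "b \<noteq> 0" by auto
  have real: "(f (of_real t) has_integral F (of_real t)) {0..}" if t: "t > 0" for t
  proof (rule has_integral_eq)
    show "(hankel_integrand t b a has_integral F (of_real t)) {0..}"
      using has_integral_hankel_integrand[OF assms(1) t] t by (simp add: F_def Ln_of_real)
    show "hankel_integrand t b a c = f (of_real t) c" if "c \<in> {0..}" for c
      using branch_powr_bracket[OF assms(1), of c] that
      by (simp add: f_def hankel_integrand_def hankel_kernel_def besselJ_0_eq)
  qed
  have "F holomorphic_on (- \<real>\<^sub>\<le>\<^sub>0)"
    unfolding F_def using \<open>b \<noteq> 0\<close>
    by (intro holomorphic_on_mult besselK_log_1_holomorphic besselI_0_holomorphic holomorphic_intros) auto
  then have "has_continued_integral f (F x) x"
    unfolding has_continued_integral_def using real by blast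
  moreover have "(f x has_integral x / (2 * b) * besselI 0 (a * x) * besselK 1 (b * x)) {0..}" if "x \<in> \<real>"
  proof -
    from that obtain t where t: "x = of_real t" by (rule Reals_cases)
    then have "t > 0" using assms(2) by (simp add: not_le)
    \<comment> \<open>As \<open>Arg x = 0\<close> for positive \<open>x\<close>, the sum of the
      arguments is in the principal range, and the value of \<open>K\<^sub>1\<close> is the
      principal one.\<close>
    have "\<bar>Arg b\<bar> < pi / 2" using b \<open>b \<noteq> 0\<close> Re_Ln_pos_lt by (simp add: Arg_eq_Im_Ln)
    then have "besselK_log 1 (Ln b + Ln x) = besselK 1 (b * x)"
      using \<open>b \<noteq> 0\<close> \<open>t > 0\<close> t by (intro besselK_log_mult) auto
    then show ?thesis using real[OF \<open>t > 0\<close>] by (simp add: t F_def)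
  qed
  ultimately show ?thesis unfolding Let_def f_def[symmetric] F_def by blast
qed

end
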